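(* Let $D$ be a tournament of arbitrary (finite or infinite) size. Then there is $\mathcal C\in \mathrm{rs}(D)$ such that every strong component of $D^{\mathcal C}$ is finite.
   Context: A digraph is an oriented simple graph: no loops, and for distinct vertices $u,v$ at most one of $uv$, $vu$ is an arc. A tournament is a digraph in which for all distinct $u,v$ exactly one of $uv$, $vu$ is an arc. For a directed cycle $C$ of $D$, $D^{C}$ denotes the digraph on $V(D)$ with arc set $(A(D)\setminus A(C))\cup\{vu: uv\in A(C)\}$. The class $\mathrm{rs}(D)$ of reversal sequences of $D$ and the digraphs $D^{\mathcal C}$ for $\mathcal C\in\mathrm{rs}(D)$ are defined simultaneously by transfinite recursion: (1) the empty sequence is in $\mathrm{rs}(D)$ and $D^{\emptyset}=D$; (2) if $\mathcal C\in\mathrm{rs}(D)$ and $C^*$ is a directed cycle of $D^{\mathcal C}$, then $\mathcal C^\frown\langle C^*\rangle\in\mathrm{rs}(D)$ and $D^{\mathcal C^\frown\langle C^*\rangle}=(D^{\mathcal C})^{C^*}$; (3) if $\mathcal C_\xi\in\mathrm{rs}(D)$ ($\xi<\zeta$) is an increasing (end-extending) sequence whose union $\mathcal C$ is locally finite (each edge of $D$ lies in only finitely many cycles of $\mathcal C$), then $\mathcal C\in\mathrm{rs}(D)$ and $D^{\mathcal C}$ is the digraph on $V(D)$ in which $uv$ is an arc iff there is $\nu<\zeta$ with $uv\in A(D^{\mathcal C_\xi})$ for all $\nu<\xi<\zeta$. Strong components of a digraph are its maximal induced subdigraphs in which any two vertices are joined by directed paths in both directions. *)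

theory Defs
  imports "Graph_Theory.Graph_Theory"
begin

section \<open>Oriented simple graphs and tournaments\<close>

text \<open>
  The vertex set is an arbitrary set, finite or infinite.  The locale
  \<^locale>\<open>digraph\<close> of the library is restricted to finite digraphs and allows
  antiparallel arcs, hence the following locales.
\<close>

locale oriented_graph = pair_loopfree_digraph D for D :: "'a pair_pre_digraph" +
  assumes no_antiparallel: "(u, v) \<in> parcs D \<Longrightarrow> (v, u) \<notin> parcs D"

locale tournament = oriented_graph +
  assumes total_arcs:
    "\<lbrakk>u \<in> pverts D; v \<in> pverts D; u \<noteq> v\<rbrakk> \<Longrightarrow> (u, v) \<in> parcs D \<or> (v, u) \<in> parcs D"

section \<open>Reversal sequences\<close>

text \<open>
  A directed cycle is given by the list of its arcs (\<^const>\<open>pre_digraph.cycle\<close>);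
  reversing it and local finiteness depend only on the set of these arcs.
\<close>

definition reverse_cycle ::
  "'a pair_pre_digraph \<Rightarrow> ('a \<times> 'a) awalk \<Rightarrow> 'a pair_pre_digraph" where
  "reverse_cycle D Z =
     \<lparr>pverts = pverts D, parcs = (parcs D - set Z) \<union> {(v, u) | u v. (u, v) \<in> set Z}\<rparr>"

text \<open>
  A transfinite sequence of cycles of length \<open>\<alpha>\<close> is a map with domain \<open>{..<\<alpha>}\<close>, where
  the ordinals are represented by the elements of a well-ordered type \<open>'i\<close>.  One such
  sequence is end-extended by another if and only if \<open>\<subseteq>\<^sub>m\<close> holds.
\<close>

type_synonym ('i, 'a) cycle_seq = "'i \<Rightarrow> ('a \<times> 'a) awalk option"

text \<open>
  The positions of the cycles that contain the edge joining \<open>u\<close> and \<open>v\<close>, in whichever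
  direction the cycle traverses it: the direction of an edge of \<open>D\<close> may have changed by
  the time the cycle is reversed.  A cycle that occurs repeatedly is counted each time.
\<close>

definition positions :: "('i, 'a) cycle_seq \<Rightarrow> 'a \<Rightarrow> 'a \<Rightarrow> 'i set" where
  "positions C u v = {i. \<exists>Z. C i = Some Z \<and> ((u, v) \<in> set Z \<or> (v, u) \<in> set Z)}"

definition locally_finite :: "'a pair_pre_digraph \<Rightarrow> ('i, 'a) cycle_seq \<Rightarrow> bool" where
  "locally_finite D C \<longleftrightarrow> (\<forall>(u, v) \<in> parcs D. finite (positions C u v))"

definition limit_ordinal :: "'i::wellorder \<Rightarrow> bool" where
  "limit_ordinal \<zeta> \<longleftrightarrow> (\<exists>\<xi>. \<xi> < \<zeta>) \<and> (\<forall>\<xi><\<zeta>. \<exists>\<eta><\<zeta>. \<xi> < \<eta>)"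

definition limit_digraph ::
  "'a pair_pre_digraph \<Rightarrow> 'i::wellorder \<Rightarrow> ('i \<Rightarrow> 'a pair_pre_digraph) \<Rightarrow> 'a pair_pre_digraph" where
  "limit_digraph D \<zeta> E =
     \<lparr>pverts = pverts D,
      parcs = {(u, v). \<exists>\<nu><\<zeta>. \<forall>\<xi>. \<nu> < \<xi> \<and> \<xi> < \<zeta> \<longrightarrow> (u, v) \<in> parcs (E \<xi>)}\<rparr>"

text \<open>
  \<open>reversal D C E\<close> is the simultaneous definition of \<open>C \<in> rs D\<close> and \<open>D\<^sup>C = E\<close>.
\<close>

inductive reversal ::
  "'a pair_pre_digraph \<Rightarrow> ('i::wellorder, 'a) cycle_seq \<Rightarrow> 'a pair_pre_digraph \<Rightarrow> bool"
  for D :: "'a pair_pre_digraph" where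
  empty: "reversal D Map.empty D"
| append: "\<lbrakk>reversal D C E; dom C = {..<\<alpha>}; pre_digraph.cycle (with_proj E) Z\<rbrakk>
    \<Longrightarrow> reversal D (C(\<alpha> \<mapsto> Z)) (reverse_cycle E Z)"
| limit: "\<lbrakk>limit_ordinal (\<zeta> :: 'i);
     \<And>\<xi>. \<xi> < \<zeta> \<Longrightarrow> reversal D (Cs \<xi>) (Es \<xi>);
     \<And>\<xi> \<eta>. \<lbrakk>\<xi> < \<eta>; \<eta> < \<zeta>\<rbrakk> \<Longrightarrow> Cs \<xi> \<subseteq>\<^sub>m Cs \<eta>;
     Map.graph C = (\<Union>\<xi>\<in>{..<\<zeta>}. Map.graph (Cs \<xi>));
     locally_finite D C\<rbrakk>
    \<Longrightarrow> reversal D C (limit_digraph D \<zeta> Es)"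

definition rs :: "'a pair_pre_digraph \<Rightarrow> ('i::wellorder, 'a) cycle_seq set" where
  "rs D = {C. \<exists>E. reversal D C E}"

definition reverse_seq ::
  "'a pair_pre_digraph \<Rightarrow> ('i::wellorder, 'a) cycle_seq \<Rightarrow> 'a pair_pre_digraph" where
  "reverse_seq D C = (THE E. reversal D C E)"

section \<open>The digraph obtained from a reversal sequence is well-defined\<close>

text \<open>
  The arc between two vertices is reversed as often as the edge lies on a cycle.
\<close>

definition parity_digraph ::
  "'a pair_pre_digraph \<Rightarrow> ('i, 'a) cycle_seq \<Rightarrow> 'a pair_pre_digraph" where
  "parity_digraph D C =
     \<lparr>pverts = pverts D,
      parcs = {(u, v). if even (card (positions C u v)) then (u, v) \<in> parcs D else (v, u) \<in> parcs D}\<rparr>"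

lemma pair_pre_digraph_eqI:
  fixes G H :: "'a pair_pre_digraph"
  assumes "pverts G = pverts H" "\<And>u v. (u, v) \<in> parcs G \<longleftrightarrow> (u, v) \<in> parcs H"
  shows "G = H"
proof -
  have "parcs G = parcs H" using assms(2) by auto
  with assms(1) show ?thesis by simp
qed

lemma positions_commute: "positions C u v = positions C v u"
  by (auto simp: positions_def)

lemma cycle_subset_parcs: "pre_digraph.cycle (with_proj E) Z \<Longrightarrow> set Z \<subseteq> parcs E"
  by (auto simp: pre_digraph.cycle_def pre_digraph.awalk_def)

lemma cycle_nonempty: "pre_digraph.cycle (with_proj E) Z \<Longrightarrow> Z \<noteq> []"
  by (auto simp: pre_digraph.cycle_def)

lemma reversal_invariant:
  fixes C :: "('i::wellorder, 'a) cycle_seq"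
  assumes "oriented_graph D" and "reversal D C E"
  shows "E = parity_digraph D C
    \<and> (\<forall>u v. finite (positions C u v))
    \<and> (\<forall>i Z. C i = Some Z \<longrightarrow> Z \<noteq> [] \<and> (\<forall>(u, v) \<in> set Z. (u, v) \<in> parcs D \<or> (v, u) \<in> parcs D))"
  using assms(2)
proof (induction rule: reversal.induct)
  case empty
  show ?case by (auto simp: parity_digraph_def positions_def)
next
  case (append C E \<alpha> Z)
  interpret oriented_graph D by fact
  have E: "E = parity_digraph D C" and fin: "\<And>u v. finite (positions C u v)"
    using append.IH by auto
  have Z: "set Z \<subseteq> parcs E" "Z \<noteq> []"
    using append.hyps cycle_subset_parcs cycle_nonempty by blast+
  have new: "\<alpha> \<notin> positions C u v" for u v
  proof -
    have "\<alpha> \<notin> dom C" using append.hyps by simp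
    then show ?thesis by (auto simp: positions_def)
  qed
  have "C \<alpha> = None" using append.hyps by (metis lessThan_iff less_irrefl domIff)
  then have pos: "positions (C(\<alpha> \<mapsto> Z)) u v
      = (if (u, v) \<in> set Z \<or> (v, u) \<in> set Z then insert \<alpha> (positions C u v) else positions C u v)" for u v
    by (auto simp: positions_def)
  have arcE: "(u, v) \<in> parcs E \<longleftrightarrow>
      (if even (card (positions C u v)) then (u, v) \<in> parcs D else (v, u) \<in> parcs D)" for u v
    by (simp add: E parity_digraph_def)
  have anti: "(v, u) \<notin> parcs E" if "(u, v) \<in> parcs E" for u v
    using that no_antiparallel[of u v] no_antiparallel[of v u]
    by (auto simp: arcE positions_commute[of C v u] split: if_splits)
  have "(u, v) \<in> parcs (reverse_cycle E Z) \<longleftrightarrow> (u, v) \<in> parcs (parity_digraph D (C(\<alpha> \<mapsto> Z)))" for u v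
  proof -
    have 1: "(u, v) \<in> parcs (reverse_cycle E Z) \<longleftrightarrow> ((u, v) \<in> parcs E \<and> (u, v) \<notin> set Z) \<or> (v, u) \<in> set Z"
      by (auto simp: reverse_cycle_def)
    have 2: "(u, v) \<in> parcs (parity_digraph D (C(\<alpha> \<mapsto> Z))) \<longleftrightarrow>
      (if (u, v) \<in> set Z \<or> (v, u) \<in> set Z then (v, u) \<in> parcs E else (u, v) \<in> parcs E)"
      using arcE[of u v] arcE[of v u] positions_commute[of C v u]
      by (simp add: parity_digraph_def pos fin new)
    show ?thesis unfolding 1 2 using Z anti[of u v] anti[of v u] by auto
  qed
  then have "reverse_cycle E Z = parity_digraph D (C(\<alpha> \<mapsto> Z))"
    by (intro pair_pre_digraph_eqI) (simp_all add: reverse_cycle_def parity_digraph_def E)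
  moreover have "(u, v) \<in> parcs D \<or> (v, u) \<in> parcs D" if "(u, v) \<in> set Z" for u v
    using that Z arcE[of u v] by (auto split: if_splits)
  moreover have "finite (positions (C(\<alpha> \<mapsto> Z)) u v)" for u v
    by (simp add: pos fin)
  moreover have "C i = Some Y \<Longrightarrow>
      Y \<noteq> [] \<and> (\<forall>(u, v) \<in> set Y. (u, v) \<in> parcs D \<or> (v, u) \<in> parcs D)" for i Y
    using append.IH by blast
  ultimately show ?case using Z(2) by (auto simp del: fun_upd_apply simp: fun_upd_def split: if_splits)
next
  case (limit \<zeta> Cs Es C)
  interpret oriented_graph D by fact
  have C_iff: "C i = Some Z \<longleftrightarrow> (\<exists>\<xi><\<zeta>. Cs \<xi> i = Some Z)" for i Z
  proof -
    have "C i = Some Z \<longleftrightarrow> (i, Z) \<in> Map.graph C" by (simp add: Map.graph_def)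
    also have "\<dots> \<longleftrightarrow> (\<exists>\<xi><\<zeta>. (i, Z) \<in> Map.graph (Cs \<xi>))"
      unfolding limit.hyps(4) by auto
    finally show ?thesis by (simp add: Map.graph_def)
  qed
  have mono: "Cs \<eta> i = Some Z" if "Cs \<xi> i = Some Z" "\<xi> \<le> \<eta>" "\<eta> < \<zeta>" for \<xi> \<eta> i Z
    using that limit.hyps(3)[of \<xi> \<eta>] by (cases "\<xi> = \<eta>") (force simp: map_le_def dom_def)+
  have edges: "Z \<noteq> [] \<and> (\<forall>(u, v) \<in> set Z. (u, v) \<in> parcs D \<or> (v, u) \<in> parcs D)"
    if "C i = Some Z" for i Z
    using that limit.IH unfolding C_iff by blast
  have fin: "finite (positions C u v)" for u v
  proof (cases "(u, v) \<in> parcs D \<or> (v, u) \<in> parcs D")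
    case True
    then show ?thesis using limit.hyps positions_commute[of C u v]
      by (auto simp: locally_finite_def)
  next
    case False
    then have "positions C u v = {}" using edges by (fastforce simp: positions_def)
    then show ?thesis by simp
  qed
  have stable: "\<exists>\<nu><\<zeta>. \<forall>\<xi>. \<nu> \<le> \<xi> \<and> \<xi> < \<zeta> \<longrightarrow> positions (Cs \<xi>) u v = positions C u v" for u v
  proof -
    have agree: "\<exists>\<nu><\<zeta>. \<forall>i\<in>F. C i = Cs \<nu> i" if "finite F" "F \<subseteq> dom C" for F
      using that
    proof (induction F)
      case empty
      then show ?case using limit.hyps(1) by (auto simp: limit_ordinal_def)
    next
      case (insert i F)
      then obtain \<nu> where \<nu>: "\<nu> < \<zeta>" "\<forall>i\<in>F. C i = Cs \<nu> i" by auto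
      from insert.prems obtain Z where Z: "C i = Some Z" by auto
      then obtain \<mu> where \<mu>: "\<mu> < \<zeta>" "Cs \<mu> i = Some Z" by (auto simp: C_iff)
      have "C j = Cs (max \<nu> \<mu>) j" if "j \<in> F" for j
      proof -
        from that insert.prems obtain Y where "C j = Some Y" by auto
        with that \<nu> \<mu> mono[of \<nu> j Y "max \<nu> \<mu>"] show ?thesis by auto
      qed
      moreover have "C i = Cs (max \<nu> \<mu>) i"
        using Z \<mu> \<nu> mono[of \<mu> i Z "max \<nu> \<mu>"] by auto
      ultimately show ?case using \<nu> \<mu> by (intro exI[of _ "max \<nu> \<mu>"]) auto
    qed
    have "positions C u v \<subseteq> dom C" by (auto simp: positions_def)
    from agree[OF fin this]
    obtain \<nu> where \<nu>: "\<nu> < \<zeta>" "\<forall>i\<in>positions C u v. C i = Cs \<nu> i"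
      by (elim exE conjE)
    have "positions (Cs \<xi>) u v = positions C u v" if "\<nu> \<le> \<xi>" "\<xi> < \<zeta>" for \<xi>
    proof (intro equalityI subsetI)
      fix i assume "i \<in> positions (Cs \<xi>) u v"
      then obtain Z where "Cs \<xi> i = Some Z" and Z: "(u, v) \<in> set Z \<or> (v, u) \<in> set Z"
        by (auto simp: positions_def)
      then have "C i = Some Z" using that C_iff by blast
      with Z show "i \<in> positions C u v" by (simp add: positions_def)
    next
      fix i assume i: "i \<in> positions C u v"
      then obtain Z where "C i = Some Z" "(u, v) \<in> set Z \<or> (v, u) \<in> set Z"
        by (auto simp: positions_def)
      moreover have "Cs \<nu> i = C i" using \<nu> i by simp
      ultimately show "i \<in> positions (Cs \<xi>) u v"
        using mono[of \<nu> i Z \<xi>] that by (auto simp: positions_def)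
    qed
    with \<nu> show ?thesis by blast
  qed
  have "(u, v) \<in> parcs (limit_digraph D \<zeta> Es) \<longleftrightarrow> (u, v) \<in> parcs (parity_digraph D C)" for u v
  proof -
    obtain \<nu> where \<nu>: "\<nu> < \<zeta>"
      "\<And>\<xi>. \<lbrakk>\<nu> \<le> \<xi>; \<xi> < \<zeta>\<rbrakk> \<Longrightarrow> positions (Cs \<xi>) u v = positions C u v"
      using stable by blast
    have same: "(u, v) \<in> parcs (Es \<xi>) \<longleftrightarrow> (u, v) \<in> parcs (parity_digraph D C)"
      if "\<nu> \<le> \<xi>" "\<xi> < \<zeta>" for \<xi>
    proof -
      have "Es \<xi> = parity_digraph D (Cs \<xi>)" using limit.IH that by blast
      then show ?thesis using \<nu> that by (simp add: parity_digraph_def)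
    qed
    show ?thesis
    proof
      assume "(u, v) \<in> parcs (limit_digraph D \<zeta> Es)"
      then obtain \<mu> where \<mu>: "\<mu> < \<zeta>" "\<And>\<xi>. \<lbrakk>\<mu> < \<xi>; \<xi> < \<zeta>\<rbrakk> \<Longrightarrow> (u, v) \<in> parcs (Es \<xi>)"
        by (auto simp: limit_digraph_def)
      obtain \<xi> where "max \<mu> \<nu> < \<xi>" "\<xi> < \<zeta>"
        using limit.hyps(1) \<mu> \<nu> by (metis limit_ordinal_def max_less_iff_conj)
      then show "(u, v) \<in> parcs (parity_digraph D C)" using \<mu>(2)[of \<xi>] same[of \<xi>] by auto
    next
      assume "(u, v) \<in> parcs (parity_digraph D C)"
      then show "(u, v) \<in> parcs (limit_digraph D \<zeta> Es)"
        using \<nu>(1) same by (auto simp: limit_digraph_def intro!: exI[of _ \<nu>])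
    qed
  qed
  then have "limit_digraph D \<zeta> Es = parity_digraph D C"
    by (intro pair_pre_digraph_eqI) (simp_all add: limit_digraph_def parity_digraph_def)
  with edges fin show ?case by blast
qed

lemma reversal_unique:
  assumes "oriented_graph D" "reversal D C E" "reversal D C E'"
  shows "E = E'"
  using reversal_invariant[OF assms(1,2)] reversal_invariant[OF assms(1,3)] by simp

lemma reverse_seq_eq:
  assumes "oriented_graph D" "reversal D C E"
  shows "reverse_seq D C = E"
  unfolding reverse_seq_def using assms reversal_unique by (blast intro: the_equality)

lemma oriented_graph_reverse_seq:
  assumes "oriented_graph D" "C \<in> rs D"
  shows "oriented_graph (reverse_seq D C)"
proof -
  interpret oriented_graph D by fact
  obtain E where "reversal D C E" using assms by (auto simp: rs_def)
  then have "reverse_seq D C = parity_digraph D C"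
    using reversal_invariant[OF assms(1)] reverse_seq_eq[OF assms(1)] by blast
  moreover have "oriented_graph (parity_digraph D C)"
  proof
    fix u v assume "(u, v) \<in> parcs (parity_digraph D C)"
    then show "(v, u) \<notin> parcs (parity_digraph D C)"
      using no_antiparallel[of u v] no_antiparallel[of v u] positions_commute[of C u v]
      by (auto simp: parity_digraph_def split: if_splits)
  next
    fix e assume "e \<in> parcs (parity_digraph D C)"
    then show "fst e \<in> pverts (parity_digraph D C)" "snd e \<in> pverts (parity_digraph D C)"
      "fst e \<noteq> snd e"
      by (auto simp: parity_digraph_def in_arcsD1 in_arcsD2 dest: pair_no_loops split: if_splits)
  qed
  ultimately show ?thesis by simp
qed

section \<open>The ordinals used as lengths\<close>

text \<open>
  A member of \<^const>\<open>rs\<close> for a digraph on \<open>'a\<close> has at most \<open>|'a \<times> 'a \<times> nat|\<close> terms,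
  over whichever well-ordered type its positions range.
\<close>

lemma card_dom_reversal:
  fixes D :: "'a pair_pre_digraph" and C :: "('i::wellorder, 'a) cycle_seq"
  assumes "oriented_graph D" "C \<in> rs D"
  shows "\<exists>f :: 'i \<Rightarrow> 'a \<times> 'a \<times> nat. inj_on f (dom C)"
proof -
  have inv: "finite (positions C u v)" "C i = Some Z \<Longrightarrow> Z \<noteq> []" for u v i Z
    using assms(2) reversal_invariant[OF assms(1)] unfolding rs_def by blast+
  obtain g :: "'a \<Rightarrow> 'a \<Rightarrow> 'i \<Rightarrow> nat" where g: "\<And>u v. inj_on (g u v) (positions C u v)"
    using finite_imp_inj_to_nat_seg[OF inv(1)] by metis
  define a where "a i = hd (the (C i))" for i
  have a: "i \<in> positions C (fst (a i)) (snd (a i))" if "i \<in> dom C" for i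
    using that inv(2) by (force simp: positions_def a_def)
  have "inj_on (\<lambda>i. (fst (a i), snd (a i), g (fst (a i)) (snd (a i)) i)) (dom C)"
  proof (rule inj_onI)
    fix i j assume ij: "i \<in> dom C" "j \<in> dom C"
      and eq: "(fst (a i), snd (a i), g (fst (a i)) (snd (a i)) i)
        = (fst (a j), snd (a j), g (fst (a j)) (snd (a j)) j)"
    then have "g (fst (a i)) (snd (a i)) i = g (fst (a i)) (snd (a i)) j" by (metis prod.inject)
    moreover have "j \<in> positions C (fst (a i)) (snd (a i))" using a[OF ij(2)] eq by simp
    ultimately show "i = j" using g a[OF ij(1)] by (meson inj_onD)
  qed
  then show ?thesis by blast
qed

text \<open>
  Therefore all lengths of members of \<^const>\<open>rs\<close> occur among the ordinals below the
  initial ordinal of the power set of \<open>'a \<times> 'a \<times> nat\<close>: the order type of an ordinal of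
  cardinality at most \<open>\<kappa>\<close> is below \<open>\<kappa>\<^sup>+\<close>, which is at most \<open>2\<^sup>\<kappa>\<close>.  The following type is
  this initial ordinal.
\<close>

typedef 'a ordinals = "UNIV :: ('a \<times> 'a \<times> nat) set set" ..

setup_lifting type_definition_ordinals

instantiation ordinals :: (type) wellorder
begin

lift_definition less_eq_ordinals :: "'a ordinals \<Rightarrow> 'a ordinals \<Rightarrow> bool"
  is "\<lambda>x y. (x, y) \<in> card_of UNIV" .

definition less_ordinals :: "'a ordinals \<Rightarrow> 'a ordinals \<Rightarrow> bool" where
  "less_ordinals x y \<longleftrightarrow> x \<le> y \<and> \<not> y \<le> x"

instance
proof -
  let ?r = "card_of (UNIV :: ('a \<times> 'a \<times> nat) set set)"
  have wo: "well_order_on UNIV ?r" by (rule card_of_well_order_on)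
  then have lin: "refl_on UNIV ?r" "trans ?r" "antisym ?r" "total_on UNIV ?r" "wf (?r - Id)"
    by (auto simp: well_order_on_def linear_order_on_def partial_order_on_def preorder_on_def)
  have refl: "x \<le> x" for x :: "'a ordinals"
    by transfer (use lin(1) in \<open>auto simp: refl_on_def\<close>)
  have trans: "x \<le> y \<Longrightarrow> y \<le> z \<Longrightarrow> x \<le> z" for x y z :: "'a ordinals"
    by transfer (use lin(2) in \<open>blast dest: transD\<close>)
  have anti: "x \<le> y \<Longrightarrow> y \<le> x \<Longrightarrow> x = y" for x y :: "'a ordinals"
    by transfer (use lin(3) in \<open>blast dest: antisymD\<close>)
  have tot: "x \<le> y \<or> y \<le> x" for x y :: "'a ordinals"
    by transfer (use lin(1,4) in \<open>metis UNIV_I refl_on_def total_on_def\<close>)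
  have "wf {(x, y :: 'a ordinals). x < y}"
  proof (rule wf_subset[OF wf_inv_image[OF lin(5), of Rep_ordinals]])
    show "{(x, y :: 'a ordinals). x < y} \<subseteq> inv_image (?r - Id) Rep_ordinals"
      using refl by (auto simp: less_ordinals_def inv_image_def less_eq_ordinals.rep_eq Rep_ordinals_inject)
  qed
  then have ind: "(\<And>x. (\<And>y. y < x \<Longrightarrow> P y) \<Longrightarrow> P x) \<Longrightarrow> P a" for P and a :: "'a ordinals"
    by (rule wf_induct_rule) auto
  show "OFCLASS('a ordinals, wellorder_class)"
  proof (standard, goal_cases)
    case (1 x y)
    show ?case by (fact less_ordinals_def)
  next
    case (2 x)
    show ?case by (fact refl)
  next
    case (3 x y z)
    then show ?case by (fact trans)
  next
    case (4 x y)
    then show ?case by (fact anti)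
  next
    case (5 x y)
    show ?case by (fact tot)
  next
    case (6 P a)
    then show ?case by (fact ind)
  qed
qed

end

lemma ordinals_no_greatest: "\<exists>\<beta>. (\<alpha> :: 'a ordinals) < \<beta>"
proof -
  let ?r = "card_of (UNIV :: ('a \<times> 'a \<times> nat) set set)"
  have "infinite (UNIV :: ('a \<times> 'a \<times> nat) set set)"
    by (simp add: Finite_Set.finite_set finite_prod)
  then obtain b where "Rep_ordinals \<alpha> \<noteq> b" "(Rep_ordinals \<alpha>, b) \<in> ?r"
    using infinite_Card_order_limit[OF card_of_Card_order, of "UNIV :: ('a \<times> 'a \<times> nat) set set" "Rep_ordinals \<alpha>"]
    by (auto simp: Field_card_of)
  then have "\<alpha> \<le> Abs_ordinals b" "\<alpha> \<noteq> Abs_ordinals b"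
    by (auto simp: less_eq_ordinals.rep_eq Abs_ordinals_inverse)
  then show ?thesis by (auto intro: le_neq_trans)
qed

end

theory Submission
  imports Defs
begin

text \<open>
  The proof is by induction on the size \<open>\<mu>\<close> of the vertex set; it suffices to split an infinite
  tournament into strong components of size less than \<open>\<mu>\<close>.

  An arc from \<open>b\<close> to \<open>a\<close> that lies on infinitely many cycles which are otherwise arc-disjoint can
  be reversed without changing anything else: reverse it along a path \<open>P\<^sub>0\<close> from \<open>a\<close> to \<open>b\<close>, restore
  \<open>P\<^sub>0\<close> by reversing \<open>P\<^sub>1\<close>, and so on.  Hence a set of at most \<open>\<mu>\<close> arcs can be reversed
  if no fewer than \<open>\<mu>\<close> arcs separate the ends of any of them.

  Call a cut small if fewer than \<open>\<mu>\<close> arcs leave it.  In a tournament, two small cuts \<open>X\<close>, \<open>Y\<close> with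
  \<open>X - Y\<close> and \<open>Y - X\<close> nonempty differ in fewer than \<open>\<mu>\<close> vertices, so being separated by small cuts
  in both directions (or equal) is an equivalence relation.  All arcs between different classes can
  be directed along one linear order.  What remains are tournaments with a small cut \<open>X\<close>
  such that outdegrees outside \<open>X\<close> and indegrees inside \<open>X\<close> are less than \<open>\<mu>\<close>.

  The two sides are treated in turn.  Let \<open>W\<close> be the complement of \<open>X\<close>.  For uncountable \<open>\<mu>\<close>,
  the arcs \<open>(v, z)\<close> for which \<open>z\<close> has larger outdegree into \<open>W\<close> than \<open>v\<close> can be
  reversed, by means of paths of length two; afterwards a component meets \<open>W\<close> in at most as many
  vertices as these degrees.  For countable \<open>\<mu>\<close>, a finite set that minimises the number of arcs
  leaving it is cut off by reversing rays that start in it, and such sets exhaust \<open>W\<close>.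
\<close>

unbundle cardinal_syntax

section \<open>Locally finite runs of cycle reversals\<close>

text \<open>Meant for symmetric \<open>N\<close>, where both orientations of a pair are exchanged
  together. Every state of a run is the \<open>flip\<close> of the initial arc set by a symmetric
  set, namely by the pairs touched an odd number of times.\<close>

definition flip :: "('a \<times> 'a) set \<Rightarrow> ('a \<times> 'a) set \<Rightarrow> ('a \<times> 'a) set" where
  "flip A N = {(u, v). if (u, v) \<in> N then (v, u) \<in> A else (u, v) \<in> A}"

definition undirected :: "('a \<times> 'a) set \<Rightarrow> ('a \<times> 'a) set" where
  "undirected P = P \<union> P\<inverse>"

definition symdiff :: "'b set \<Rightarrow> 'b set \<Rightarrow> 'b set" where
  "symdiff N M = {f. (f \<in> N) \<noteq> (f \<in> M)}"

text \<open>The symmetric difference of a possibly infinite family. An element of infinitely many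
  \<open>F i\<close> would count as even, because \<open>card\<close> is then 0, so the value is the
  intended one for locally finite families.\<close>

definition parity :: "('i \<Rightarrow> 'b set) \<Rightarrow> 'i set \<Rightarrow> 'b set" where
  "parity F K = {f. odd (card {i \<in> K. f \<in> F i})}"

text \<open>One- and two-element lists yield a loop or two antiparallel arcs. Neither fits into an
  oriented arc set, so inside such a set these are the directed cycles of length at least
  three.\<close>

definition cycle_arcs :: "('a \<times> 'a) set \<Rightarrow> bool" where
  "cycle_arcs Z \<longleftrightarrow> (\<exists>xs. xs \<noteq> [] \<and> distinct xs \<and> Z = set (zip xs (rotate1 xs)))"

text \<open>The arcs present before step \<open>i\<close> are read off from the parities of the
  earlier cycles, which spares a transfinite recursion. Allowing an arbitrary well-founded index
  order instead of ordinals lets concatenations be indexed by lexicographic products.\<close>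

definition run :: "('a \<times> 'a) set \<Rightarrow> 'i rel \<Rightarrow> 'i set \<Rightarrow> ('i \<Rightarrow> ('a \<times> 'a) set) \<Rightarrow> bool" where
  "run A r I Z \<longleftrightarrow> wf r \<and> trans r \<and> total_on I r
     \<and> (\<forall>i\<in>I. cycle_arcs (Z i) \<and> Z i \<subseteq> flip A (parity (undirected \<circ> Z) {j \<in> I. (j, i) \<in> r}))
     \<and> (\<forall>f. finite {i \<in> I. f \<in> undirected (Z i)})"

abbreviation ord_less :: "'i::order rel" where
  "ord_less \<equiv> {(x, y). x < y}"

text \<open>
  In \<open>reach A T N\<close>, all cycles of the run stay within the pairs in \<open>T\<close>, which controls local
  finiteness when runs are concatenated, and \<open>N\<close> is the set of pairs reversed in the end.
\<close>

definition reach :: "('a \<times> 'a) set \<Rightarrow> ('a \<times> 'a) set \<Rightarrow> ('a \<times> 'a) set \<Rightarrow> bool" where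
  "reach A T N \<longleftrightarrow> (\<exists>(\<alpha> :: 'a ordinals) Z. run A ord_less {..<\<alpha>} Z
     \<and> (\<forall>i<\<alpha>. undirected (Z i) \<subseteq> T) \<and> N = parity (undirected \<circ> Z) {..<\<alpha>})"

lemma sym_undirected [simp]: "sym (undirected P)"
  by (auto simp: undirected_def sym_def)

lemma in_undirected: "(u, v) \<in> undirected P \<longleftrightarrow> (u, v) \<in> P \<or> (v, u) \<in> P"
  by (auto simp: undirected_def)

lemma in_flip: "(u, v) \<in> flip A N \<longleftrightarrow> (if (u, v) \<in> N then (v, u) \<in> A else (u, v) \<in> A)"
  by (simp add: flip_def)

lemma sym_parity: "(\<And>i. i \<in> K \<Longrightarrow> sym (F i)) \<Longrightarrow> sym (parity F K)"
proof (rule symI)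
  fix a b assume *: "\<And>i. i \<in> K \<Longrightarrow> sym (F i)" and "(a, b) \<in> parity F K"
  moreover have "{i \<in> K. (a, b) \<in> F i} = {i \<in> K. (b, a) \<in> F i}"
    using * by (auto simp: sym_def)
  ultimately show "(b, a) \<in> parity F K" by (simp add: parity_def)
qed

lemma flip_flip:
  assumes "sym N" "sym M" shows "flip (flip A N) M = flip A (symdiff N M)"
proof -
  have "(u, v) \<in> flip (flip A N) M \<longleftrightarrow> (u, v) \<in> flip A (symdiff N M)" for u v
    using assms symD[of N u v] symD[of N v u] symD[of M u v] symD[of M v u]
    by (auto simp: in_flip symdiff_def)
  then show ?thesis by auto
qed

lemma flip_empty [simp]: "flip A {} = A"
  by (auto simp: flip_def)

text \<open>A finite sum is odd iff the number of its odd terms is odd; the sum here counts the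
  indices touching \<open>f\<close> block by block.\<close>

lemma parity_Sigma:
  assumes "finite {(j, i) \<in> Sigma J K. f \<in> F j i}"
  shows "f \<in> parity (case_prod F) (Sigma J K) \<longleftrightarrow> f \<in> parity (\<lambda>j. parity (F j) (K j)) J"
proof -
  let ?S = "\<lambda>j. {i \<in> K j. f \<in> F j i}"
  let ?J = "{j \<in> J. ?S j \<noteq> {}}"
  have eq: "{x \<in> Sigma J K. f \<in> case_prod F x} = Sigma ?J ?S" by auto
  have fin: "finite (Sigma ?J ?S)" using assms eq
    by (auto elim: rev_finite_subset)
  have finJ: "finite ?J"
  proof (rule finite_subset)
    show "?J \<subseteq> fst ` Sigma ?J ?S" by force
  qed (use fin in auto)
  have finS: "\<forall>j\<in>?J. finite (?S j)"
  proof
    fix j assume "j \<in> ?J"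
    then have "?S j \<subseteq> snd ` Sigma ?J ?S" by force
    then show "finite (?S j)" using fin by (auto intro: finite_subset)
  qed
  have "card (Sigma ?J ?S) = (\<Sum>j\<in>?J. card (?S j))"
    using card_SigmaI[OF finJ finS] .
  then have "odd (card (Sigma ?J ?S)) \<longleftrightarrow> odd (card {j \<in> ?J. odd (card (?S j))})"
    using even_sum_iff[OF finJ, of "\<lambda>j. card (?S j)"] by simp
  also have "{j \<in> ?J. odd (card (?S j))} = {j \<in> J. f \<in> parity (F j) (K j)}"
    unfolding parity_def by (auto simp del: Collect_empty_eq)
  finally show ?thesis using eq by (simp add: parity_def)
qed

lemma parity_Un:
  assumes "K \<inter> L = {}" "finite {i \<in> K \<union> L. f \<in> F i}"
  shows "f \<in> parity F (K \<union> L) \<longleftrightarrow> f \<in> symdiff (parity F K) (parity F L)"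
proof -
  have "{i \<in> K \<union> L. f \<in> F i} = {i \<in> K. f \<in> F i} \<union> {i \<in> L. f \<in> F i}" by auto
  moreover have "card ({i \<in> K. f \<in> F i} \<union> {i \<in> L. f \<in> F i})
      = card {i \<in> K. f \<in> F i} + card {i \<in> L. f \<in> F i}"
    using assms by (intro card_Un_disjoint) (auto elim: rev_finite_subset)
  ultimately show ?thesis by (auto simp: parity_def symdiff_def)
qed

section \<open>Reindexing runs by ordinals of bounded size\<close>

lemma well_order_ordinals:
  "well_order_on UNIV {(x, y :: 'i::wellorder). x \<le> y}"
proof -
  have "{(x, y :: 'i). x \<le> y} - Id = {(x, y). x < y}" by auto
  then have "wf ({(x, y :: 'i). x \<le> y} - Id)" using wellorder_class.wf by simp
  then show ?thesis
    by (auto simp: well_order_on_def linear_order_on_def partial_order_on_def preorder_on_def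
        refl_on_def trans_def antisym_def total_on_def)
qed

text \<open>If the order on \<open>I\<close> were not shorter than \<open>'a ordinals\<close>, the
  power set of \<open>'a \<times> 'a \<times> nat\<close> would inject into \<open>I\<close> and
  hence, by \<open>h\<close>, into \<open>'a \<times> 'a \<times> nat\<close>, contradicting Cantor.
  So it is isomorphic to a proper initial segment.\<close>

lemma initial_segment_enumeration:
  fixes r :: "'i rel" and h :: "'i \<Rightarrow> 'a \<times> 'a \<times> nat"
  assumes "wf r" "trans r" "total_on I r" "inj_on h I"
  shows "\<exists>(\<alpha> :: 'a ordinals) g. bij_betw g {..<\<alpha>} I
    \<and> (\<forall>x<\<alpha>. \<forall>y<\<alpha>. (g x, g y) \<in> r \<longleftrightarrow> x < y)"
proof -
  let ?o = "{(x, y :: 'a ordinals). x \<le> y}"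
  let ?s = "(r \<inter> I \<times> I) \<union> Id_on I"
  have irr: "(x, x) \<notin> r" for x using assms(1) by auto
  have asym: "(x, y) \<in> r \<Longrightarrow> (y, x) \<notin> r" for x y using assms(1,2) irr by (meson transD)
  have sI: "Field ?s = I" by (auto simp: Field_def)
  have "?s - Id \<subseteq> r" by auto
  then have "wf (?s - Id)" using assms(1) wf_subset by blast
  moreover have "trans ?s" using assms(2) by (auto simp: trans_def)
  moreover have "refl_on I ?s" by (auto simp: refl_on_def)
  moreover have "antisym ?s" using asym by (auto simp: antisym_def)
  moreover have "total_on I ?s" using assms(3) by (auto simp: total_on_def)
  ultimately have wos: "well_order_on I ?s"
    unfolding well_order_on_def linear_order_on_def partial_order_on_def preorder_on_def
    by auto
  then have Ws: "Well_order ?s" using sI by simp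
  have Fo: "Field ?o = UNIV" by (auto simp: Field_def)
  have Wo: "Well_order ?o" using well_order_ordinals by (simp add: Fo)
  have "?s <o ?o"
  proof (rule ccontr)
    assume "\<not> ?s <o ?o"
    then have "?o \<le>o ?s" using not_ordLess_iff_ordLeq[OF Wo Ws] by blast
    then have "|Field ?o| \<le>o |Field ?s|" by (rule card_of_mono2)
    then have "|UNIV :: 'a ordinals set| \<le>o |I|" unfolding Fo sI .
    also have "|I| \<le>o |UNIV :: ('a \<times> 'a \<times> nat) set|"
      using assms(4) card_of_ordLeq by blast
    finally (ordLeq_transitive) have le: "|UNIV :: 'a ordinals set| \<le>o |UNIV :: ('a \<times> 'a \<times> nat) set|" .
    have "|UNIV :: ('a \<times> 'a \<times> nat) set set| \<le>o |UNIV :: 'a ordinals set|"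
      using card_of_ordLeq[of "UNIV :: ('a \<times> 'a \<times> nat) set set" "UNIV :: 'a ordinals set"]
        Abs_ordinals_inject by (metis UNIV_I inj_onI subset_UNIV)
    then have "|UNIV :: ('a \<times> 'a \<times> nat) set set| \<le>o |UNIV :: ('a \<times> 'a \<times> nat) set|"
      using le by (rule ordLeq_transitive)
    then show False using card_of_Pow[of "UNIV :: ('a \<times> 'a \<times> nat) set"]
      by (metis Pow_UNIV not_ordLess_ordLeq)
  qed
  then obtain \<alpha> where \<alpha>: "?s =o Restr ?o (underS ?o \<alpha>)"
    using ordLess_iff_ordIso_Restr[OF Wo Ws] by blast
  have us: "underS ?o \<alpha> = {..<\<alpha>}" by (auto simp: underS_def)
  have "Restr ?o (underS ?o \<alpha>) =o ?s" using \<alpha> by (rule ordIso_symmetric)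
  then obtain g where "iso (Restr ?o {..<\<alpha>}) ?s g"
    unfolding ordIso_def us by auto
  moreover have "Field (Restr ?o {..<\<alpha>}) = {..<\<alpha>}" by (auto simp: Field_def)
  ultimately have g: "bij_betw g {..<\<alpha>} I"
      and *: "\<forall>x\<in>{..<\<alpha>}. \<forall>y\<in>{..<\<alpha>}. (x, y) \<in> Restr ?o {..<\<alpha>} \<longleftrightarrow> (g x, g y) \<in> ?s"
    using iso_iff2[of "Restr ?o {..<\<alpha>}" ?s g] sI by auto
  have "(g x, g y) \<in> r \<longleftrightarrow> x < y" if "x < \<alpha>" "y < \<alpha>" for x y
  proof -
    have gI: "g x \<in> I" "g y \<in> I" using g that by (auto dest: bij_betwE)
    have "g x = g y \<longleftrightarrow> x = y" using g that by (auto simp: bij_betw_def inj_on_def)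
    moreover have "x \<le> y \<longleftrightarrow> (g x, g y) \<in> r \<or> g x = g y"
      using * that gI by auto
    ultimately show ?thesis using irr by (metis order_less_le)
  qed
  with g show ?thesis by blast
qed

text \<open>An index is coded by one element of its set together with its number among the finitely
  many indices that share this element.\<close>

lemma finite_touch_injection:
  fixes F :: "'i \<Rightarrow> ('a \<times> 'a) set"
  assumes "\<And>f. finite {i \<in> I. f \<in> F i}" "\<And>i. i \<in> I \<Longrightarrow> F i \<noteq> {}"
  shows "\<exists>h :: 'i \<Rightarrow> 'a \<times> 'a \<times> nat. inj_on h I"
proof -
  obtain g :: "'a \<times> 'a \<Rightarrow> 'i \<Rightarrow> nat" where g: "\<And>f. inj_on (g f) {i \<in> I. f \<in> F i}"
    using finite_imp_inj_to_nat_seg[OF assms(1)] by metis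
  define a where "a i = (SOME f. f \<in> F i)" for i
  have a: "a i \<in> F i" if "i \<in> I" for i
    using assms(2)[OF that] unfolding a_def by (metis ex_in_conv someI)
  have "inj_on (\<lambda>i. (fst (a i), snd (a i), g (a i) i)) I"
  proof (rule inj_onI)
    fix i j assume ij: "i \<in> I" "j \<in> I"
      and eq: "(fst (a i), snd (a i), g (a i) i) = (fst (a j), snd (a j), g (a j) j)"
    then have "a i = a j" by (simp add: prod_eq_iff)
    then show "i = j" using eq a[OF ij(1)] a[OF ij(2)] ij g[of "a i"] by (auto simp: inj_on_def)
  qed
  then show ?thesis by blast
qed

lemma cycle_arcs_nonempty: "cycle_arcs Z \<Longrightarrow> Z \<noteq> {}"
  by (auto simp: cycle_arcs_def zip_eq_Nil_iff)

text \<open>This frees all constructions from the ordinals: cycles are nonempty and each pair lies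
  on finitely many of them, so the index set is small enough to be enumerated in order by an initial
  segment of \<open>'a ordinals\<close>, and the run is transported along this enumeration.\<close>

lemma run_reach:
  fixes Z :: "'i \<Rightarrow> ('a \<times> 'a) set"
  assumes "run A r I Z" "\<And>i. i \<in> I \<Longrightarrow> undirected (Z i) \<subseteq> T"
  shows "reach A T (parity (undirected \<circ> Z) I)"
proof -
  have r: "wf r" "trans r" "total_on I r"
    and Z: "\<And>i. i \<in> I \<Longrightarrow> cycle_arcs (Z i)"
      "\<And>i. i \<in> I \<Longrightarrow> Z i \<subseteq> flip A (parity (undirected \<circ> Z) {j \<in> I. (j, i) \<in> r})"
    and fin: "\<And>f. finite {i \<in> I. f \<in> undirected (Z i)}"
    using assms(1) by (auto simp: run_def)
  have "\<exists>h :: 'i \<Rightarrow> 'a \<times> 'a \<times> nat. inj_on h I"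
    using fin Z(1)[THEN cycle_arcs_nonempty]
    by (intro finite_touch_injection[of I "undirected \<circ> Z"]) (auto simp: undirected_def)
  then obtain \<alpha> :: "'a ordinals" and g where g: "bij_betw g {..<\<alpha>} I"
      "\<And>x y. x < \<alpha> \<Longrightarrow> y < \<alpha> \<Longrightarrow> (g x, g y) \<in> r \<longleftrightarrow> x < y"
    using initial_segment_enumeration[OF r] by blast
  have inj: "inj_on g {..<\<alpha>}" and gI: "g ` {..<\<alpha>} = I" using g by (auto simp: bij_betw_def)
  have img: "{i \<in> g ` K. f \<in> undirected (Z i)} = g ` {x \<in> K. f \<in> undirected (Z (g x))}" for K f by auto
  have par: "parity (undirected \<circ> Z) (g ` K) = parity (undirected \<circ> (Z \<circ> g)) K" if "K \<subseteq> {..<\<alpha>}" for K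
  proof -
    have "card {i \<in> g ` K. f \<in> undirected (Z i)} = card {x \<in> K. f \<in> undirected (Z (g x))}" for f
      unfolding img using that by (intro card_image inj_on_subset[OF inj]) auto
    then show ?thesis by (simp add: parity_def)
  qed
  have before: "{j \<in> I. (j, g x) \<in> r} = g ` {..<x}" if "x < \<alpha>" for x
    using g(2) that unfolding gI[symmetric] by (auto intro: less_trans)
  have "run A ord_less {..<\<alpha>} (Z \<circ> g)"
    unfolding run_def
  proof (intro conjI ballI allI)
    show "wf (ord_less :: 'a ordinals rel)" by (rule wellorder_class.wf)
    show "trans (ord_less :: 'a ordinals rel)" by (auto intro: transI less_trans)
    show "total_on {..<\<alpha>} ord_less" by (auto simp: total_on_def)
  next
    fix x assume x: "x \<in> {..<\<alpha>}"
    show "cycle_arcs ((Z \<circ> g) x)" using Z(1) gI x by auto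
    have "{j \<in> {..<\<alpha>}. (j, x) \<in> ord_less} = {..<x}" using x by auto
    then show "(Z \<circ> g) x \<subseteq> flip A (parity (undirected \<circ> (Z \<circ> g)) {j \<in> {..<\<alpha>}. (j, x) \<in> ord_less})"
      using Z(2)[of "g x"] gI x before[of x] par[of "{..<x}"] by auto
  next
    fix f
    have "finite (g ` {x \<in> {..<\<alpha>}. f \<in> undirected (Z (g x))})"
      using fin[of f] img[of "{..<\<alpha>}" f] gI by simp
    then show "finite {i \<in> {..<\<alpha>}. f \<in> undirected ((Z \<circ> g) i)}"
      by (auto dest!: finite_imageD intro: inj_on_subset[OF inj])
  qed
  moreover have "undirected ((Z \<circ> g) x) \<subseteq> T" if "x < \<alpha>" for x using assms(2) gI that by auto
  moreover have "parity (undirected \<circ> Z) I = parity (undirected \<circ> (Z \<circ> g)) {..<\<alpha>}"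
    using par[of "{..<\<alpha>}"] gI by simp
  ultimately show ?thesis unfolding reach_def by blast
qed

section \<open>Closure properties of reachable reversals\<close>

lemma reach_sym: "reach A T N \<Longrightarrow> sym N"
  by (auto simp: reach_def intro!: sym_parity)

lemma reach_subset: "reach A T N \<Longrightarrow> N \<subseteq> T"
proof
  fix f assume "reach A T N" "f \<in> N"
  then obtain \<alpha> :: "'a ordinals" and Z where "\<forall>i<\<alpha>. undirected (Z i) \<subseteq> T" "odd (card {i \<in> {..<\<alpha>}. f \<in> undirected (Z i)})"
    by (auto simp: reach_def parity_def)
  moreover from this(2) have "{i \<in> {..<\<alpha>}. f \<in> undirected (Z i)} \<noteq> {}" by (metis card.empty even_zero)
  ultimately show "f \<in> T" by blast
qed

lemma reach_mono: "reach A T N \<Longrightarrow> T \<subseteq> T' \<Longrightarrow> reach A T' N"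
  unfolding reach_def by blast

text \<open>Runs chosen for the single blocks are concatenated by ordering the disjoint sum of their
  index sets lexicographically. Each block is confined to its \<open>T j\<close>, so the result is
  locally finite as soon as every pair belongs to finitely many \<open>T j\<close>.\<close>

lemma reach_sum:
  fixes J :: "'j set"
  assumes r: "wf r" "trans r" "total_on J r"
    and reach: "\<And>j. j \<in> J \<Longrightarrow> reach (flip A (parity N {i \<in> J. (i, j) \<in> r})) (T j) (N j)"
    and fin: "\<And>f. finite {j \<in> J. f \<in> T j}"
  shows "reach A (\<Union>j\<in>J. T j) (parity N J)"
proof -
  have "\<exists>\<alpha> :: 'a ordinals. \<exists>Z. run (flip A (parity N {i \<in> J. (i, j) \<in> r})) ord_less {..<\<alpha>} Z
     \<and> (\<forall>i<\<alpha>. undirected (Z i) \<subseteq> T j) \<and> N j = parity (undirected \<circ> Z) {..<\<alpha>}" if "j \<in> J" for j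
    using reach[OF that] unfolding reach_def by blast
  then have "\<forall>j\<in>J. \<exists>p :: 'a ordinals \<times> _. run (flip A (parity N {i \<in> J. (i, j) \<in> r})) ord_less {..<fst p} (snd p)
     \<and> (\<forall>i<fst p. undirected (snd p i) \<subseteq> T j) \<and> N j = parity (undirected \<circ> snd p) {..<fst p}"
    by simp
  from bchoice[OF this] obtain p :: "'j \<Rightarrow> 'a ordinals \<times> _" where
    p: "\<forall>j\<in>J. run (flip A (parity N {i \<in> J. (i, j) \<in> r})) ord_less {..<fst (p j)} (snd (p j))
     \<and> (\<forall>i<fst (p j). undirected (snd (p j) i) \<subseteq> T j) \<and> N j = parity (undirected \<circ> snd (p j)) {..<fst (p j)}"
    by blast
  define \<alpha> where "\<alpha> j = fst (p j)" for j
  define Z where "Z j = snd (p j)" for j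
  have Z: "\<And>j. j \<in> J \<Longrightarrow> run (flip A (parity N {i \<in> J. (i, j) \<in> r})) ord_less {..<\<alpha> j} (Z j)"
      "\<And>j i. j \<in> J \<Longrightarrow> i < \<alpha> j \<Longrightarrow> undirected (Z j i) \<subseteq> T j"
      "\<And>j. j \<in> J \<Longrightarrow> N j = parity (undirected \<circ> Z j) {..<\<alpha> j}"
    using p unfolding \<alpha>_def Z_def by blast+
  have symN: "sym (N j)" if "j \<in> J" for j using reach_sym[OF reach[OF that]] .
  let ?I = "Sigma J (\<lambda>j. {..<\<alpha> j})" and ?r = "r <*lex*> (ord_less :: 'a ordinals rel)"
  let ?Z = "case_prod Z" and ?F = "\<lambda>j i. undirected (Z j i)"
  have F: "undirected \<circ> ?Z = case_prod ?F" by (auto simp: fun_eq_iff)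
  have finI: "finite {(j, i) \<in> ?I. f \<in> ?F j i}" for f
  proof -
    have "{(j, i) \<in> ?I. f \<in> ?F j i} = Sigma {j \<in> J. f \<in> T j} (\<lambda>j. {i \<in> {..<\<alpha> j}. f \<in> undirected (Z j i)})"
      using Z(2) by auto
    moreover have "finite \<dots>"
    proof (intro finite_SigmaI)
      fix j assume "j \<in> {j \<in> J. f \<in> T j}"
      then have "run (flip A (parity N {i \<in> J. (i, j) \<in> r})) ord_less {..<\<alpha> j} (Z j)" using Z(1) by simp
      then show "finite {i \<in> {..<\<alpha> j}. f \<in> undirected (Z j i)}" unfolding run_def by blast
    qed (rule fin)
    ultimately show ?thesis by simp
  qed
  have fin_sub: "finite {x \<in> K. f \<in> case_prod ?F x}" if "K \<subseteq> ?I" for f K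
    by (rule finite_subset[OF _ finI[of f]]) (use that in auto)
  have parN: "parity (case_prod ?F) (Sigma K (\<lambda>j. {..<\<alpha> j})) = parity N K" if "K \<subseteq> J" for K
  proof (intro set_eqI)
    fix f
    have "f \<in> parity (case_prod ?F) (Sigma K (\<lambda>j. {..<\<alpha> j}))
        \<longleftrightarrow> f \<in> parity (\<lambda>j. parity (?F j) {..<\<alpha> j}) K"
      using that by (intro parity_Sigma finite_subset[OF _ finI[of f]]) auto
    also have "{j \<in> K. f \<in> parity (?F j) {..<\<alpha> j}} = {j \<in> K. f \<in> N j}"
      using that Z(3) by (auto simp: comp_def)
    then have "f \<in> parity (\<lambda>j. parity (?F j) {..<\<alpha> j}) K \<longleftrightarrow> f \<in> parity N K"
      unfolding parity_def by simp
    finally show "f \<in> parity (case_prod ?F) (Sigma K (\<lambda>j. {..<\<alpha> j})) \<longleftrightarrow> f \<in> parity N K" .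
  qed
  have irr: "(x, x) \<notin> r" for x using r(1) by auto
  have "run A ?r ?I ?Z"
    unfolding run_def
  proof (intro conjI ballI allI)
    show "wf ?r" by (rule wf_lex_prod[OF r(1) wellorder_class.wf])
    show "trans ?r" using r(2) by (intro trans_lex_prod) (auto intro: transI less_trans)
    show "total_on ?I ?r" using r(3) by (auto simp: total_on_def)
  next
    fix x assume x: "x \<in> ?I"
    obtain j i where ji: "x = (j, i)" by (cases x)
    then have j: "j \<in> J" and i: "i < \<alpha> j" using x by auto
    show "cycle_arcs (?Z x)" using Z(1)[OF j] i ji by (auto simp: run_def)
    let ?B = "{k \<in> J. (k, j) \<in> r}"
    \<comment> \<open>Before step \<open>i\<close> of block \<open>j\<close>, all earlier blocks are
      complete and block \<open>j\<close> has performed the steps below \<open>i\<close>; the two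
      parts contribute separately to the parity.\<close>
    have split: "{y \<in> ?I. (y, x) \<in> ?r} = Sigma ?B (\<lambda>j. {..<\<alpha> j}) \<union> {j} \<times> {..<i}"
      using j i ji irr by (auto intro: less_trans)
    have "parity (case_prod ?F) {y \<in> ?I. (y, x) \<in> ?r}
      = symdiff (parity N ?B) (parity (undirected \<circ> Z j) {..<i})"
    proof (intro set_eqI)
      fix f
      have "f \<in> parity (case_prod ?F) {y \<in> ?I. (y, x) \<in> ?r}
        \<longleftrightarrow> f \<in> symdiff (parity (case_prod ?F) (Sigma ?B (\<lambda>j. {..<\<alpha> j}))) (parity (case_prod ?F) ({j} \<times> {..<i}))"
        unfolding split
      proof (rule parity_Un)
        show "(SIGMA j:?B. {..<\<alpha> j}) \<inter> {j} \<times> {..<i} = {}" using irr by auto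
        show "finite {y \<in> (SIGMA j:?B. {..<\<alpha> j}) \<union> {j} \<times> {..<i}. f \<in> case_prod ?F y}"
          unfolding split[symmetric] by (rule fin_sub) auto
      qed
      also have "parity (case_prod ?F) (Sigma ?B (\<lambda>j. {..<\<alpha> j})) = parity N ?B" by (rule parN) auto
      also have "f \<in> symdiff (parity N ?B) (parity (case_prod ?F) ({j} \<times> {..<i}))
        \<longleftrightarrow> f \<in> symdiff (parity N ?B) (parity (undirected \<circ> Z j) {..<i})"
      proof -
        have "{y \<in> {j} \<times> {..<i}. f \<in> case_prod ?F y} = Pair j ` {k \<in> {..<i}. f \<in> undirected (Z j k)}" by auto
        then have "card {y \<in> {j} \<times> {..<i}. f \<in> case_prod ?F y} = card {k \<in> {..<i}. f \<in> undirected (Z j k)}"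
          by (simp add: card_image inj_on_def)
        then show ?thesis by (simp add: symdiff_def parity_def)
      qed
      finally show "f \<in> parity (case_prod ?F) {y \<in> ?I. (y, x) \<in> ?r}
        \<longleftrightarrow> f \<in> symdiff (parity N ?B) (parity (undirected \<circ> Z j) {..<i})" .
    qed
    moreover have "flip (flip A (parity N ?B)) (parity (undirected \<circ> Z j) {..<i})
        = flip A (symdiff (parity N ?B) (parity (undirected \<circ> Z j) {..<i}))"
      using symN by (intro flip_flip sym_parity) auto
    moreover have "Z j i \<subseteq> flip (flip A (parity N ?B)) (parity (undirected \<circ> Z j) {k \<in> {..<\<alpha> j}. (k, i) \<in> ord_less})"
      using Z(1)[OF j] i unfolding run_def by blast
    moreover have "{k \<in> {..<\<alpha> j}. (k, i) \<in> ord_less} = {..<i}" using i by (auto intro: less_trans)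
    ultimately show "?Z x \<subseteq> flip A (parity (undirected \<circ> ?Z) {y \<in> ?I. (y, x) \<in> ?r})"
      unfolding F ji by simp
  next
    fix f show "finite {x \<in> ?I. f \<in> undirected (?Z x)}"
      using fin_sub[of ?I f, OF subset_refl] by (simp add: case_prod_beta)
  qed
  then have "reach A (\<Union>j\<in>J. T j) (parity (undirected \<circ> ?Z) ?I)"
  proof (rule run_reach)
    fix x assume "x \<in> ?I"
    then show "undirected (?Z x) \<subseteq> (\<Union>j\<in>J. T j)" using Z(2) by (cases x) fastforce
  qed
  then show ?thesis unfolding F using parN[of J] by simp
qed

lemma ex_strict_well_order: "\<exists>r. wf r \<and> trans r \<and> total_on J r"
proof -
  have "well_order_on J |J|" by (rule card_of_well_order_on)
  then show ?thesis
    by (intro exI[of _ "|J| - Id"])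
      (auto simp: well_order_on_def linear_order_on_def partial_order_on_def preorder_on_def
        intro: trans_diff_Id)
qed

lemma parity_empty [simp]: "parity F {} = {}"
  by (auto simp: parity_def)

lemma parity_singleton [simp]: "parity F {i} = F i"
proof -
  have "{j. j = i \<and> f \<in> F j} = (if f \<in> F i then {i} else {})" for f by auto
  then show ?thesis by (auto simp: parity_def split: if_splits)
qed

lemma parity_disjoint:
  assumes "\<And>i j. i \<in> K \<Longrightarrow> j \<in> K \<Longrightarrow> i \<noteq> j \<Longrightarrow> F i \<inter> F j = {}"
  shows "parity F K = (\<Union>i\<in>K. F i)"
proof (intro set_eqI iffI)
  fix f assume "f \<in> parity F K"
  then have "{i \<in> K. f \<in> F i} \<noteq> {}" unfolding parity_def by (metis (mono_tags) CollectD card.empty even_zero)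
  then show "f \<in> (\<Union>i\<in>K. F i)" by auto
next
  fix f assume "f \<in> (\<Union>i\<in>K. F i)"
  then obtain i where i: "i \<in> K" "f \<in> F i" by auto
  then have "{j \<in> K. f \<in> F j} = {i}" using assms by blast
  then show "f \<in> parity F K" by (simp add: parity_def)
qed

lemma reach_empty: "reach A {} {}"
  using run_reach[of A "{} :: nat rel" "{}" "\<lambda>_. {}" "{}"] by (simp add: run_def)

lemma reach_cycle:
  assumes "cycle_arcs Z" "Z \<subseteq> A" shows "reach A (undirected Z) (undirected Z)"
  using run_reach[of A "{}" "{()}" "\<lambda>_. Z" "undirected Z"] assms
  by (simp add: run_def total_on_def)

text \<open>All cycles of the run lie within \<open>T\<close>, so whether they are present depends
  on the arcs in \<open>T\<close> alone. This transfers runs between a tournament and its induced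
  subtournaments.\<close>

lemma reach_local:
  assumes "reach A T N" "A \<inter> T = A' \<inter> T"
  shows "reach A' T N"
proof -
  from assms(1) obtain \<alpha> :: "'a ordinals" and Z where Z: "run A ord_less {..<\<alpha>} Z"
      "\<forall>i<\<alpha>. undirected (Z i) \<subseteq> T" "N = parity (undirected \<circ> Z) {..<\<alpha>}"
    unfolding reach_def by blast
  have "Z i \<subseteq> flip A' M" if i: "i < \<alpha>" and *: "Z i \<subseteq> flip A M" for i M
  proof
    fix f assume f: "f \<in> Z i"
    obtain u v where uv: "f = (u, v)" by (cases f)
    then have "(u, v) \<in> undirected (Z i)" "(v, u) \<in> undirected (Z i)" using f by (auto simp: in_undirected)
    then have "(u, v) \<in> T" "(v, u) \<in> T" using Z(2) i by auto
    then have "(u, v) \<in> A \<longleftrightarrow> (u, v) \<in> A'" "(v, u) \<in> A \<longleftrightarrow> (v, u) \<in> A'" using assms(2) by blast+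
    moreover have "(u, v) \<in> flip A M" using f * uv by blast
    ultimately show "f \<in> flip A' M" unfolding uv in_flip by (simp split: if_splits)
  qed
  then have "run A' ord_less {..<\<alpha>} Z" using Z(1) by (simp add: run_def)
  then show ?thesis using Z(2,3) unfolding reach_def by blast
qed

lemma flip_converse: "sym N \<Longrightarrow> flip (A\<inverse>) N = (flip A N)\<inverse>"
  by (auto simp: in_flip sym_def split: if_splits)

lemma undirected_converse [simp]: "undirected (Z\<inverse>) = undirected Z"
  by (auto simp: undirected_def)

lemma cycle_arcs_converse:
  assumes "cycle_arcs Z" shows "cycle_arcs (Z\<inverse>)"
proof -
  obtain xs where xs: "xs \<noteq> []" "distinct xs" "Z = set (zip xs (rotate1 xs))"
    using assms by (auto simp: cycle_arcs_def)
  then obtain x zs where x: "xs = x # zs" by (cases xs) auto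
  have "Z\<inverse> = set (zip (rotate1 xs) xs)" using xs(3) by (auto simp: in_set_zip)
  also have "\<dots> = set (rev (zip (rotate1 xs) xs))" by simp
  also have "\<dots> = set (zip (rev (rotate1 xs)) (rev xs))" by (simp add: zip_rev)
  also have "rev xs = rotate1 (rev (rotate1 xs))" by (simp add: x)
  finally show ?thesis unfolding cycle_arcs_def using xs by (intro exI[of _ "rev (rotate1 xs)"]) auto
qed

text \<open>Reversing every cycle of a run gives a run on the opposite arcs that touches the same
  pairs. It allows the two sides of a cut to be treated by the same argument.\<close>

lemma reach_converse:
  assumes "reach A T N" shows "reach (A\<inverse>) T N"
proof -
  from assms(1) obtain \<alpha> :: "'a ordinals" and Z where Z: "run A ord_less {..<\<alpha>} Z"
      "\<forall>i<\<alpha>. undirected (Z i) \<subseteq> T" "N = parity (undirected \<circ> Z) {..<\<alpha>}"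
    unfolding reach_def by blast
  let ?Z = "\<lambda>i. (Z i)\<inverse>"
  have eq: "undirected \<circ> ?Z = undirected \<circ> Z" by (auto simp: fun_eq_iff)
  have "flip (A\<inverse>) (parity (undirected \<circ> Z) K) = (flip A (parity (undirected \<circ> Z) K))\<inverse>" for K
    by (intro flip_converse sym_parity) simp
  then have "run (A\<inverse>) ord_less {..<\<alpha>} ?Z"
    using Z(1) unfolding run_def eq by (auto intro: cycle_arcs_converse)
  then show ?thesis using Z(2,3) eq unfolding reach_def by (metis undirected_converse)
qed

lemma parity_insert:
  assumes "i \<notin> K" "finite {j \<in> K. f \<in> F j}"
  shows "f \<in> parity F (insert i K) \<longleftrightarrow> f \<in> symdiff (parity F K) (F i)"
proof -
  have "finite {j \<in> K \<union> {i}. f \<in> F j}" using assms(2) by (auto elim: rev_finite_subset[rotated] intro: finite_subset[of _ "insert i {j \<in> K. f \<in> F j}"])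
  then show ?thesis using parity_Un[of K "{i}" f F] assms(1) by simp
qed

text \<open>The form used for infinite constructions: \<open>M n\<close> collects the pairs reversed
  after \<open>n\<close> blocks. A pair is touched by finitely many blocks, so its membership in
  \<open>M n\<close> stabilises, and the stable value is the total parity.\<close>

lemma reach_omega:
  fixes N T :: "nat \<Rightarrow> ('a \<times> 'a) set"
  assumes M: "M 0 = {}" "\<And>n. M (Suc n) = symdiff (M n) (N n)"
    and reach: "\<And>n. reach (flip A (M n)) (T n) (N n)"
    and fin: "\<And>f. finite {n. f \<in> T n}"
  shows "reach A (\<Union>n. T n) {f. \<exists>m. \<forall>n\<ge>m. f \<in> M n}"
proof -
  have par: "parity N {..<n} = M n" for n
  proof (induction n)
    case (Suc n)
    have "{..<Suc n} = insert n {..<n}" by auto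
    then show ?case using Suc M(2) by (auto simp: parity_insert)
  qed (simp add: M)
  have "reach A (\<Union>n\<in>UNIV. T n) (parity N UNIV)"
    using reach fin wf_less by (intro reach_sum[where r = ord_less])
      (auto simp: lessThan_def[symmetric] par total_on_def trans_def)
  also have "parity N UNIV = {f. \<exists>m. \<forall>n\<ge>m. f \<in> M n}"
  proof (intro set_eqI)
    fix f
    obtain m where m: "{n. f \<in> T n} \<subseteq> {..<m}"
      using fin[of f] finite_nat_iff_bounded by blast
    have "f \<in> parity N UNIV \<longleftrightarrow> f \<in> M n" if "n \<ge> m" for n
    proof -
      have "{i. f \<in> N i} = {i \<in> {..<n}. f \<in> N i}" using m that reach_subset[OF reach] by fastforce
      then show ?thesis using par[of n] by (auto simp: parity_def)
    qed
    then show "f \<in> parity N UNIV \<longleftrightarrow> f \<in> {f. \<exists>m. \<forall>n\<ge>m. f \<in> M n}"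
      by simp (meson le_cases order_trans)
  qed
  finally show ?thesis .
qed

text \<open>An instance of \<open>reach_omega\<close> in which all blocks after the first two are
  empty.\<close>

lemma reach_trans:
  assumes "reach A T1 N1" "reach (flip A N1) T2 N2"
  shows "reach A (T1 \<union> T2) (symdiff N1 N2)"
proof -
  let ?T = "\<lambda>n :: nat. if n = 0 then T1 else if n = 1 then T2 else {}"
  let ?N = "\<lambda>n :: nat. if n = 0 then N1 else if n = 1 then N2 else {}"
  let ?M = "\<lambda>n :: nat. if n = 0 then {} else if n = 1 then N1 else symdiff N1 N2"
  have "reach A (\<Union>n. ?T n) {f. \<exists>m. \<forall>n\<ge>m. f \<in> ?M n}"
  proof (rule reach_omega)
    show "?M (Suc n) = symdiff (?M n) (?N n)" for n by (auto simp: symdiff_def)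
    show "reach (flip A (?M n)) (?T n) (?N n)" for n using assms by (simp add: reach_empty)
    show "finite {n. f \<in> ?T n}" for f by (rule finite_subset[of _ "{0, 1}"]) (auto split: if_splits)
  qed simp
  also have "{f. \<exists>m. \<forall>n\<ge>m. f \<in> ?M n} = symdiff N1 N2"
  proof (intro set_eqI iffI)
    fix f assume "f \<in> {f. \<exists>m. \<forall>n\<ge>m. f \<in> ?M n}"
    then obtain m where "\<forall>n\<ge>m. f \<in> ?M n" by blast
    from this[THEN spec, of "m + 2"] show "f \<in> symdiff N1 N2" by simp
  next
    fix f assume "f \<in> symdiff N1 N2"
    then show "f \<in> {f. \<exists>m. \<forall>n\<ge>m. f \<in> ?M n}" by (auto intro!: exI[of _ 2])
  qed
  also have "(\<Union>n. ?T n) = T1 \<union> T2" by (auto split: if_splits intro: exI[of _ 0] exI[of _ 1])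
  finally show ?thesis .
qed

text \<open>Earlier blocks do not touch the pairs in \<open>T j\<close>, so by
  \<open>reach_local\<close> each block can be run as if it came first, whatever well-order is put
  on \<open>J\<close>.\<close>

lemma reach_disjoint:
  fixes J :: "'j set"
  assumes "\<And>j. j \<in> J \<Longrightarrow> reach A (T j) (N j)"
    and disj: "\<And>i j. i \<in> J \<Longrightarrow> j \<in> J \<Longrightarrow> i \<noteq> j \<Longrightarrow> T i \<inter> T j = {}"
  shows "reach A (\<Union>j\<in>J. T j) (\<Union>j\<in>J. N j)"
proof -
  obtain r where r: "wf r" "trans r" "total_on J r" using ex_strict_well_order by blast
  have sub: "N j \<subseteq> T j" if "j \<in> J" for j using assms(1) reach_subset that by blast
  have par: "parity N K = (\<Union>j\<in>K. N j)" if "K \<subseteq> J" for K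
    by (rule parity_disjoint) (use that sub disj in blast)
  have "reach A (\<Union>j\<in>J. T j) (parity N J)"
  proof (rule reach_sum[OF r])
    fix j assume j: "j \<in> J"
    let ?K = "{i \<in> J. (i, j) \<in> r}"
    have "(j, j) \<notin> r" using r(1) by auto
    then have "T j \<inter> parity N ?K = {}" using par[of ?K] sub disj j by fastforce
    then have "(u, v) \<in> A \<longleftrightarrow> (u, v) \<in> flip A (parity N ?K)" if "(u, v) \<in> T j" for u v
      using that by (auto simp: in_flip)
    then have "A \<inter> T j = flip A (parity N ?K) \<inter> T j" by auto
    then show "reach (flip A (parity N ?K)) (T j) (N j)" using reach_local assms(1) j by blast
  next
    fix f
    have "\<exists>i. {j \<in> J. f \<in> T j} \<subseteq> {i}" using disj by blast
    then show "finite {j \<in> J. f \<in> T j}" by (metis finite.emptyI finite.insertI finite_subset)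
  qed
  then show ?thesis using par by simp
qed

section \<open>Realising runs as reversal sequences\<close>

lemma zip_successor_walk:
  fixes E :: "'a pair_pre_digraph"
  shows "pre_digraph.cas (with_proj E) x (zip (x # ys) (ys @ [z])) z
    \<and> pre_digraph.awalk_verts (with_proj E) x (zip (x # ys) (ys @ [z])) = x # ys @ [z]"
  by (induction ys arbitrary: x) (auto simp: pre_digraph.cas.simps pre_digraph.awalk_verts.simps)

lemma zip_rotate1_cycle:
  fixes E :: "'a pair_pre_digraph"
  assumes "xs \<noteq> []" "distinct xs" "set (zip xs (rotate1 xs)) \<subseteq> parcs E" "parcs E \<subseteq> pverts E \<times> pverts E"
  shows "pre_digraph.cycle (with_proj E) (zip xs (rotate1 xs))"
proof -
  obtain x ys where xs: "xs = x # ys" using assms(1) by (cases xs) auto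
  then have zip: "zip xs (rotate1 xs) = zip (x # ys) (ys @ [x])" by simp
  then have "x \<in> fst ` set (zip xs (rotate1 xs))" by (cases ys) auto
  then have "x \<in> pverts E" using assms(3,4) by auto
  then show ?thesis
    using zip_successor_walk[of E x ys x] assms unfolding zip
    by (auto simp: pre_digraph.cycle_def pre_digraph.awalk_def xs zip_eq_Nil_iff intro!: exI[of _ x])
qed

text \<open>The initial segments \<open>C \<beta>\<close> of the run are shown by induction on
  \<open>\<beta>\<close> to be reversal sequences, with the three rules of \<open>reversal\<close>
  matching successor, limit and zero.\<close>

lemma reach_reversal:
  fixes D :: "'a pair_pre_digraph"
  assumes "oriented_graph D" "reach (parcs D) T N"
  shows "\<exists>(C :: ('a ordinals, 'a) cycle_seq) E. reversal D C E \<and> pverts E = pverts D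
    \<and> parcs E = flip (parcs D) N"
proof -
  interpret oriented_graph D by fact
  have DV: "parcs D \<subseteq> pverts D \<times> pverts D" using in_arcsD1 in_arcsD2 by fastforce
  from assms(2) obtain \<alpha> :: "'a ordinals" and Z where Z: "run (parcs D) ord_less {..<\<alpha>} Z"
      "N = parity (undirected \<circ> Z) {..<\<alpha>}"
    unfolding reach_def by blast
  have "\<exists>p. i < \<alpha> \<longrightarrow> (\<exists>xs. xs \<noteq> [] \<and> distinct xs \<and> p = zip xs (rotate1 xs)) \<and> Z i = set p" for i
    using Z(1) unfolding run_def cycle_arcs_def by blast
  then obtain p where p: "\<And>i. i < \<alpha> \<Longrightarrow> (\<exists>xs. xs \<noteq> [] \<and> distinct xs \<and> p i = zip xs (rotate1 xs))"
     "\<And>i. i < \<alpha> \<Longrightarrow> Z i = set (p i)"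
    by metis
  define C :: "'a ordinals \<Rightarrow> ('a ordinals, 'a) cycle_seq" where
    "C \<beta> i = (if i < \<beta> then Some (p i) else None)" for \<beta> i
  have pos: "positions (C \<beta>) u v = {i \<in> {..<\<beta>}. (u, v) \<in> undirected (Z i)}" if "\<beta> \<le> \<alpha>" for \<beta> u v
    using that p(2) by (auto simp: positions_def C_def in_undirected split: if_splits)
  have arcs: "parcs (parity_digraph D (C \<beta>)) = flip (parcs D) (parity (undirected \<circ> Z) {..<\<beta>})"
    if "\<beta> \<le> \<alpha>" for \<beta>
    using pos[OF that] by (auto simp: parity_digraph_def in_flip parity_def)
  have verts: "pverts (parity_digraph D X) = pverts D" for X :: "('a ordinals, 'a) cycle_seq" by (simp add: parity_digraph_def)
  have dom: "dom (C \<beta>) = {..<\<beta>}" for \<beta> by (auto simp: C_def dom_def)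
  have "reversal D (C \<beta>) (parity_digraph D (C \<beta>))" if "\<beta> \<le> \<alpha>" for \<beta>
    using that
  proof (induction \<beta> rule: less_induct)
    case (less \<beta>)
    \<comment> \<open>Any resulting digraph suffices, since \<open>reversal_invariant\<close>
      identifies it as the parity digraph. A greatest element below \<open>\<beta>\<close>
      distinguishes the successor case.\<close>
    have "\<exists>E. reversal D (C \<beta>) E"
    proof (cases "\<exists>\<gamma><\<beta>. \<forall>\<xi><\<beta>. \<xi> \<le> \<gamma>")
      case True
      then obtain \<gamma> where \<gamma>: "\<gamma> < \<beta>" "\<And>\<xi>. \<xi> < \<beta> \<Longrightarrow> \<xi> \<le> \<gamma>" by blast
      then have "C \<beta> = (C \<gamma>)(\<gamma> \<mapsto> p \<gamma>)" by (force simp: C_def fun_eq_iff not_less)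
      moreover have \<gamma>\<alpha>: "\<gamma> < \<alpha>" using \<gamma>(1) less.prems by simp
      moreover have "pre_digraph.cycle (with_proj (parity_digraph D (C \<gamma>))) (p \<gamma>)"
      proof -
        obtain xs where xs: "xs \<noteq> []" "distinct xs" "p \<gamma> = zip xs (rotate1 xs)" using p(1)[OF \<gamma>\<alpha>] by blast
        have "{j \<in> {..<\<alpha>}. (j, \<gamma>) \<in> ord_less} = {..<\<gamma>}" using \<gamma>\<alpha> by auto
        moreover have "Z \<gamma> \<subseteq> flip (parcs D) (parity (undirected \<circ> Z) {j \<in> {..<\<alpha>}. (j, \<gamma>) \<in> ord_less})"
          using Z(1) \<gamma>\<alpha> unfolding run_def by blast
        ultimately have "set (p \<gamma>) \<subseteq> parcs (parity_digraph D (C \<gamma>))"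
          using p(2)[OF \<gamma>\<alpha>] arcs[of \<gamma>] \<gamma>\<alpha> by simp
        moreover have "parcs (parity_digraph D (C \<gamma>)) \<subseteq> pverts D \<times> pverts D"
          using DV by (auto simp: parity_digraph_def split: if_splits)
        ultimately show ?thesis unfolding xs(3) using xs verts by (intro zip_rotate1_cycle) auto
      qed
      ultimately show ?thesis
        using reversal.append[OF less.IH[OF \<gamma>(1)] dom, of "p \<gamma>"] by (metis less_imp_le)
    next
      case False
      show ?thesis
      proof (cases "\<exists>\<xi>. \<xi> < \<beta>")
        case True
        have lim: "limit_ordinal \<beta>" using True False by (force simp: limit_ordinal_def not_le)
        have "locally_finite D (C \<beta>)"
        proof -
          have "finite (positions (C \<beta>) u v)" for u v
          proof -
            have "finite {i \<in> {..<\<alpha>}. (u, v) \<in> undirected (Z i)}" using Z(1) unfolding run_def by blast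
            then show ?thesis unfolding pos[OF less.prems] by (rule rev_finite_subset) (use less.prems in auto)
          qed
          then show ?thesis by (auto simp: locally_finite_def)
        qed
        moreover have "Map.graph (C \<beta>) = (\<Union>\<xi>\<in>{..<\<beta>}. Map.graph (C \<xi>))"
        proof -
          have "(i, q) \<in> Map.graph (C \<beta>) \<longleftrightarrow> (\<exists>\<xi><\<beta>. (i, q) \<in> Map.graph (C \<xi>))" for i q
          proof
            assume "(i, q) \<in> Map.graph (C \<beta>)"
            then have i: "i < \<beta>" "q = p i" by (auto simp: Map.graph_def C_def split: if_splits)
            then obtain \<xi> where "i < \<xi>" "\<xi> < \<beta>" using lim by (auto simp: limit_ordinal_def)
            then show "\<exists>\<xi><\<beta>. (i, q) \<in> Map.graph (C \<xi>)" using i by (auto simp: Map.graph_def C_def)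
          next
            assume "\<exists>\<xi><\<beta>. (i, q) \<in> Map.graph (C \<xi>)"
            then show "(i, q) \<in> Map.graph (C \<beta>)"
              by (auto simp: Map.graph_def C_def split: if_splits)
          qed
          then show ?thesis by auto
        qed
        moreover have "C \<xi> \<subseteq>\<^sub>m C \<eta>" if "\<xi> < \<eta>" for \<xi> \<eta>
          using that by (auto simp: map_le_def C_def dom_def)
        ultimately have "reversal D (C \<beta>) (limit_digraph D \<beta> (\<lambda>\<xi>. parity_digraph D (C \<xi>)))"
          using less.IH less.prems by (intro reversal.limit[OF lim, where Cs = C]) auto
        then show ?thesis by blast
      next
        case False
        then have "C \<beta> = Map.empty" by (auto simp: C_def)
        then show ?thesis using reversal.empty by metis
      qed
    qed
    then show ?case using reversal_invariant[OF assms(1)] by blast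
  qed
  then have "reversal D (C \<alpha>) (parity_digraph D (C \<alpha>))" by simp
  moreover have "parcs (parity_digraph D (C \<alpha>)) = flip (parcs D) N" using arcs Z(2) by simp
  ultimately show ?thesis using verts by metis
qed

section \<open>Reversing a prescribed set of arcs\<close>

text \<open>Outdegree minus indegree within a finite set \<open>Z\<close>. A path is represented by
  its excess at the two ends; closing it up then amounts to making all excesses vanish, and neither
  simplicity nor the order of the arcs has to be tracked.\<close>

definition excess :: "('a \<times> 'a) set \<Rightarrow> 'a \<Rightarrow> int" where
  "excess Z v = (\<Sum>(x, y)\<in>Z. of_bool (x = v) - of_bool (y = v))"

definition oriented :: "('a \<times> 'a) set \<Rightarrow> bool" where
  "oriented A \<longleftrightarrow> (\<forall>u v. (u, v) \<in> A \<longrightarrow> (v, u) \<notin> A)"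

lemma excess_Un: "finite Y \<Longrightarrow> finite Z \<Longrightarrow> Y \<inter> Z = {} \<Longrightarrow> excess (Y \<union> Z) v = excess Y v + excess Z v"
  by (simp add: excess_def sum.union_disjoint)

lemma excess_insert:
  "finite Z \<Longrightarrow> (x, y) \<notin> Z \<Longrightarrow> excess (insert (x, y) Z) v = of_bool (x = v) - of_bool (y = v) + excess Z v"
  by (simp add: excess_def)

lemma excess_converse: "excess (Z\<inverse>) v = - excess Z v"
proof -
  have "excess (Z\<inverse>) v = (\<Sum>f\<in>prod.swap ` Z. of_bool (fst f = v) - of_bool (snd f = v))"
    unfolding excess_def by (intro sum.cong) force+
  also have "\<dots> = (\<Sum>f\<in>Z. of_bool (snd f = v) - of_bool (fst f = v))"
    by (subst sum.reindex) (auto simp: inj_on_def)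
  also have "\<dots> = - excess Z v"
    unfolding excess_def by (simp add: sum_negf[symmetric] case_prod_beta)
  finally show ?thesis .
qed

lemma oriented_flip: "oriented A \<Longrightarrow> sym N \<Longrightarrow> oriented (flip A N)"
  by (auto simp: oriented_def in_flip sym_def split: if_splits)

lemma rtrancl_simple_path:
  assumes "(a, b) \<in> B\<^sup>*"
  shows "\<exists>xs. xs \<noteq> [] \<and> hd xs = a \<and> last xs = b \<and> distinct xs \<and> successively (\<lambda>u v. (u, v) \<in> B) xs"
  using assms
proof (induction rule: rtrancl_induct)
  case base
  show ?case by (intro exI[of _ "[a]"]) simp
next
  case (step y z)
  then obtain xs where xs: "xs \<noteq> []" "hd xs = a" "last xs = y" "distinct xs" "successively (\<lambda>u v. (u, v) \<in> B) xs"
    by blast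
  show ?case
  proof (cases "z \<in> set xs")
    case True
    then obtain us vs where uv: "xs = us @ z # vs" by (meson split_list)
    then have "successively (\<lambda>u v. (u, v) \<in> B) (us @ [z])"
      using xs(5) by (auto simp: successively_append_iff)
    then show ?thesis using xs uv by (intro exI[of _ "us @ [z]"]) (auto simp: hd_append)
  next
    case False
    then show ?thesis using xs step(2)
      by (intro exI[of _ "xs @ [z]"]) (auto simp: successively_append_iff)
  qed
qed

lemma successively_zip:
  "successively (\<lambda>u v. (u, v) \<in> B) xs \<longleftrightarrow> set (zip xs (tl xs)) \<subseteq> B"
  by (induction xs rule: induct_list012) auto

lemma excess_path:
  assumes "xs \<noteq> []" "distinct xs"
  shows "excess (set (zip xs (tl xs))) v = of_bool (hd xs = v) - of_bool (last xs = v)"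
  using assms
proof (induction xs rule: induct_list012)
  case (3 x y ys)
  have "(x, y) \<notin> set (zip (y # ys) ys)" using 3(4) by (auto dest: set_zip_leftD)
  then have "excess (insert (x, y) (set (zip (y # ys) ys))) v
      = of_bool (x = v) - of_bool (y = v) + excess (set (zip (y # ys) ys)) v"
    by (intro excess_insert) auto
  then show ?case using 3 by simp
qed (auto simp: excess_def)

lemma zip_tl_butlast: "zip xs (tl xs) = zip (butlast xs) (tl xs)"
  by (induction xs rule: induct_list012) auto

text \<open>In a finite acyclic set, some head of an arc is the tail of none and thus has negative
  excess. Otherwise an arc \<open>(v, w)\<close> is closed by a simple path from \<open>w\<close>
  back to \<open>v\<close>.\<close>

lemma balanced_contains_cycle:
  assumes "finite Z" "Z \<noteq> {}" "\<And>v. excess Z v = 0"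
  shows "\<exists>Y\<subseteq>Z. cycle_arcs Y \<and> (\<forall>v. excess Y v = 0)"
proof -
  have "\<not> acyclic Z"
  proof
    assume "acyclic Z"
    then have "wf (Z\<inverse>)" using assms(1) by (intro finite_acyclic_wf_converse)
    moreover obtain z where "z \<in> Range Z" using assms(2) by auto
    ultimately obtain y where y: "y \<in> Range Z" "\<And>w. (w, y) \<in> Z\<inverse> \<Longrightarrow> w \<notin> Range Z"
      by (metis wfE_min)
    then have no: "(y, w) \<notin> Z" for w by auto
    obtain x where "(x, y) \<in> Z" using y(1) by auto
    have "excess Z y = - (\<Sum>(p, q)\<in>Z. of_bool (q = y))"
      unfolding excess_def using no by (subst sum_negf[symmetric], intro sum.cong) auto
    moreover have "(\<Sum>(p, q)\<in>Z. of_bool (q = y) :: int) > 0"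
      by (rule sum_pos2[OF assms(1) \<open>(x, y) \<in> Z\<close>]) auto
    ultimately show False using assms(3)[of y] by simp
  qed
  then obtain v w where vw: "(v, w) \<in> Z" "(w, v) \<in> Z\<^sup>*"
    unfolding acyclic_def by (meson tranclD)
  then obtain xs where xs: "xs \<noteq> []" "hd xs = w" "last xs = v" "distinct xs" "set (zip xs (tl xs)) \<subseteq> Z"
    using rtrancl_simple_path[OF vw(2)] by (auto simp: successively_zip)
  let ?W = "zip (butlast xs) (tl xs)"
  have zipW: "zip xs (tl xs) = ?W" by (rule zip_tl_butlast)
  have "rotate1 xs = tl xs @ [w]" using xs(1,2) by (cases xs) auto
  then have "zip xs (rotate1 xs) = zip (butlast xs @ [last xs]) (tl xs @ [w])" using xs(1) by simp
  also have "\<dots> = ?W @ [(v, w)]" using xs(1,3) by (subst zip_append) auto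
  finally have zip: "set (zip xs (rotate1 xs)) = insert (v, w) (set ?W)" by simp
  have "v \<notin> set (butlast xs)" using xs by (metis append_butlast_last_id distinct_append
    disjoint_iff list.set_intros(1))
  then have "(v, w) \<notin> set ?W" by (auto dest: set_zip_leftD)
  then have "excess (insert (v, w) (set ?W)) u = 0" for u
    using excess_path[OF xs(1,4), of u] xs zipW by (subst excess_insert) auto
  moreover have "cycle_arcs (insert (v, w) (set ?W))"
    unfolding cycle_arcs_def zip[symmetric] using xs by blast
  moreover have "insert (v, w) (set ?W) \<subseteq> Z" using vw xs(5) zipW by auto
  ultimately show ?thesis by blast
qed

lemma undirected_disjoint:
  assumes "oriented A" "X \<subseteq> A" "Y \<subseteq> A" "X \<inter> Y = {}"
  shows "undirected X \<inter> undirected Y = {}"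
  using assms unfolding undirected_def oriented_def by blast

lemma undirected_Un: "undirected (X \<union> Y) = undirected X \<union> undirected Y"
  by (auto simp: undirected_def)

lemma subset_flip: "X \<subseteq> A \<Longrightarrow> X \<inter> N = {} \<Longrightarrow> X \<subseteq> flip A N"
  by (auto simp: in_flip)

lemma converse_subset_flip: "X \<subseteq> A \<Longrightarrow> undirected X \<subseteq> N \<Longrightarrow> X\<inverse> \<subseteq> flip A N"
  by (fastforce simp: in_flip undirected_def)

text \<open>One trade in an infinite process: \<open>E\<close> stays reversed while \<open>Y\<close>
  is restored and \<open>Z\<close> is reversed in its place.\<close>

lemma symdiff_telescope:
  "E \<inter> Y = {} \<Longrightarrow> E \<inter> Z = {} \<Longrightarrow> Y \<inter> Z = {} \<Longrightarrow> symdiff (E \<union> Y) (Y \<union> Z) = E \<union> Z"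
  by (auto simp: symdiff_def)

text \<open>Cycles are split off one by one. As \<open>A\<close> is oriented, disjoint sets of arcs
  also occupy disjoint sets of pairs, so reversing one cycle leaves the remaining arcs in
  place.\<close>

lemma reach_balanced:
  assumes "finite Z" "Z \<subseteq> A" "oriented A" "\<And>v. excess Z v = 0"
  shows "reach A (undirected Z) (undirected Z)"
  using assms
proof (induction "card Z" arbitrary: Z A rule: less_induct)
  case less
  show ?case
  proof (cases "Z = {}")
    case True
    then show ?thesis using reach_empty by (simp add: undirected_def)
  next
    case False
    then obtain Y where Y: "Y \<subseteq> Z" "cycle_arcs Y" "\<And>v. excess Y v = 0"
      using balanced_contains_cycle[of Z] less.prems by blast
    have fin: "finite Y" using Y(1) less.prems(1) finite_subset by blast
    have Zeq: "Z = Y \<union> (Z - Y)" using Y(1) by auto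
    have disj: "undirected Y \<inter> undirected (Z - Y) = {}"
      by (rule undirected_disjoint[OF less.prems(3)]) (use Y less.prems in auto)
    have "card (Z - Y) < card Z"
      using cycle_arcs_nonempty[OF Y(2)] Y(1) less.prems(1) by (intro psubset_card_mono) auto
    moreover have "excess (Z - Y) v = 0" for v
      using excess_Un[of Y "Z - Y" v] fin less.prems Y(3) Zeq by auto
    moreover have "Z - Y \<subseteq> flip A (undirected Y)"
      using disj less.prems by (intro subset_flip) (auto simp: undirected_def)
    ultimately have "reach (flip A (undirected Y)) (undirected (Z - Y)) (undirected (Z - Y))"
      using less.prems by (intro less.hyps) (auto intro: oriented_flip)
    moreover have "reach A (undirected Y) (undirected Y)"
      using Y less.prems by (intro reach_cycle) auto
    ultimately have "reach A (undirected Y \<union> undirected (Z - Y)) (symdiff (undirected Y) (undirected (Z - Y)))"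
      using reach_trans by blast
    moreover have "symdiff (undirected Y) (undirected (Z - Y)) = undirected Y \<union> undirected (Z - Y)"
      using disj by (auto simp: symdiff_def)
    ultimately show ?thesis using undirected_Un Zeq by metis
  qed
qed

lemma finite_disjoint_family:
  assumes "\<And>i j. i \<in> I \<Longrightarrow> j \<in> I \<Longrightarrow> i \<noteq> j \<Longrightarrow> F i \<inter> F j = {}"
  shows "finite {i \<in> I. (u, v) \<in> undirected (F i)}"
proof -
  have "\<exists>i. {i \<in> I. f \<in> F i} \<subseteq> {i}" for f using assms by blast
  then have "finite {i \<in> I. f \<in> F i}" for f by (metis finite.emptyI finite.insertI finite_subset)
  then have "finite ({i \<in> I. (u, v) \<in> F i} \<union> {i \<in> I. (v, u) \<in> F i})" by blast
  then show ?thesis by (rule rev_finite_subset) (auto simp: in_undirected)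
qed

text \<open>
  The arc is reversed together with a first path \<open>P 0\<close>; then \<open>P 0\<close> is restored at the
  expense of \<open>P 1\<close>, and so on, so that in the limit only the arc itself has changed.
\<close>

lemma reach_single:
  assumes "oriented A" "e \<in> A"
    and P: "\<And>k. finite (P k)" "\<And>k. P k \<subseteq> A - {e}" "\<And>k v. excess (P k) v = of_bool (snd e = v) - of_bool (fst e = v)"
    and disj: "\<And>i j :: nat. i \<noteq> j \<Longrightarrow> P i \<inter> P j = {}"
  shows "reach A (undirected (insert e (\<Union>k. P k))) (undirected {e})"
proof -
  define M where "M n = (case n of 0 \<Rightarrow> {} | Suc k \<Rightarrow> undirected (insert e (P k)))" for n
  define N where "N n = (case n of 0 \<Rightarrow> undirected (insert e (P 0)) | Suc k \<Rightarrow> undirected (P k \<union> P (Suc k)))" for n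
  have de: "undirected {e} \<inter> undirected (P k) = {}" for k
    using assms by (intro undirected_disjoint[of A]) auto
  have dP: "undirected (P i) \<inter> undirected (P j) = {}" if "i \<noteq> j" for i j
    using assms that by (intro undirected_disjoint[of A]) auto
  have ins: "undirected (insert e X) = undirected {e} \<union> undirected X" for X by (auto simp: undirected_def)
  have MS: "M (Suc k) = undirected {e} \<union> undirected (P k)" for k by (simp add: M_def ins[of "P k"])
  have M0: "M 0 = {}" by (simp add: M_def)
  have "reach A (\<Union>n. N n) {f. \<exists>m. \<forall>n\<ge>m. f \<in> M n}"
  proof (rule reach_omega)
    show "M 0 = {}" by (simp add: M_def)
    show "M (Suc n) = symdiff (M n) (N n)" for n
    proof (cases n)
      case (Suc k)
      then show ?thesis
        using symdiff_telescope[OF de[of k] de[of "Suc k"] dP[of k "Suc k"]]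
        by (simp add: MS N_def undirected_Un)
    qed (simp add: M_def N_def symdiff_def)
    show "reach (flip A (M n)) (N n) (N n)" for n
    proof (cases n)
      case 0
      have "excess (insert e (P 0)) v = 0" for v
        using excess_insert[of "P 0" "fst e" "snd e" v] P[of 0] by auto
      then show ?thesis using assms(1,2) P[of 0] 0
        by (auto simp: M_def N_def intro!: reach_balanced)
    next
      case (Suc k)
      \<comment> \<open>The reversed old path and the new path have opposite excesses. Their union
        is therefore balanced, though it need not be a single cycle.\<close>
      let ?Z = "(P k)\<inverse> \<union> P (Suc k)"
      have d: "P (Suc k) \<inter> M (Suc k) = {}"
        using de[of "Suc k"] dP[of k "Suc k"] by (auto simp: MS undirected_def)
      have "M (Suc k) \<supseteq> undirected (P k)" by (auto simp: MS)
      then have "(P k)\<inverse> \<inter> P (Suc k) = {}" using d by (auto simp: undirected_def)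
      then have "excess ?Z v = 0" for v
        using P(1,3) excess_converse[of "P k" v] by (subst excess_Un) auto
      moreover have "P (Suc k) \<subseteq> flip A (M (Suc k))" using d P(2) by (intro subset_flip) auto
      moreover have "(P k)\<inverse> \<subseteq> flip A (M (Suc k))"
        using P(2) by (intro converse_subset_flip) (auto simp: MS)
      moreover have "oriented (flip A (M (Suc k)))" using assms(1) by (intro oriented_flip) (auto simp: MS sym_Un)
      ultimately have "reach (flip A (M (Suc k))) (undirected ?Z) (undirected ?Z)"
        using P(1) by (intro reach_balanced) auto
      moreover have "undirected ?Z = N n" using Suc by (auto simp: N_def undirected_def)
      ultimately show ?thesis using Suc by simp
    qed
    fix f :: "'a \<times> 'a"
    obtain u v where f: "f = (u, v)" by (cases f)
    have fin: "finite {k \<in> UNIV. f \<in> undirected (P k)}" unfolding f using disj by (rule finite_disjoint_family)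
    have "{n. f \<in> N n} \<subseteq> insert 0 ({k \<in> UNIV. f \<in> undirected (P k)} \<union> Suc ` {k \<in> UNIV. f \<in> undirected (P k)})"
    proof
      fix n assume "n \<in> {n. f \<in> N n}"
      then show "n \<in> insert 0 ({k \<in> UNIV. f \<in> undirected (P k)} \<union> Suc ` {k \<in> UNIV. f \<in> undirected (P k)})"
        by (cases n) (auto simp: N_def undirected_Un)
    qed
    then show "finite {n. f \<in> N n}" by (rule finite_subset) (use fin in auto)
  qed
  moreover have "(\<Union>n. N n) \<subseteq> undirected (insert e (\<Union>k. P k))"
    by (auto simp: N_def undirected_def split: nat.splits)
  moreover have "{f. \<exists>m. \<forall>n\<ge>m. f \<in> M n} = undirected {e}"
  proof (intro set_eqI iffI)
    fix f assume "f \<in> {f. \<exists>m. \<forall>n\<ge>m. f \<in> M n}"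
    then obtain m where m: "\<And>n. n \<ge> m \<Longrightarrow> f \<in> M n" by blast
    show "f \<in> undirected {e}"
      using m[of "Suc m"] m[of "Suc (Suc m)"] dP[of m "Suc m"] by (auto simp: MS)
  next
    fix f assume "f \<in> undirected {e}"
    then have "f \<in> M n" if "n \<ge> 1" for n using that by (cases n) (auto simp: MS)
    then show "f \<in> {f. \<exists>m. \<forall>n\<ge>m. f \<in> M n}" by blast
  qed
  ultimately show ?thesis using reach_mono by metis
qed

text \<open>The arcs of \<open>R\<close> are reversed one after the other along \<open>r\<close>.
  When \<open>e\<close> has its turn, the arcs before it already point the other way, so its paths
  must avoid these and \<open>e\<close> itself, but may use arcs of \<open>R\<close> that come later
  and are intact. Disjointness of all paths makes the whole process locally finite.\<close>

lemma reach_exact: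
  assumes "oriented A" "R \<subseteq> A" and r: "wf r" "trans r" "total_on R r"
    and P: "\<And>e k. e \<in> R \<Longrightarrow> finite (P e k)" "\<And>e k. e \<in> R \<Longrightarrow> P e k \<subseteq> A"
      "\<And>e k v. e \<in> R \<Longrightarrow> excess (P e k) v = of_bool (snd e = v) - of_bool (fst e = v)"
      "\<And>e k. e \<in> R \<Longrightarrow> P e k \<inter> {d \<in> R. (d, e) \<in> r \<or> d = e} = {}"
    and disj: "\<And>d e i j :: nat. d \<in> R \<Longrightarrow> e \<in> R \<Longrightarrow> (d, i) \<noteq> (e, j) \<Longrightarrow> P d i \<inter> P e j = {}"
  shows "reach A (\<Union>e\<in>R. undirected (insert e (\<Union>k. P e k))) (undirected R)"
proof -
  let ?N = "\<lambda>e. undirected {e}"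
  have par: "parity ?N K = undirected K" if "K \<subseteq> R" for K
  proof -
    have "undirected {d} \<inter> undirected {e} = {}" if "d \<in> K" "e \<in> K" "d \<noteq> e" for d e
      using that \<open>K \<subseteq> R\<close> assms(1,2) by (intro undirected_disjoint[of A]) auto
    then have "parity ?N K = (\<Union>e\<in>K. undirected {e})" by (intro parity_disjoint)
    then show ?thesis by (auto simp: undirected_def)
  qed
  have "reach A (\<Union>e\<in>R. undirected (insert e (\<Union>k. P e k))) (parity ?N R)"
  proof (rule reach_sum[OF r])
    fix e assume e: "e \<in> R"
    let ?K = "{d \<in> R. (d, e) \<in> r}"
    have "(e, e) \<notin> r" using r(1) by auto
    have d: "undirected X \<inter> undirected ?K = {}" if "X \<subseteq> A" "X \<inter> ?K = {}" for X
      using that assms(1,2) by (intro undirected_disjoint[of A]) auto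
    have un: "X \<subseteq> undirected X" for X :: "('a \<times> 'a) set" by (auto simp: undirected_def)
    have PK: "P e k \<inter> ?K = {}" "e \<notin> P e k" for k using P(4)[OF e, of k] e by blast+
    have "e \<in> flip A (undirected ?K)"
      using subset_flip[of "{e}" A "undirected ?K"] d[of "{e}"] un[of "{e}"] e assms(2) \<open>(e, e) \<notin> r\<close> by auto
    moreover have "P e k \<subseteq> flip A (undirected ?K)" for k
      using d[OF P(2)[OF e] PK(1), of k] un P(2)[OF e] by (intro subset_flip) auto
    ultimately have "reach (flip A (undirected ?K)) (undirected (insert e (\<Union>k. P e k))) (undirected {e})"
      using assms(1) e P(1,3) disj PK(2) by (intro reach_single oriented_flip) auto
    then show "reach (flip A (parity ?N ?K)) (undirected (insert e (\<Union>k. P e k))) (undirected {e})"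
      by (subst par) auto
  next
    fix f :: "'a \<times> 'a"
    obtain u v where f: "f = (u, v)" by (cases f)
    have "finite {e \<in> R. f \<in> undirected (\<Union>k. P e k)}"
      unfolding f
    proof (rule finite_disjoint_family)
      fix d e assume "d \<in> R" "e \<in> R" "d \<noteq> e"
      then have "P d i \<inter> P e j = {}" for i j using disj[of d e i j] by simp
      then show "(\<Union>k. P d k) \<inter> (\<Union>k. P e k) = {}" by blast
    qed
    then have "finite ({(u, v), (v, u)} \<union> {e \<in> R. f \<in> undirected (\<Union>k. P e k)})" by blast
    then show "finite {e \<in> R. f \<in> undirected (insert e (\<Union>k. P e k))}"
      by (rule rev_finite_subset) (auto simp: undirected_def f)
  qed
  then show ?thesis using par by simp
qed

section \<open>Strong components\<close>

definition tour :: "'a set \<Rightarrow> ('a \<times> 'a) set \<Rightarrow> bool" where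
  "tour V A \<longleftrightarrow> A \<subseteq> V \<times> V \<and> oriented A
    \<and> (\<forall>u\<in>V. \<forall>v\<in>V. u \<noteq> v \<longrightarrow> (u, v) \<in> A \<or> (v, u) \<in> A)"

definition scc :: "('a \<times> 'a) set \<Rightarrow> 'a \<Rightarrow> 'a set" where
  "scc A u = {v. (u, v) \<in> A\<^sup>* \<and> (v, u) \<in> A\<^sup>*}"

text \<open>\<open>P\<close> receives both the vertex set and the induced arcs of a component, so
  that a further splitting can be carried out inside it.\<close>

definition splits_into ::
  "'a set \<Rightarrow> ('a \<times> 'a) set \<Rightarrow> ('a set \<Rightarrow> ('a \<times> 'a) set \<Rightarrow> bool) \<Rightarrow> bool" where
  "splits_into V A P \<longleftrightarrow> (\<exists>N. reach A (V \<times> V) N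
    \<and> (\<forall>v\<in>V. P (scc (flip A N) v) (flip A N \<inter> scc (flip A N) v \<times> scc (flip A N) v)))"

lemma flip_subset: "A \<subseteq> V \<times> V \<Longrightarrow> flip A N \<subseteq> V \<times> V"
  by (auto simp: in_flip split: if_splits)

lemma tour_flip:
  assumes "tour V A" "sym N" shows "tour V (flip A N)"
proof -
  have "(u, v) \<in> flip A N \<or> (v, u) \<in> flip A N" if "u \<in> V" "v \<in> V" "u \<noteq> v" for u v
    using assms that symD[of N u v] symD[of N v u] unfolding tour_def in_flip by auto
  then show ?thesis using assms by (simp add: tour_def oriented_flip flip_subset)
qed

lemma tour_restrict: "tour V A \<Longrightarrow> S \<subseteq> V \<Longrightarrow> tour S (A \<inter> S \<times> S)"
  unfolding tour_def oriented_def by blast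

lemma tour_converse: "tour V A \<Longrightarrow> tour V (A\<inverse>)"
  by (auto simp: tour_def oriented_def)

lemma scc_refl [simp]: "v \<in> scc A v"
  by (simp add: scc_def)

lemma scc_eq: "w \<in> scc A v \<Longrightarrow> scc A w = scc A v"
  by (auto simp: scc_def intro: rtrancl_trans)

lemma scc_converse [simp]: "scc (A\<inverse>) v = scc A v"
  by (auto simp: scc_def rtrancl_converse)

lemma scc_subset:
  assumes "A \<subseteq> V \<times> V" "v \<in> V" shows "scc A v \<subseteq> V"
proof
  fix w assume "w \<in> scc A v"
  then have "(v, w) \<in> A\<^sup>*" by (simp add: scc_def)
  then show "w \<in> V" by (cases rule: rtranclE) (use assms in auto)
qed

text \<open>Every vertex on a closed walk through \<open>u\<close> is strongly connected to
  \<open>u\<close>, so the walk stays in the component.\<close>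

lemma scc_path:
  assumes "(u, w) \<in> A\<^sup>*" "(w, u) \<in> A\<^sup>*"
  shows "(u, w) \<in> (A \<inter> scc A u \<times> scc A u)\<^sup>*"
  using assms
proof (induction rule: rtrancl_induct)
  case (step y z)
  then have yu: "(y, u) \<in> A\<^sup>*" by (meson converse_rtrancl_into_rtrancl)
  then have "(y, z) \<in> A \<inter> scc A u \<times> scc A u"
    using step by (auto simp: scc_def intro: rtrancl_into_rtrancl)
  then show ?case using step.IH[OF yu] by (rule rtrancl_into_rtrancl[rotated])
qed simp

lemma scc_path': "w \<in> scc A u \<Longrightarrow> (w, u) \<in> (A \<inter> scc A u \<times> scc A u)\<^sup>*"
  using scc_path[of w u A] scc_eq[of w A u] by (auto simp: scc_def)

lemma splits_into_trivial:
  assumes "\<And>v. v \<in> V \<Longrightarrow> P (scc A v) (A \<inter> scc A v \<times> scc A v)"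
  shows "splits_into V A P"
  unfolding splits_into_def using assms reach_mono[OF reach_empty]
  by (intro exI[of _ "{}"]) auto

text \<open>The components of the first splitting are disjoint, so the second reversals, each
  confined to its own component, can be carried out together by
  \<open>reach_disjoint\<close>.\<close>

lemma splits_into_refine:
  assumes tour: "tour V A" and P: "splits_into V A P"
    and Q: "\<And>S B. tour S B \<Longrightarrow> S \<subseteq> V \<Longrightarrow> P S B \<Longrightarrow> splits_into S B Q"
  shows "splits_into V A Q"
proof -
  obtain N where N: "reach A (V \<times> V) N"
    "\<And>v. v \<in> V \<Longrightarrow> P (scc (flip A N) v) (flip A N \<inter> scc (flip A N) v \<times> scc (flip A N) v)"
    using P unfolding splits_into_def by blast
  define A1 where "A1 = flip A N"
  have symN: "sym N" using N(1) by (rule reach_sym)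
  have tour1: "tour V A1" unfolding A1_def using tour symN by (rule tour_flip)
  then have A1V: "A1 \<subseteq> V \<times> V" by (simp add: tour_def)
  define J where "J = scc A1 ` V"
  have JV: "S \<subseteq> V" if "S \<in> J" for S using that scc_subset[OF A1V] by (auto simp: J_def)
  have Jeq: "S = scc A1 v" if "S \<in> J" "v \<in> S" for S v using that scc_eq[of v A1] by (auto simp: J_def)
  have "\<exists>M. reach (A1 \<inter> S \<times> S) (S \<times> S) M \<and> (\<forall>v\<in>S. Q (scc (flip (A1 \<inter> S \<times> S) M) v)
      (flip (A1 \<inter> S \<times> S) M \<inter> scc (flip (A1 \<inter> S \<times> S) M) v \<times> scc (flip (A1 \<inter> S \<times> S) M) v))" if "S \<in> J" for S
  proof -
    have "P S (A1 \<inter> S \<times> S)" using that N(2) by (auto simp: J_def A1_def)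
    then show ?thesis
      using Q[of S "A1 \<inter> S \<times> S"] tour_restrict[OF tour1 JV[OF that]] JV[OF that] unfolding splits_into_def by blast
  qed
  then obtain M where M: "\<And>S. S \<in> J \<Longrightarrow> reach (A1 \<inter> S \<times> S) (S \<times> S) (M S)"
    "\<And>S v. S \<in> J \<Longrightarrow> v \<in> S \<Longrightarrow> Q (scc (flip (A1 \<inter> S \<times> S) (M S)) v)
      (flip (A1 \<inter> S \<times> S) (M S) \<inter> scc (flip (A1 \<inter> S \<times> S) (M S)) v \<times> scc (flip (A1 \<inter> S \<times> S) (M S)) v)"
    by metis
  have MS: "M S \<subseteq> S \<times> S" if "S \<in> J" for S using M(1)[OF that] by (rule reach_subset)
  let ?M = "\<Union>S\<in>J. M S"
  have disj: "S = S'" if "S \<in> J" "S' \<in> J" "v \<in> S" "v \<in> S'" for S S' v using Jeq that by metis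
  have "reach A1 (\<Union>S\<in>J. S \<times> S) ?M"
  proof (rule reach_disjoint)
    fix S assume "S \<in> J"
    then show "reach A1 (S \<times> S) (M S)" by (rule reach_local[OF M(1)]) auto
  next
    fix S S' assume "S \<in> J" "S' \<in> J" "S \<noteq> S'"
    then show "S \<times> S \<inter> S' \<times> S' = {}" using disj by blast
  qed
  then have reachM: "reach A1 (V \<times> V) ?M" using JV by (elim reach_mono) fast
  then have symM: "sym ?M" by (rule reach_sym)
  define A2 where "A2 = flip A1 ?M"
  have "reach A (V \<times> V) (symdiff N ?M)" using reach_trans[OF N(1)] reachM A1_def by fastforce
  moreover have A2: "flip A (symdiff N ?M) = A2" using flip_flip[OF symN symM] by (simp add: A1_def A2_def)
  moreover have "Q (scc A2 v) (A2 \<inter> scc A2 v \<times> scc A2 v)" if v: "v \<in> V" for v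
  proof -
    define S where "S = scc A1 v"
    have SJ: "S \<in> J" using v by (simp add: S_def J_def)
    have vS: "v \<in> S" by (simp add: S_def)
    let ?B = "flip (A1 \<inter> S \<times> S) (M S)"
    have B: "A2 \<inter> S \<times> S = ?B"
    proof -
      have "(x, y) \<in> ?M \<longleftrightarrow> (x, y) \<in> M S" if "x \<in> S" "y \<in> S" for x y
      proof
        assume "(x, y) \<in> ?M"
        then obtain S' where S': "S' \<in> J" "(x, y) \<in> M S'" by blast
        then have "x \<in> S'" using MS by blast
        then show "(x, y) \<in> M S" using disj[OF SJ S'(1) that(1)] S'(2) by simp
      qed (use SJ in blast)
      then show ?thesis using MS[OF SJ] unfolding A2_def by (auto simp: in_flip split: if_splits)
    qed
    \<comment> \<open>An arc of a touched pair joins two vertices of one component of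
      \<open>A1\<close>, and the others are unchanged. Hence the second reversals cannot merge
      components.\<close>
    have "A2 \<subseteq> A1\<^sup>*"
    proof
      fix e assume e: "e \<in> A2"
      show "e \<in> A1\<^sup>*"
      proof (cases "e \<in> ?M")
        case True
        then obtain S' where S': "S' \<in> J" "e \<in> S' \<times> S'" using MS by blast
        then obtain w where "S' = scc A1 w" by (auto simp: J_def)
        with S' show ?thesis by (auto simp: scc_def intro: rtrancl_trans)
      next
        case False
        then show ?thesis using e by (cases e) (auto simp: A2_def in_flip)
      qed
    qed
    then have A2A1: "A2\<^sup>* \<subseteq> A1\<^sup>*" by (metis rtrancl_mono rtrancl_idemp)
    let ?K = "scc A2 v"
    have KS: "?K \<subseteq> S" using A2A1 by (auto simp: scc_def S_def)
    have "A2 \<inter> ?K \<times> ?K \<subseteq> ?B" using B KS by auto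
    then have sub: "(A2 \<inter> ?K \<times> ?K)\<^sup>* \<subseteq> ?B\<^sup>*" by (rule rtrancl_mono)
    have "?B\<^sup>* \<subseteq> A2\<^sup>*" using B by (intro rtrancl_mono) auto
    moreover have "w \<in> scc ?B v" if "w \<in> ?K" for w
    proof -
      have "(v, w) \<in> (A2 \<inter> ?K \<times> ?K)\<^sup>*" using that scc_path[of v w A2] by (simp add: scc_def)
      then show ?thesis using sub scc_path'[OF that] by (auto simp: scc_def)
    qed
    ultimately have K: "scc ?B v = ?K" by (auto simp: scc_def)
    have "A2 \<inter> ?K \<times> ?K = ?B \<inter> ?K \<times> ?K" using B KS by auto
    then show ?thesis using M(2)[OF SJ vS] K by simp
  qed
  ultimately show ?thesis unfolding splits_into_def by (intro exI[of _ "symdiff N ?M"]) simp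
qed

section \<open>Translation to tournaments and their strong components as subdigraphs\<close>

lemma scc_finite_imp_sccs_finite:
  fixes E :: "'a pair_pre_digraph"
  assumes "\<And>v. v \<in> pverts E \<Longrightarrow> finite (scc (parcs E) v)" "H \<in> pre_digraph.sccs (with_proj E)"
  shows "finite (verts H)"
proof -
  have H: "induced_subgraph H (with_proj E)" "strongly_connected H"
    using assms(2) by (auto simp: pre_digraph.sccs_def)
  then have sub: "verts H \<subseteq> pverts E" "arcs_ends H \<subseteq> parcs E"
    by (auto simp: induced_subgraph_def subgraph_def compatible_def arcs_ends_def arc_to_ends_def)
  obtain v where v: "v \<in> verts H" using H(2) by (auto simp: strongly_connected_def)
  have "verts H \<subseteq> scc (parcs E) v"
  proof
    fix w assume "w \<in> verts H"
    then have "(v, w) \<in> (arcs_ends H)\<^sup>*" "(w, v) \<in> (arcs_ends H)\<^sup>*"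
      using H(2) v unfolding strongly_connected_def by (blast intro: reachable_rtranclI)+
    then show "w \<in> scc (parcs E) v" using rtrancl_mono[OF sub(2)] by (auto simp: scc_def)
  qed
  then show ?thesis using assms(1) v sub(1) finite_subset by blast
qed

lemma splits_into_finite_imp_theorem:
  fixes D :: "'a pair_pre_digraph"
  assumes "tournament D" "\<And>V A. tour V (A :: ('a \<times> 'a) set) \<Longrightarrow> splits_into V A (\<lambda>K B. finite K)"
  shows "\<exists>C \<in> (rs D :: ('a ordinals, 'a) cycle_seq set).
           \<forall>H \<in> pre_digraph.sccs (with_proj (reverse_seq D C)). finite (verts H)"
proof -
  interpret tournament D by fact
  have "tour (pverts D) (parcs D)"
    unfolding tour_def oriented_def using in_arcsD1 in_arcsD2 no_antiparallel total_arcs by fastforce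
  then obtain N where N: "reach (parcs D) (pverts D \<times> pverts D) N"
      "\<And>v. v \<in> pverts D \<Longrightarrow> finite (scc (flip (parcs D) N) v)"
    using assms(2) unfolding splits_into_def by blast
  have D: "oriented_graph D" ..
  obtain C :: "('a ordinals, 'a) cycle_seq" and E where E: "reversal D C E" "pverts E = pverts D"
      "parcs E = flip (parcs D) N"
    using reach_reversal[OF D N(1)] by blast
  then have "reverse_seq D C = E" "C \<in> rs D" using reverse_seq_eq[OF D] by (auto simp: rs_def)
  then show ?thesis using scc_finite_imp_sccs_finite[of E] N(2) E by auto
qed

section \<open>Small cuts\<close>

text \<open>A well-order of least possible type, made strict: its proper initial segments have
  smaller cardinality.\<close>

lemma ex_small_strict_well_order:
  "\<exists>r. wf r \<and> trans r \<and> total_on J r \<and> (\<forall>j\<in>J. |{i \<in> J. (i, j) \<in> r}| <o |J| )"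
proof -
  have wo: "well_order_on J |J|" by (rule card_of_well_order_on)
  have "|{i \<in> J. (i, j) \<in> |J| - Id}| <o |J|" if "j \<in> J" for j
  proof -
    have "|underS (card_of J) j| <o |J|"
      using that by (intro card_of_underS card_of_Card_order) (simp add: Field_card_of)
    then show ?thesis
      by (rule ordLeq_ordLess_trans[rotated]) (auto simp: underS_def intro!: card_of_mono1)
  qed
  then show ?thesis using wo
    by (intro exI[of _ "|J| - Id"])
      (auto simp: well_order_on_def linear_order_on_def partial_order_on_def preorder_on_def
        intro: trans_diff_Id)
qed

text \<open>The paths for \<open>reach_exact\<close> are chosen by recursion along
  \<open>r'\<close>, each avoiding those chosen before. \<open>r\<close> is the order in which arcs
  are reversed and \<open>r'\<close> the order in which paths are chosen; \<open>connected\<close>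
  demands that a path survives whatever finite sets \<open>g\<close> were chosen earlier.\<close>

lemma reach_reverse_arcs:
  fixes A :: "('a \<times> 'a) set" and r' :: "(('a \<times> 'a) \<times> nat) rel"
  assumes "tour V A" "R \<subseteq> A" and r: "wf r" "trans r" "total_on R r"
    and r': "wf r'" "total_on (R \<times> UNIV) r'"
    and connected: "\<And>e k g. e \<in> R \<Longrightarrow> (\<And>i. finite (g i)) \<Longrightarrow>
      (snd e, fst e) \<in> (A - ({d \<in> R. (d, e) \<in> r \<or> d = e} \<union> (\<Union>i\<in>{i \<in> R \<times> UNIV. (i, (e, k)) \<in> r'}. g i)))\<^sup>*"
  shows "reach A (V \<times> V) (undirected R)"
proof -
  let ?B = "\<lambda>e k g. A - ({d \<in> R. (d, e) \<in> r \<or> d = e} \<union> (\<Union>i\<in>{i \<in> R \<times> UNIV. (i, (e, k)) \<in> r'}. g i))"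
  \<comment> \<open>Indices whose arc is not in \<open>R\<close> are unconstrained, so that the
    recursion can run over the whole type.\<close>
  define good where "good g i X \<longleftrightarrow> (fst i \<in> R \<longrightarrow> finite X \<and> X \<subseteq> ?B (fst i) (snd i) g
    \<and> (\<forall>v. excess X v = of_bool (snd (fst i) = v) - of_bool (fst (fst i) = v)))" for g i X
  have "\<exists>f. \<forall>i. good f i (f i)"
  proof (rule dependent_wf_choice[OF r'(1)])
    fix f g :: "('a \<times> 'a) \<times> nat \<Rightarrow> ('a \<times> 'a) set" and i X
    assume "\<And>j. (j, i) \<in> r' \<Longrightarrow> f j = g j"
    then have "(\<Union>j\<in>{j \<in> R \<times> UNIV. (j, i) \<in> r'}. f j) = (\<Union>j\<in>{j \<in> R \<times> UNIV. (j, i) \<in> r'}. g j)" by auto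
    then show "good f i X = good g i X" by (simp add: good_def)
  next
    fix i and f :: "('a \<times> 'a) \<times> nat \<Rightarrow> ('a \<times> 'a) set"
    assume IH: "\<And>j. (j, i) \<in> r' \<Longrightarrow> good f j (f j)"
    show "\<exists>X. good f i X"
    proof (cases "fst i \<in> R")
      case True
      obtain e k where i: "i = (e, k)" by (cases i)
      \<comment> \<open>Values at indices that do not precede \<open>i\<close> are replaced by the
        empty set, because \<open>connected\<close> applies to families that are finite
        everywhere.\<close>
      define g where "g j = (if j \<in> R \<times> UNIV \<and> (j, i) \<in> r' then f j else {})" for j
      have "finite (g j)" for j using IH[of j] by (auto simp: g_def good_def)
      then have "(snd e, fst e) \<in> (?B e k g)\<^sup>*" using connected[of e g k] True i by simp
      moreover have eq: "?B e k g = ?B e k f" by (auto simp: g_def i)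
      ultimately obtain xs where xs: "xs \<noteq> []" "hd xs = snd e" "last xs = fst e" "distinct xs"
          "set (zip xs (tl xs)) \<subseteq> ?B e k f"
        using rtrancl_simple_path[of "snd e" "fst e" "?B e k g"] unfolding successively_zip eq by auto
      then have "good f i (set (zip xs (tl xs)))" using excess_path[OF xs(1,4)] i by (simp add: good_def)
      then show ?thesis by blast
    qed (auto simp: good_def)
  qed
  then obtain f where f: "\<And>i. good f i (f i)" by blast
  define P where "P e k = f (e, k)" for e k
  have P: "finite (P e k)" "P e k \<subseteq> ?B e k f"
    "excess (P e k) v = of_bool (snd e = v) - of_bool (fst e = v)" if "e \<in> R" for e k v
    using f[of "(e, k)"] that by (auto simp: good_def P_def)
  have disj: "P d i \<inter> P e j = {}" if *: "d \<in> R" "e \<in> R" "(d, i) \<noteq> (e, j)" for d e i j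
  proof -
    have less: "P d' i' \<inter> P e' j' = {}" if "d' \<in> R" "e' \<in> R" "((d', i'), (e', j')) \<in> r'" for d' e' i' j'
      using P(2)[OF that(2), of j'] that by (fastforce simp: P_def)
    have "((d, i), (e, j)) \<in> r' \<or> ((e, j), (d, i)) \<in> r'"
      using r'(2) * by (auto simp: total_on_def)
    then show ?thesis using less[OF *(1,2)] less[OF *(2,1)] by blast
  qed
  have A: "A \<subseteq> V \<times> V" "oriented A" using assms(1) by (auto simp: tour_def)
  have "reach A (\<Union>e\<in>R. undirected (insert e (\<Union>k. P e k))) (undirected R)"
  proof (rule reach_exact[OF A(2) assms(2) r])
    fix e k assume e: "e \<in> R"
    show "finite (P e k)" using P(1)[OF e] .
    show "P e k \<subseteq> A" using P(2)[OF e] by blast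
    show "P e k \<inter> {d \<in> R. (d, e) \<in> r \<or> d = e} = {}" using P(2)[OF e] by blast
    show "excess (P e k) v = of_bool (snd e = v) - of_bool (fst e = v)" for v using P(3)[OF e] .
  qed (rule disj)
  moreover have "undirected (insert e (\<Union>k. P e k)) \<subseteq> V \<times> V" if "e \<in> R" for e
  proof -
    have "insert e (\<Union>k. P e k) \<subseteq> V \<times> V" using P(2)[OF that] A(1) assms(2) that by blast
    then show ?thesis by (auto simp: undirected_def)
  qed
  ultimately show ?thesis by (elim reach_mono) blast
qed

lemma card_finite_less: "finite A \<Longrightarrow> infinite B \<Longrightarrow> |A| <o |B|"
  using finite_ordLess_infinite[of "|A|" "|B|"] by (simp add: card_of_well_order_on Field_card_of)

lemma card_UN_finite_less:
  assumes "infinite V" "|I| <o |V|" "\<And>i. i \<in> I \<Longrightarrow> finite (g i)"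
  shows "|\<Union>i\<in>I. g i| <o |V|"
proof (cases "finite I")
  case True
  then show ?thesis using assms by (intro card_finite_less) auto
next
  case False
  have "|\<Union>i\<in>I. g i| \<le>o |I|"
  proof (rule card_of_UNION_ordLeq_infinite[OF False])
    show "\<forall>i\<in>I. |g i| \<le>o |I|"
      using False assms(3) by (auto intro!: ordLess_imp_ordLeq card_finite_less)
  qed (simp add: card_of_mono1)
  then show ?thesis using assms(2) by (rule ordLeq_ordLess_trans)
qed

lemma card_subset_less: "|B| <o |V| \<Longrightarrow> A \<subseteq> B \<Longrightarrow> |A| <o |V|"
  using card_of_mono1 ordLeq_ordLess_trans by blast

lemma card_image_less: "|B| <o |V| \<Longrightarrow> |f ` B| <o |V|"
  using card_of_image ordLeq_ordLess_trans by blast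

lemma split_by_small_cuts:
  fixes A :: "('a \<times> 'a) set"
  assumes tour: "tour V A" and inf: "infinite V"
  shows "splits_into V A (\<lambda>S B. \<exists>X. |B \<inter> (S \<inter> X) \<times> (S - X)| <o |V|
    \<and> (\<forall>w\<in>S - X. |B `` {w} - X| <o |V| ) \<and> (\<forall>x\<in>S \<inter> X. |B\<inverse> `` {x} \<inter> X| <o |V| ))"
proof -
  have AV: "A \<subseteq> V \<times> V" and ori: "oriented A"
    and total: "\<And>u v. u \<in> V \<Longrightarrow> v \<in> V \<Longrightarrow> u \<noteq> v \<Longrightarrow> (u, v) \<in> A \<or> (v, u) \<in> A"
    using tour by (auto simp: tour_def)
  define cut where "cut X = A \<inter> X \<times> - X" for X
  \<comment> \<open>\<open>sep a b\<close> means that a small cut has \<open>a\<close> inside and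
    \<open>b\<close> outside. The classes of \<open>inc\<close> are to contain the components of the
    new tournament.\<close>
  define sep where "sep a b \<longleftrightarrow> (\<exists>X. a \<in> X \<and> b \<notin> X \<and> |cut X| <o |V| )" for a b
  define inc where "inc a b \<longleftrightarrow> a = b \<or> (sep a b \<and> sep b a)" for a b
  have Un: "|X \<union> Y| <o |V|" if "|X| <o |V|" "|Y| <o |V|" for X Y :: "'b set"
    using card_of_Un_ordLess_infinite[OF inf] that by blast
  \<comment> \<open>A vertex of \<open>X - Y\<close> is joined to \<open>b\<close>, which lies in
    \<open>Y - X\<close>. The arc leaves \<open>X\<close> or \<open>Y\<close>, so the vertex is an
    end of an arc in one of two small cuts.\<close>
  have cut_diff: "|(X - Y) \<inter> V| <o |V|"
    if "|cut X| <o |V|" "|cut Y| <o |V|" "b \<in> Y - X" "b \<in> V" for X Y b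
  proof (rule card_subset_less)
    show "|fst ` cut X \<union> snd ` cut Y| <o |V|" using that by (intro Un card_image_less)
    show "(X - Y) \<inter> V \<subseteq> fst ` cut X \<union> snd ` cut Y"
    proof
      fix w assume w: "w \<in> (X - Y) \<inter> V"
      then have "(w, b) \<in> A \<or> (b, w) \<in> A" using total[of w b] that by auto
      then have "(w, b) \<in> cut X \<or> (b, w) \<in> cut Y" using w that by (auto simp: cut_def)
      then show "w \<in> fst ` cut X \<union> snd ` cut Y" by force
    qed
  qed
  have sep_via: "sep a b \<or> sep b c" if "sep a c" for a b c using that unfolding sep_def by blast
  have not_sep: "\<not> sep a a" for a by (auto simp: sep_def)
  have sep_trans: "sep u w"
    if "sep u v" "sep v u" "sep v w" "sep w v" "u \<in> V" "v \<in> V" "w \<in> V" "u \<noteq> w" for u v w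
  proof -
    from that(1) obtain X where X: "u \<in> X" "v \<notin> X" "|cut X| <o |V|" by (auto simp: sep_def)
    from that(3) obtain Y where Y: "v \<in> Y" "w \<notin> Y" "|cut Y| <o |V|" by (auto simp: sep_def)
    show ?thesis
    proof (cases "w \<in> X \<and> u \<notin> Y")
      case True
      \<comment> \<open>Neither cut separates \<open>u\<close> from \<open>w\<close> here, but their
        intersection excludes \<open>w\<close> and lacks only \<open>u\<close>. Inserting
        \<open>u\<close> adds to the cut only arcs that leave \<open>X\<close> or end in
        \<open>X - Y\<close>, which is small by \<open>cut_diff\<close>.\<close>
      let ?Z = "insert u (X \<inter> Y)"
      have "|(X - Y) \<inter> V| <o |V|" using cut_diff[OF X(3) Y(3), of v] X Y that by auto
      then have "|Pair u ` ((X - Y) \<inter> V) \<union> (cut X \<union> cut Y)| <o |V|"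
        using X Y by (intro Un card_image_less)
      moreover have "cut ?Z \<subseteq> Pair u ` ((X - Y) \<inter> V) \<union> (cut X \<union> cut Y)"
        using X(1) AV by (auto simp: cut_def)
      ultimately have "|cut ?Z| <o |V|" by (rule card_subset_less)
      moreover have "w \<notin> ?Z" using Y that by auto
      ultimately show ?thesis unfolding sep_def by blast
    next
      case False
      then show ?thesis using X Y unfolding sep_def by blast
    qed
  qed
  obtain s where s: "wf s" "trans s" "total_on V s" using ex_strict_well_order by blast
  have s_asym: "(a, b) \<in> s \<Longrightarrow> (b, a) \<notin> s" for a b using s(1) by (meson wf_asym)
  \<comment> \<open>This orders the classes so that reversal is possible: an arc from
    \<open>b\<close> to \<open>a\<close> is turned only if no small cut separates \<open>a\<close>
    from \<open>b\<close>. If no small cut separates the two in either direction, the arbitrary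
    well-order \<open>s\<close> decides.\<close>
  define before where "before a b \<longleftrightarrow> \<not> sep a b \<and> (sep b a \<or> (a, b) \<in> s)" for a b
  define R where "R = {(b, a). (b, a) \<in> A \<and> before a b}"
  have RA: "R \<subseteq> A" by (auto simp: R_def)
  have VV: "|V \<times> V| =o |V|" using card_of_Times_same_infinite[OF inf] .
  have "|R| \<le>o |V \<times> V|" using RA AV by (intro card_of_mono1) auto
  then have RV: "|R| \<le>o |V|" using VV by (rule ordLeq_ordIso_trans)
  have RnV: "|R \<times> (UNIV :: nat set)| \<le>o |V|"
    using inf RV by (intro card_of_Times_ordLeq_infinite_Field)
      (auto simp: Field_card_of card_of_card_order_on infinite_iff_card_of_nat[symmetric])
  obtain r where r: "wf r" "trans r" "total_on R r" "\<And>e. e \<in> R \<Longrightarrow> |{d \<in> R. (d, e) \<in> r}| <o |R|"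
    using ex_small_strict_well_order[of R] by blast
  obtain r' where r': "wf r'" "trans r'" "total_on (R \<times> (UNIV :: nat set)) r'"
      "\<And>i. i \<in> R \<times> UNIV \<Longrightarrow> |{j \<in> R \<times> UNIV. (j, i) \<in> r'}| <o |R \<times> (UNIV :: nat set)|"
    using ex_small_strict_well_order[of "R \<times> (UNIV :: nat set)"] by blast
  have reach: "reach A (V \<times> V) (undirected R)"
  proof (rule reach_reverse_arcs[OF tour RA r(1-3) r'(1,3)])
    fix e k and g :: "('a \<times> 'a) \<times> nat \<Rightarrow> ('a \<times> 'a) set"
    assume e: "e \<in> R" and g: "\<And>i. finite (g i)"
    let ?F = "{d \<in> R. (d, e) \<in> r \<or> d = e} \<union> (\<Union>i\<in>{i \<in> R \<times> UNIV. (i, (e, k)) \<in> r'}. g i)"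
    \<comment> \<open>The arcs leaving the set reachable from \<open>snd e\<close> after the
      deletion were all deleted. The cut is therefore small and cannot separate \<open>snd e\<close>
      from \<open>fst e\<close>.\<close>
    let ?X = "(A - ?F)\<^sup>* `` {snd e}"
    have "|{d \<in> R. (d, e) \<in> r} \<union> {e}| <o |V|"
      using r(4)[OF e] RV inf by (intro Un) (auto intro: ordLess_ordLeq_trans card_finite_less)
    moreover have "|{i \<in> R \<times> UNIV. (i, (e, k)) \<in> r'}| <o |V|"
      using r'(4)[of "(e, k)"] RnV e by (auto intro: ordLess_ordLeq_trans)
    then have "|\<Union>i\<in>{i \<in> R \<times> UNIV. (i, (e, k)) \<in> r'}. g i| <o |V|"
      using g by (intro card_UN_finite_less[OF inf]) auto
    ultimately have "|({d \<in> R. (d, e) \<in> r} \<union> {e}) \<union> (\<Union>i\<in>{i \<in> R \<times> UNIV. (i, (e, k)) \<in> r'}. g i)| <o |V|"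
      by (rule Un)
    moreover have "cut ?X \<subseteq> ({d \<in> R. (d, e) \<in> r} \<union> {e}) \<union> (\<Union>i\<in>{i \<in> R \<times> UNIV. (i, (e, k)) \<in> r'}. g i)"
    proof
      fix f assume "f \<in> cut ?X"
      then obtain x y where f: "f = (x, y)" "(x, y) \<in> A" "(snd e, x) \<in> (A - ?F)\<^sup>*" "(snd e, y) \<notin> (A - ?F)\<^sup>*"
        unfolding cut_def by blast
      then have "(x, y) \<in> ?F" by (meson DiffI rtrancl.rtrancl_into_rtrancl)
      then show "f \<in> ({d \<in> R. (d, e) \<in> r} \<union> {e}) \<union> (\<Union>i\<in>{i \<in> R \<times> UNIV. (i, (e, k)) \<in> r'}. g i)"
        using f(1) by auto
    qed
    ultimately have "|cut ?X| <o |V|" by (rule card_subset_less)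
    moreover have "\<not> sep (snd e) (fst e)" using e by (auto simp: R_def before_def)
    ultimately show "(snd e, fst e) \<in> (A - ?F)\<^sup>*" unfolding sep_def by blast
  qed
  define A' where "A' = flip A (undirected R)"
  have A'V: "A' \<subseteq> V \<times> V" unfolding A'_def using AV by (rule flip_subset)
  have inc_before: "\<not> before a b" if "inc a b" for a b
    using that s_asym[of a a] not_sep by (auto simp: inc_def before_def)
  have arc: "inc u v \<or> before u v" if "(u, v) \<in> A'" for u v
  proof (rule ccontr)
    assume n: "\<not> (inc u v \<or> before u v)"
    have V: "u \<in> V" "v \<in> V" using that A'V by auto
    then have vu: "before v u" using n s(3) unfolding inc_def before_def total_on_def by blast
    show False
    proof (cases "(u, v) \<in> A")
      case True
      then have "(u, v) \<in> undirected R" using vu by (auto simp: R_def undirected_def)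
      then have "(v, u) \<in> A" using that by (simp add: A'_def in_flip)
      then show False using True ori by (auto simp: oriented_def)
    next
      case False
      then have "(u, v) \<in> undirected R" using that by (auto simp: A'_def in_flip split: if_splits)
      then have "(v, u) \<in> R" using False RA by (auto simp: undirected_def)
      then show False using n by (auto simp: R_def)
    qed
  qed
  have trans: "inc u w \<or> before u w"
    if "inc u v \<or> before u v" "inc v w \<or> before v w" "u \<in> V" "v \<in> V" "w \<in> V" for u v w
  proof -
    from that(1,2) consider "inc u v" "inc v w" | "before u v" "inc v w" | "inc u v" "before v w"
      | "before u v" "before v w" by blast
    then show ?thesis
    proof cases
      case 1
      then show ?thesis using sep_trans[of u v w] sep_trans[of w v u] that unfolding inc_def by metis
    next
      case 2
      then show ?thesis using sep_via[of w v u] sep_via[of w u v] sep_via[of u w v]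
        unfolding inc_def before_def by metis
    next
      case 3
      then show ?thesis using sep_via unfolding inc_def before_def by metis
    next
      case 4
      then have "\<not> sep u w" using sep_via unfolding before_def by blast
      moreover have "sep w u \<or> (u, w) \<in> s"
        using 4 sep_via s(2) unfolding before_def by (meson transD)
      ultimately show ?thesis unfolding before_def by blast
    qed
  qed
  have path: "inc u v \<or> before u v" if "(u, v) \<in> A'\<^sup>*" "u \<in> V" for u v
    using that(1)
  proof (induction rule: rtrancl_induct)
    case (step y z)
    then show ?case using trans[of u y z] arc[of y z] A'V that(2) by blast
  qed (simp add: inc_def)
  have "\<exists>X. |(A' \<inter> S \<times> S) \<inter> (S \<inter> X) \<times> (S - X)| <o |V|
    \<and> (\<forall>w\<in>S - X. |(A' \<inter> S \<times> S) `` {w} - X| <o |V| ) \<and> (\<forall>x\<in>S \<inter> X. |(A' \<inter> S \<times> S)\<inverse> `` {x} \<inter> X| <o |V| )"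
    if S: "S = scc A' t" and t: "t \<in> V" for S t
  proof -
    have SV: "S \<subseteq> V" unfolding S using A'V t by (rule scc_subset)
    have incS: "inc a b" if "a \<in> S" "b \<in> S" for a b
    proof -
      have "(a, b) \<in> A'\<^sup>*" "(b, a) \<in> A'\<^sup>*" using that unfolding S scc_def by (auto intro: rtrancl_trans)
      then have "inc a b \<or> before a b" "inc b a \<or> before b a" using path SV that by blast+
      moreover have "\<not> (before a b \<and> before b a)" using s_asym unfolding before_def by blast
      ultimately show ?thesis unfolding inc_def by blast
    qed
    let ?B = "A' \<inter> S \<times> S"
    have BA: "?B \<subseteq> A"
    proof
      fix f assume f: "f \<in> ?B"
      obtain a b where ab: "f = (a, b)" by (cases f)
      then have "inc a b" "inc b a" using f incS by auto
      then have "(a, b) \<notin> undirected R" using inc_before by (auto simp: undirected_def R_def)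
      then show "f \<in> A" using f ab by (auto simp: A'_def in_flip)
    qed
    show ?thesis
    proof (cases "S = {t}")
      case True
      have "finite ?B" using True by (intro finite_subset[of ?B "{(t, t)}"]) auto
      then have "|?B `` {w} - {}| <o |V|" for w using inf by (intro card_finite_less) auto
      then show ?thesis using inf by (intro exI[of _ "{}"]) (auto intro: card_finite_less)
    next
      case False
      then obtain u where u: "u \<in> S" "u \<noteq> t" using S scc_refl by fastforce
      have tS: "t \<in> S" by (simp add: S)
      \<comment> \<open>Two distinct vertices of the component provide the required cut; they also
        serve as reference points for the degree bounds.\<close>
      obtain X where X: "u \<in> X" "t \<notin> X" "|cut X| <o |V|"
        using incS[OF u(1) tS] u(2) by (auto simp: inc_def sep_def)
      have "|?B \<inter> (S \<inter> X) \<times> (S - X)| <o |V|"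
        using X(3) by (rule card_subset_less) (use BA in \<open>auto simp: cut_def\<close>)
      moreover have "|?B `` {w} - X| <o |V|" if w: "w \<in> S - X" for w
      proof -
        \<comment> \<open>An out-neighbour of \<open>w\<close> outside \<open>X\<close> lies in
          \<open>Y - X\<close>, which is small because \<open>u\<close> is in \<open>X - Y\<close>,
          or is the head of an arc leaving \<open>Y\<close>. The bound on indegrees is symmetric,
          with \<open>t\<close> in place of \<open>u\<close>.\<close>
        obtain Y where Y: "w \<in> Y" "u \<notin> Y" "|cut Y| <o |V|"
          using incS[of w u] w u X by (auto simp: inc_def sep_def)
        have "|(Y - X) \<inter> V| <o |V|" using cut_diff[OF Y(3) X(3), of u] X Y u SV by auto
        then have "|(Y - X) \<inter> V \<union> snd ` cut Y| <o |V|" using Y by (intro Un card_image_less)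
        moreover have "?B `` {w} - X \<subseteq> (Y - X) \<inter> V \<union> snd ` cut Y"
          using BA Y(1) SV by (force simp: cut_def)
        ultimately show ?thesis by (rule card_subset_less)
      qed
      moreover have "|?B\<inverse> `` {x} \<inter> X| <o |V|" if x: "x \<in> S \<inter> X" for x
      proof -
        obtain Y where Y: "t \<in> Y" "x \<notin> Y" "|cut Y| <o |V|"
          using incS[of t x] x tS X by (auto simp: inc_def sep_def)
        have "|(X - Y) \<inter> V| <o |V|" using cut_diff[OF X(3) Y(3), of t] X Y tS SV by auto
        then have "|(X - Y) \<inter> V \<union> fst ` cut Y| <o |V|" using Y by (intro Un card_image_less)
        moreover have "?B\<inverse> `` {x} \<inter> X \<subseteq> (X - Y) \<inter> V \<union> fst ` cut Y"
          using BA Y(2) SV by (force simp: cut_def)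
        ultimately show ?thesis by (rule card_subset_less)
      qed
      ultimately show ?thesis by blast
    qed
  qed
  then show ?thesis unfolding splits_into_def A'_def[symmetric] using reach
    by (intro exI[of _ "undirected R"]) (simp add: A'_def)
qed

section \<open>Uncountable tournaments\<close>

text \<open>
  The set \<open>V\<close> only serves as a bound for cardinalities.
\<close>

definition thins :: "'v set \<Rightarrow> 'a set \<Rightarrow> ('a \<times> 'a) set \<Rightarrow> 'a set \<Rightarrow> bool" where
  "thins V S B W \<longleftrightarrow> (\<exists>N. reach B (S \<times> S) N \<and> N \<inter> (S - W) \<times> (S - W) = {}
     \<and> flip B N \<inter> (S - W) \<times> W \<subseteq> B \<and> (\<forall>v\<in>S. |scc (flip B N) v \<inter> W| <o |V| ))"

section \<open>Cardinal bounds and degrees in tournaments\<close>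

lemma card_Un_le: "infinite Q \<Longrightarrow> |X| \<le>o |Q| \<Longrightarrow> |Y| \<le>o |Q| \<Longrightarrow> |X \<union> Y| \<le>o |Q|"
  by (rule card_of_Un_ordLeq_infinite_Field)
    (auto simp: Field_card_of card_of_card_order_on)

lemma card_UN_le:
  "infinite Q \<Longrightarrow> |I| \<le>o |Q| \<Longrightarrow> (\<And>i. i \<in> I \<Longrightarrow> |X i| \<le>o |Q| ) \<Longrightarrow> |\<Union>i\<in>I. X i| \<le>o |Q|"
  by (rule card_of_UNION_ordLeq_infinite) auto

lemma card_finite_le: "finite X \<Longrightarrow> infinite Q \<Longrightarrow> |X| \<le>o |Q|"
  using card_finite_less ordLess_imp_ordLeq by blast

lemma card_subset_le: "|Y| \<le>o |Q| \<Longrightarrow> X \<subseteq> Y \<Longrightarrow> |X| \<le>o |Q|"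
  using card_of_mono1 ordLeq_transitive by blast

lemma card_image_le: "|X| \<le>o |Q| \<Longrightarrow> |f ` X| \<le>o |Q|"
  using card_of_image ordLeq_transitive by blast

lemma card_not_less: "\<not> |X| <o |Y| \<longleftrightarrow> |Y| \<le>o |X|"
  by (simp add: not_ordLess_iff_ordLeq card_of_Well_order)

lemma card_closure_le:
  assumes "infinite Q" "|H| \<le>o |Q|" "\<And>x. |L `` {x}| \<le>o |Q|"
  shows "|L\<^sup>* `` H| \<le>o |Q|"
proof -
  have "|(L ^^ n) `` H| \<le>o |Q|" for n
  proof (induction n)
    case (Suc n)
    have "(L ^^ Suc n) `` H = (\<Union>x\<in>(L ^^ n) `` H. L `` {x})" by auto
    then show ?case by (simp only:) (rule card_UN_le[OF assms(1) Suc assms(3)])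
  qed (use assms in simp)
  moreover have "L\<^sup>* `` H = (\<Union>n. (L ^^ n) `` H)" unfolding rtrancl_is_UN_relpow by blast
  moreover have "|UNIV :: nat set| \<le>o |Q|" using assms(1) infinite_iff_card_of_nat by blast
  ultimately show ?thesis by (simp only:) (rule card_UN_le[OF assms(1)])
qed

text \<open>Otherwise choose \<open>|Q|\<close> vertices of \<open>M\<close>. They and their
  out-neighbours in \<open>W\<close> do not cover \<open>M\<close>, so some \<open>z\<close> in
  \<open>M\<close> has arcs to all the chosen vertices and thus too large an outdegree.\<close>

lemma card_bounded_outdegree:
  assumes tour: "tour S B" and "W \<subseteq> S" "M \<subseteq> W" and inf: "infinite Q"
    and out: "\<And>v. v \<in> M \<Longrightarrow> |B `` {v} \<inter> W| <o |Q|"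
  shows "|M| \<le>o |Q|"
proof (rule ccontr)
  assume nle: "\<not> |M| \<le>o |Q|"
  then have less: "|Q| <o |M|" using card_not_less by blast
  then have "|Q| \<le>o |M|" by (rule ordLess_imp_ordLeq)
  then obtain f where f: "inj_on f Q" "f ` Q \<subseteq> M" using card_of_ordLeq[of Q M] by auto
  let ?Y = "f ` Q"
  have YQ: "|?Y| \<le>o |Q|" by (rule card_of_image)
  have "|\<Union>y\<in>?Y. B `` {y} \<inter> W| \<le>o |Q|"
  proof (rule card_UN_le[OF inf YQ])
    fix y assume "y \<in> ?Y"
    then show "|B `` {y} \<inter> W| \<le>o |Q|" using out f(2) by (blast intro: ordLess_imp_ordLeq)
  qed
  with YQ have "|?Y \<union> (\<Union>y\<in>?Y. B `` {y} \<inter> W)| \<le>o |Q|" by (rule card_Un_le[OF inf])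
  then have "\<not> M \<subseteq> ?Y \<union> (\<Union>y\<in>?Y. B `` {y} \<inter> W)"
    using card_subset_le[of _ Q M] nle by blast
  then obtain z where zM: "z \<in> M" and zU: "z \<notin> ?Y \<union> (\<Union>y\<in>?Y. B `` {y} \<inter> W)" unfolding subset_eq Ball_def not_all not_imp by (elim exE conjE)
  then have z: "z \<in> M" "z \<notin> ?Y" "\<And>y. y \<in> ?Y \<Longrightarrow> (y, z) \<notin> B" using assms(3) by auto
  have "?Y \<subseteq> B `` {z} \<inter> W"
  proof
    fix y assume y: "y \<in> ?Y"
    then have "y \<in> M" "y \<noteq> z" using f(2) z(2) by blast+
    then have "y \<noteq> z" "y \<in> S" "z \<in> S" "y \<in> W" using z(1) assms(2,3) by auto
    then show "y \<in> B `` {z} \<inter> W" using tour z(3)[OF y] unfolding tour_def by blast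
  qed
  then have "|?Y| \<le>o |B `` {z} \<inter> W|" by (rule card_of_mono1)
  moreover have "|Q| \<le>o |?Y|" using f(1) by (intro card_of_ordLeqI[of f]) auto
  ultimately have "|Q| \<le>o |B `` {z} \<inter> W|" by (rule ordLeq_transitive[rotated])
  then show False using not_ordLess_ordLeq[OF out[OF z(1)]] by simp
qed

text \<open>Sort by the cardinality of \<open>\<kappa>\<close>, and order each class of equal
  cardinality by a well-order of least type. The part of a segment within its own class has size
  below the cardinal successor of \<open>|\<kappa> e|\<close>, hence at most
  \<open>|\<kappa> e|\<close>.\<close>

lemma ex_order_with_bounded_segments:
  fixes \<kappa> :: "'m \<Rightarrow> 'b set"
  assumes inf: "\<And>e. e \<in> R \<Longrightarrow> infinite (\<kappa> e)"
    and lower: "\<And>e. e \<in> R \<Longrightarrow> |{d \<in> R. |\<kappa> d| <o |\<kappa> e| }| \<le>o |\<kappa> e|"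
    and same: "\<And>e. e \<in> R \<Longrightarrow> |{d \<in> R. |\<kappa> d| =o |\<kappa> e| }| \<le>o cardSuc |\<kappa> e|"
  shows "\<exists>r. wf r \<and> trans r \<and> total_on R r \<and> (\<forall>e\<in>R. |{d \<in> R. (d, e) \<in> r}| \<le>o |\<kappa> e| )"
proof -
  define cl where "cl e = {d \<in> R. |\<kappa> d| =o |\<kappa> e| }" for e
  have "\<forall>C :: 'm set. \<exists>r. wf r \<and> trans r \<and> total_on C r \<and> (\<forall>j\<in>C. |{i \<in> C. (i, j) \<in> r}| <o |C| )"
    by (intro allI ex_small_strict_well_order)
  from choice[OF this] obtain c where
    "\<forall>C :: 'm set. wf (c C) \<and> trans (c C) \<and> total_on C (c C) \<and> (\<forall>j\<in>C. |{i \<in> C. (i, j) \<in> c C}| <o |C| )"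
    by (elim exE)
  then have c: "wf (c C)" "trans (c C)" "total_on C (c C)"
      "j \<in> C \<Longrightarrow> |{i \<in> C. (i, j) \<in> c C}| <o |C|" for C :: "'m set" and j
    by blast+
  define r where "r = {(d, e). d \<in> R \<and> e \<in> R \<and> ( |\<kappa> d| <o |\<kappa> e| \<or> ( |\<kappa> d| =o |\<kappa> e| \<and> (d, e) \<in> c (cl e)))}"
  have cl_eq: "cl d = cl e" if "|\<kappa> d| =o |\<kappa> e|" for d e
    using that unfolding cl_def by (auto intro: ordIso_transitive ordIso_symmetric)
  have wf_key: "wf (inv_image ordLess (\<lambda>e. |\<kappa> e| ))" by (rule wf_inv_image[OF wf_ordLess])
  have "wf r"
  proof (rule wfI_min)
    fix x and Q assume x: "x \<in> (Q :: 'm set)"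
    show "\<exists>z\<in>Q. \<forall>y. (y, z) \<in> r \<longrightarrow> y \<notin> Q"
    proof (cases "Q \<inter> R = {}")
      case True
      then show ?thesis using x unfolding r_def by blast
    next
      case False
      then obtain m where m: "m \<in> Q \<inter> R" "\<And>y. (y, m) \<in> inv_image ordLess (\<lambda>e. |\<kappa> e| ) \<Longrightarrow> y \<notin> Q \<inter> R"
        using wfE_min[OF wf_key] by (metis ex_in_conv)
      then have "m \<in> Q \<inter> cl m" by (simp add: cl_def card_of_refl)
      then obtain z where z: "z \<in> Q \<inter> cl m" "\<And>y. (y, z) \<in> c (cl m) \<Longrightarrow> y \<notin> Q \<inter> cl m"
        using wfE_min[OF c(1)[of "cl m"]] by metis
      have zm: "|\<kappa> z| =o |\<kappa> m|" using z(1) by (simp add: cl_def)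
      have "y \<notin> Q" if y: "(y, z) \<in> r" for y
      proof
        assume yQ: "y \<in> Q"
        have yR: "y \<in> R" using y by (simp add: r_def)
        consider "|\<kappa> y| <o |\<kappa> z|" | "|\<kappa> y| =o |\<kappa> z|" "(y, z) \<in> c (cl z)" using y by (auto simp: r_def)
        then show False
        proof cases
          case 1
          then have "|\<kappa> y| <o |\<kappa> m|" using zm ordLess_ordIso_trans by blast
          then show False using m(2)[of y] yQ yR by simp
        next
          case 2
          then have "y \<in> cl m" using yR zm ordIso_transitive unfolding cl_def by blast
          then show False using z(2)[of y] 2 yQ cl_eq[OF zm] by simp
        qed
      qed
      then show ?thesis using z(1) by blast
    qed
  qed
  moreover have "trans r"
  proof (rule transI)
    fix x y z assume xy: "(x, y) \<in> r" and yz: "(y, z) \<in> r"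
    then have R: "x \<in> R" "z \<in> R" by (auto simp: r_def)
    consider "|\<kappa> x| <o |\<kappa> y|" | "|\<kappa> x| =o |\<kappa> y|" "(x, y) \<in> c (cl y)" using xy by (auto simp: r_def)
    then show "(x, z) \<in> r"
    proof cases
      case 1
      then have "|\<kappa> x| <o |\<kappa> z|"
        using yz ordLess_transitive ordLess_ordIso_trans unfolding r_def by blast
      then show ?thesis using R by (simp add: r_def)
    next
      case x: 2
      consider "|\<kappa> y| <o |\<kappa> z|" | "|\<kappa> y| =o |\<kappa> z|" "(y, z) \<in> c (cl z)" using yz by (auto simp: r_def)
      then show ?thesis
      proof cases
        case 1
        then have "|\<kappa> x| <o |\<kappa> z|" using x(1) ordIso_ordLess_trans by blast
        then show ?thesis using R by (simp add: r_def)
      next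
        case 2
        then have "(x, z) \<in> c (cl z)" using x(2) cl_eq[OF 2(1)] c(2)[of "cl z"] by (metis transD)
        moreover have "|\<kappa> x| =o |\<kappa> z|" using 2 x(1) ordIso_transitive by blast
        ultimately show ?thesis using R by (simp add: r_def)
      qed
    qed
  qed
  moreover have "total_on R r"
  proof (rule total_onI)
    fix x y assume xy: "x \<in> R" "y \<in> R" "x \<noteq> y"
    consider "|\<kappa> x| <o |\<kappa> y|" | "|\<kappa> y| <o |\<kappa> x|" | "|\<kappa> x| =o |\<kappa> y|"
      using card_not_less ordLeq_iff_ordLess_or_ordIso by blast
    then show "(x, y) \<in> r \<or> (y, x) \<in> r"
    proof cases
      case 3
      then have "x \<in> cl y" "y \<in> cl y" "cl x = cl y" using xy cl_eq by (auto simp: cl_def card_of_refl)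
      then show ?thesis
        using c(3)[of "cl y"] xy 3 ordIso_symmetric[OF 3] by (auto simp: r_def total_on_def)
    qed (use xy in \<open>auto simp: r_def\<close>)
  qed
  moreover have "|{d \<in> R. (d, e) \<in> r}| \<le>o |\<kappa> e|" if e: "e \<in> R" for e
  proof (rule card_subset_le)
    have "e \<in> cl e" using e by (simp add: cl_def card_of_refl)
    then have "|{d \<in> cl e. (d, e) \<in> c (cl e)}| <o |cl e|" by (rule c(4))
    also have "|cl e| \<le>o cardSuc |\<kappa> e|" using same[OF e] by (simp add: cl_def)
    finally (ordLess_ordLeq_trans) have "|{d \<in> cl e. (d, e) \<in> c (cl e)}| \<le>o |\<kappa> e|"
      by (simp add: cardSuc_ordLeq_ordLess card_of_Card_order)
    then show "|{d \<in> R. |\<kappa> d| <o |\<kappa> e| } \<union> {d \<in> cl e. (d, e) \<in> c (cl e)}| \<le>o |\<kappa> e|"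
      using lower[OF e] by (intro card_Un_le[OF inf[OF e]])
    show "{d \<in> R. (d, e) \<in> r} \<subseteq> {d \<in> R. |\<kappa> d| <o |\<kappa> e| } \<union> {d \<in> cl e. (d, e) \<in> c (cl e)}"
      by (auto simp: r_def cl_def)
  qed
  ultimately show ?thesis by blast
qed

text \<open>Arcs along which the outdegree into \<open>W\<close> grows are reversed, where
  outdegrees up to the size of the cut and up to countable ones are not distinguished. Afterwards
  this rank is constant on each component and bounds the part of the component in
  \<open>W\<close>.\<close>

lemma thins_uncountable:
  fixes B :: "('a \<times> 'a) set"
  assumes tour: "tour S B" and WS: "W \<subseteq> S" and unc: "|UNIV :: nat set| <o |V|"
    and cut: "|B \<inter> (S - W) \<times> W| <o |V|"
    and outW: "\<And>w. w \<in> W \<Longrightarrow> |B `` {w} \<inter> W| <o |V|"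
  shows "thins V S B W"
proof -
  have BS: "B \<subseteq> S \<times> S" and ori: "oriented B"
    and total: "\<And>u v. u \<in> S \<Longrightarrow> v \<in> S \<Longrightarrow> u \<noteq> v \<Longrightarrow> (u, v) \<in> B \<or> (v, u) \<in> B"
    using tour by (auto simp: tour_def)
  have infV: "infinite V" using unc by (meson infinite_iff_card_of_nat ordLess_imp_ordLeq)
  define C where "C = B \<inter> (S - W) \<times> W"
  define G where "G = C <+> (UNIV :: nat set)"
  define out where "out v = B `` {v} \<inter> W" for v
  \<comment> \<open>A set whose cardinality is the maximum of the outdegree into \<open>W\<close>,
    the number of arcs of \<open>C\<close> entering \<open>W\<close>, and aleph-zero.\<close>
  define \<kappa> where "\<kappa> v = out v <+> G" for v
  have infG: "infinite G" by (auto simp: G_def)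
  then have inf\<kappa>: "infinite (\<kappa> v)" for v by (auto simp: \<kappa>_def)
  have G_le: "|G| \<le>o |\<kappa> v|" and out_le: "|out v| \<le>o |\<kappa> v|" for v
    unfolding \<kappa>_def by (rule card_of_Plus2, rule card_of_Plus1)
  have C_le: "|C| \<le>o |G|" and nat_le: "|UNIV :: nat set| \<le>o |G|"
    unfolding G_def by (rule card_of_Plus1, rule card_of_Plus2)
  have \<kappa>_le: "|\<kappa> v| \<le>o |Q|" if "|out v| \<le>o |Q|" "|G| \<le>o |Q|" "infinite Q" for v and Q :: "'q set"
    unfolding \<kappa>_def using that by (intro card_of_Plus_ordLeq_infinite_Field)
      (auto simp: Field_card_of card_of_card_order_on)
  have out_nW: "|out v| \<le>o |G|" if "v \<in> S - W" for v
  proof (rule card_subset_le)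
    show "|snd ` C| \<le>o |G|" using C_le by (rule card_image_le)
    show "out v \<subseteq> snd ` C" using that by (force simp: out_def C_def)
  qed
  have "|G| <o |V|" unfolding G_def using cut unc infV
    by (intro card_of_Plus_ordLess_infinite) (auto simp: C_def)
  moreover from this have "|out v| <o |V|" if "v \<in> S" for v
    using outW[of v] out_nW[of v] that by (cases "v \<in> W") (auto simp: out_def[of v] intro: ordLeq_ordLess_trans)
  ultimately have \<kappa>_less: "|\<kappa> v| <o |V|" if "v \<in> S" for v
    unfolding \<kappa>_def using that infV by (intro card_of_Plus_ordLess_infinite) auto
  define R where "R = {(v, z) \<in> B. |\<kappa> v| <o |\<kappa> z| }"
  have RB: "R \<subseteq> B" by (auto simp: R_def)
  \<comment> \<open>\<open>G\<close> is absorbed by \<open>\<kappa> v\<close>, so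
    \<open>\<kappa> z\<close> can exceed it only through \<open>out z\<close>.\<close>
  have R_out: "|\<kappa> v| <o |out z|" if "(v, z) \<in> R" for v z
  proof (rule ccontr)
    assume "\<not> |\<kappa> v| <o |out z|"
    then have "|\<kappa> z| \<le>o |\<kappa> v|" using G_le inf\<kappa> card_not_less by (intro \<kappa>_le) auto
    then show False using that not_ordLess_ordLeq by (auto simp: R_def)
  qed
  have R_W: "z \<in> W" if "(v, z) \<in> R" for v z
  proof (rule ccontr)
    assume "z \<notin> W"
    then have "|out z| \<le>o |G|" using that RB BS by (intro out_nW) auto
    then have "|out z| \<le>o |\<kappa> v|" using G_le ordLeq_transitive by blast
    then show False using R_out[OF that] not_ordLess_ordLeq by blast
  qed
  \<comment> \<open>This gives both counts for \<open>ex_order_with_bounded_segments\<close>: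
    \<open>Q\<close> is \<open>\<kappa> (fst e)\<close> for the smaller ranks and has the successor
    cardinal for the rank of \<open>e\<close> itself. Arcs of \<open>R\<close> with tail outside
    \<open>W\<close> have their head in \<open>W\<close> and so belong to \<open>C\<close>.\<close>
  have source_bound: "|{d \<in> R. fst d \<in> W \<longrightarrow> fst d \<in> M}| \<le>o |Q|"
    if "M \<subseteq> W" "\<And>v. v \<in> M \<Longrightarrow> |out v| <o |Q|" "|G| \<le>o |Q|" "infinite Q" for M and Q :: "'q set"
  proof (rule card_subset_le)
    have "|M| \<le>o |Q|" using that by (intro card_bounded_outdegree[OF tour WS]) (auto simp: out_def)
    then show "|(\<Union>v\<in>M. Pair v ` out v) \<union> C| \<le>o |Q|"
      using that C_le by (intro card_Un_le card_UN_le card_image_le)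
        (auto intro: ordLess_imp_ordLeq ordLeq_transitive)
    show "{d \<in> R. fst d \<in> W \<longrightarrow> fst d \<in> M} \<subseteq> (\<Union>v\<in>M. Pair v ` out v) \<union> C"
    proof
      fix d assume d: "d \<in> {d \<in> R. fst d \<in> W \<longrightarrow> fst d \<in> M}"
      obtain v z where vz: "d = (v, z)" by (cases d)
      then have "z \<in> W" "(v, z) \<in> B" using d R_W RB by auto
      then show "d \<in> (\<Union>v\<in>M. Pair v ` out v) \<union> C" using d vz BS by (auto simp: out_def C_def)
    qed
  qed
  have "\<exists>r. wf r \<and> trans r \<and> total_on R r \<and> (\<forall>e\<in>R. |{d \<in> R. (d, e) \<in> r}| \<le>o |\<kappa> (fst e)| )"
  proof (rule ex_order_with_bounded_segments)
    fix e assume e: "e \<in> R"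
    show "infinite (\<kappa> (fst e))" by (rule inf\<kappa>)
    show "|{d \<in> R. |\<kappa> (fst d)| <o |\<kappa> (fst e)| }| \<le>o |\<kappa> (fst e)|"
    proof (rule card_subset_le[OF source_bound])
      fix v assume "v \<in> {v \<in> W. |\<kappa> v| <o |\<kappa> (fst e)| }"
      then show "|out v| <o |\<kappa> (fst e)|" using out_le ordLeq_ordLess_trans by blast
    qed (use G_le inf\<kappa> in auto)
    let ?c = "cardSuc |\<kappa> (fst e)|"
    have co: "Card_order ?c" by (rule cardSuc_Card_order[OF card_of_Card_order])
    have less: "|\<kappa> (fst e)| <o ?c" by (rule cardSuc_greater[OF card_of_Card_order])
    have Fc: "|Field ?c| =o ?c" using co by (rule card_of_Field_ordIso)
    have lessF: "|\<kappa> (fst e)| <o |Field ?c|" using less ordIso_symmetric[OF Fc] ordLess_ordIso_trans by blast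
    have "|{d \<in> R. |\<kappa> (fst d)| =o |\<kappa> (fst e)| }| \<le>o |Field ?c|"
    proof (rule card_subset_le[OF source_bound])
      fix v assume "v \<in> {v \<in> W. |\<kappa> v| =o |\<kappa> (fst e)| }"
      then have "|out v| \<le>o |\<kappa> (fst e)|" using out_le ordLeq_ordIso_trans by blast
      then show "|out v| <o |Field ?c|" using lessF ordLeq_ordLess_trans by blast
    next
      show "|G| \<le>o |Field ?c|" using G_le lessF ordLeq_ordLess_trans ordLess_imp_ordLeq by blast
      show "infinite (Field ?c)" using inf\<kappa> cardSuc_finite[OF card_of_Card_order, of "\<kappa> (fst e)"] by (simp only: Field_card_of not_False_eq_True)
    qed auto
    then show "|{d \<in> R. |\<kappa> (fst d)| =o |\<kappa> (fst e)| }| \<le>o ?c" using Fc ordLeq_ordIso_trans by blast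
  qed
  then obtain r where r: "wf r" "trans r" "total_on R r"
      "\<And>e. e \<in> R \<Longrightarrow> |{d \<in> R. (d, e) \<in> r}| \<le>o |\<kappa> (fst e)|" by blast
  have reach: "reach B (S \<times> S) (undirected R)"
  \<comment> \<open>Paths are chosen here in the order in which their arcs are reversed, so at most
    \<open>|\<kappa> v|\<close> arcs are forbidden at the turn of an arc with tail
    \<open>v\<close>.\<close>
  proof (rule reach_reverse_arcs[OF tour RB r(1-3), where r' = "r <*lex*> ord_less"])
    show "wf (r <*lex*> (ord_less :: nat rel))" by (rule wf_lex_prod[OF r(1) wf_less])
    show "total_on (R \<times> UNIV) (r <*lex*> (ord_less :: nat rel))" using r(3) by (auto simp: total_on_def)
    fix e and k :: nat and g :: "('a \<times> 'a) \<times> nat \<Rightarrow> ('a \<times> 'a) set"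
    assume e: "e \<in> R" and g: "\<And>i. finite (g i)"
    obtain v z where vz: "e = (v, z)" by (cases e)
    let ?D = "{d \<in> R. (d, e) \<in> r \<or> d = e}"
    let ?I = "{i \<in> R \<times> UNIV. (i, (e, k)) \<in> r <*lex*> ord_less}"
    let ?F = "?D \<union> (\<Union>i\<in>?I. g i)"
    have D: "|?D| \<le>o |\<kappa> v|"
    proof (rule card_subset_le)
      show "|{d \<in> R. (d, e) \<in> r} \<union> {e}| \<le>o |\<kappa> v|"
        using r(4)[OF e] vz by (intro card_Un_le[OF inf\<kappa> _ card_finite_le[OF _ inf\<kappa>]]) auto
    qed auto
    have I: "|?I| \<le>o |\<kappa> v|"
    proof (rule card_subset_le)
      show "|?D \<times> (UNIV :: nat set)| \<le>o |\<kappa> v|"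
        using D ordLeq_transitive[OF nat_le G_le] inf\<kappa> by (intro card_of_Times_ordLeq_infinite_Field)
          (auto simp: Field_card_of card_of_card_order_on)
    qed auto
    have F: "|?F| \<le>o |\<kappa> v|"
      by (rule card_Un_le[OF inf\<kappa> D card_UN_le[OF inf\<kappa> I card_finite_le[OF g inf\<kappa>]]])
    have "|(out v \<union> {v}) \<union> (fst ` ?F \<union> snd ` ?F)| \<le>o |\<kappa> v|"
      by (intro card_Un_le[OF inf\<kappa>] card_image_le[OF F] out_le card_finite_le[OF _ inf\<kappa>]) simp
    \<comment> \<open>\<open>out z\<close> has more than \<open>|\<kappa> v|\<close> elements, so
      some \<open>t\<close> in it is not an out-neighbour of \<open>v\<close> and touches no
      forbidden arc. The path runs from \<open>z\<close> through \<open>t\<close> to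
      \<open>v\<close>.\<close>
    then have "\<not> out z \<subseteq> (out v \<union> {v}) \<union> (fst ` ?F \<union> snd ` ?F)"
      using R_out[of v z] e vz card_subset_le not_ordLess_ordLeq by blast
    then obtain t where t: "t \<in> out z" "t \<notin> out v" "t \<noteq> v" "t \<notin> fst ` ?F" "t \<notin> snd ` ?F" by blast
    have "(z, t) \<in> B" "t \<in> W" using t(1) by (auto simp: out_def)
    moreover from this have "(v, t) \<notin> B" using t(2) by (auto simp: out_def)
    moreover have "v \<in> S" using e vz RB BS by auto
    ultimately have zB: "(z, t) \<in> B" "(t, v) \<in> B" using total[of v t] t(3) WS by auto
    have nF: "(z, t) \<notin> ?F" "(t, v) \<notin> ?F"
      using t(5)[THEN contrapos_nn, of "(z, t) \<in> ?F"] t(4)[THEN contrapos_nn, of "(t, v) \<in> ?F"]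
        imageI[of "(z, t)" ?F snd] imageI[of "(t, v)" ?F fst]
      unfolding fst_conv snd_conv by iprover+
    have zt: "(z, t) \<in> B - ?F" and tv: "(t, v) \<in> B - ?F"
      by (rule DiffI[OF zB(1) nF(1)], rule DiffI[OF zB(2) nF(2)])
    show "(snd e, fst e) \<in> (B - ?F)\<^sup>*"
      using rtrancl_into_rtrancl[OF r_into_rtrancl[OF zt] tv] by (simp only: vz fst_conv snd_conv)
  qed
  define B' where "B' = flip B (undirected R)"
  have B'S: "B' \<subseteq> S \<times> S" unfolding B'_def using BS by (rule flip_subset)
  have arc: "(x, y) \<in> B \<and> (x, y) \<notin> R \<or> (y, x) \<in> R" if "(x, y) \<in> B'" for x y
    using that ori RB unfolding B'_def oriented_def
    by (auto simp: in_flip in_undirected split: if_splits)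
  \<comment> \<open>\<open>\<kappa>\<close> still refers to the outdegrees in \<open>B\<close>. The
    arcs that raise its cardinality have been turned, so it cannot rise along an arc of the new
    tournament.\<close>
  have descend: "|\<kappa> y| \<le>o |\<kappa> x|" if "(x, y) \<in> B'" for x y
    using arc[OF that] card_not_less ordLess_imp_ordLeq by (auto simp: R_def)
  have descend_path: "|\<kappa> y| \<le>o |\<kappa> x|" if "(x, y) \<in> B'\<^sup>*" for x y
    using that
  proof (induction rule: rtrancl_induct)
    case (step y z)
    then show ?case using descend ordLeq_transitive by blast
  qed (simp add: card_of_mono1)
  have "|scc B' v \<inter> W| <o |V|" if v: "v \<in> S" for v
  proof (cases "scc B' v \<inter> W = {}")
    case True
    then show ?thesis using infV by (auto intro: card_finite_less)
  next
    case False
    define K where "K = scc B' v"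
    obtain w where w: "w \<in> K" "w \<in> W" using False by (auto simp: K_def)
    have K\<kappa>: "|\<kappa> x| \<le>o |\<kappa> y|" if "x \<in> K" "y \<in> K" for x y
    proof -
      have "(y, x) \<in> B'\<^sup>*" using that unfolding K_def scc_def by (auto intro: rtrancl_trans)
      then show ?thesis by (rule descend_path)
    qed
    have KB: "(x, y) \<in> B" if "(x, y) \<in> B'" "x \<in> K" "y \<in> K" for x y
      using arc[OF that(1)] K\<kappa>[OF that(2,3)] not_ordLess_ordLeq unfolding R_def by blast
    \<comment> \<open>All arcs of \<open>B'\<close> inside \<open>K\<close> belong to
      \<open>B\<close>. A path in \<open>K\<close> that has left \<open>W\<close> can re-enter it
      only at a head of an arc of \<open>C\<close>; so \<open>w\<close> and these heads generate
      \<open>K \<inter> W\<close> along \<open>L\<close>, whose outdegrees are at most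
      \<open>|\<kappa> v|\<close>.\<close>
    define L where "L = {(x, y) \<in> B. x \<in> W \<inter> K \<and> y \<in> W}"
    have "|L\<^sup>* `` insert w (snd ` C)| \<le>o |\<kappa> v|"
    proof (rule card_closure_le[OF inf\<kappa>])
      have "|snd ` C| \<le>o |\<kappa> v|" using C_le G_le ordLeq_transitive by (blast intro: card_image_le)
      then have "|{w} \<union> snd ` C| \<le>o |\<kappa> v|"
        by (intro card_Un_le[OF inf\<kappa> card_finite_le[OF _ inf\<kappa>]]) simp_all
      then show "|insert w (snd ` C)| \<le>o |\<kappa> v|" by simp
      show "|L `` {x}| \<le>o |\<kappa> v|" for x
      proof (cases "x \<in> K")
        case True
        have "v \<in> K" by (simp add: K_def)
        then have "|out x| \<le>o |\<kappa> v|" using out_le K\<kappa>[OF True] ordLeq_transitive by blast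
        then show ?thesis by (rule card_subset_le) (auto simp: L_def out_def)
      next
        case False
        then have "L `` {x} = {}" by (auto simp: L_def)
        then show ?thesis by (simp add: card_of_empty)
      qed
    qed
    moreover have "K \<inter> W \<subseteq> L\<^sup>* `` insert w (snd ` C)"
    proof
      fix y assume y: "y \<in> K \<inter> W"
      have Kw: "scc B' w = K" using scc_eq[of w B' v] w(1) by (simp add: K_def)
      have "(w, y) \<in> B'\<^sup>*" "(y, w) \<in> B'\<^sup>*" using y unfolding Kw[symmetric] by (auto simp: scc_def)
      then have "(w, y) \<in> (B' \<inter> K \<times> K)\<^sup>*" using scc_path[of w y B'] Kw by simp
      then have "y \<in> W \<longrightarrow> y \<in> L\<^sup>* `` insert w (snd ` C)"
      proof (induction rule: rtrancl_induct)
        case (step x y)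
        show ?case
        proof
          assume yW: "y \<in> W"
          have xy: "(x, y) \<in> B" "x \<in> K" "x \<in> S" using step(2) KB B'S by auto
          show "y \<in> L\<^sup>* `` insert w (snd ` C)"
          proof (cases "x \<in> W")
            case True
            then have "(x, y) \<in> L" using xy yW by (simp add: L_def)
            then show ?thesis using step.IH True by (meson Image_iff rtrancl.rtrancl_into_rtrancl)
          next
            case False
            then have "(x, y) \<in> C" using xy yW by (simp add: C_def)
            then have "y \<in> snd ` C" by force
            then show ?thesis by auto
          qed
        qed
      qed auto
      then show "y \<in> L\<^sup>* `` insert w (snd ` C)" using y by blast
    qed
    ultimately have "|K \<inter> W| \<le>o |\<kappa> v|" by (rule card_subset_le)
    then show ?thesis using \<kappa>_less[OF v] ordLeq_ordLess_trans unfolding K_def by blast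
  qed
  moreover have "undirected R \<inter> (S - W) \<times> (S - W) = {}" using R_W by (auto simp: undirected_def)
  moreover have "B' \<inter> (S - W) \<times> W \<subseteq> B" using arc R_W by blast
  ultimately show ?thesis unfolding thins_def using reach B'_def by blast
qed

section \<open>Rays\<close>

lemma rtrancl_leave_start:
  assumes "(x, v) \<in> (A \<inter> X \<times> X)\<^sup>*" "v \<noteq> x"
  shows "\<exists>y. (x, y) \<in> A \<and> y \<in> X - {x} \<and> (y, v) \<in> (A \<inter> (X - {x}) \<times> (X - {x}))\<^sup>*"
  using assms
proof (induction rule: rtrancl_induct)
  case (step y z)
  show ?case
  proof (cases "y = x")
    case True
    then show ?thesis using step.hyps(2) step.prems by blast
  next
    case False
    then obtain w where w: "(x, w) \<in> A" "w \<in> X - {x}" "(w, y) \<in> (A \<inter> (X - {x}) \<times> (X - {x}))\<^sup>*"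
      using step.IH by blast
    moreover have "(y, z) \<in> A \<inter> (X - {x}) \<times> (X - {x})" using False step by blast
    ultimately show ?thesis by (meson rtrancl.rtrancl_into_rtrancl)
  qed
qed simp

text \<open>Koenig's argument. A state records the set already visited and the current vertex, from
  which infinitely many vertices are reachable while avoiding that set; finite outdegree lets some
  successor inherit this.\<close>

lemma infinite_ray:
  assumes "A \<subseteq> W \<times> W" and fin: "\<And>w. finite (A `` {w})" and "infinite (A\<^sup>* `` {w0})" "w0 \<in> W"
  shows "\<exists>\<rho> :: nat \<Rightarrow> 'a. \<rho> 0 = w0 \<and> inj \<rho> \<and> (\<forall>n. (\<rho> n, \<rho> (Suc n)) \<in> A)"
proof -
  define P where "P n s \<longleftrightarrow> (n = 0 \<longrightarrow> s = ({}, w0)) \<and> snd s \<in> W - fst s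
    \<and> infinite ((A \<inter> (W - fst s) \<times> (W - fst s))\<^sup>* `` {snd s})" for n :: nat and s :: "'a set \<times> 'a"
  define Q where "Q s t \<longleftrightarrow> fst t = insert (snd s) (fst s) \<and> (snd s, snd t) \<in> A" for s t :: "'a set \<times> 'a"
  have "\<exists>f. \<forall>n. P n (f n) \<and> Q (f n) (f (Suc n))"
  proof (rule dependent_nat_choice)
    have "A \<inter> W \<times> W = A" using assms(1) by auto
    then show "\<exists>s. P 0 s" using assms(3,4) by (intro exI[of _ "({}, w0)"]) (simp add: P_def)
  next
    fix s n assume s: "P n s"
    obtain F x where Fx: "s = (F, x)" by (cases s)
    let ?X = "W - F"
    let ?R = "\<lambda>y. (A \<inter> (?X - {x}) \<times> (?X - {x}))\<^sup>* `` {y}"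
    have "(A \<inter> ?X \<times> ?X)\<^sup>* `` {x} \<subseteq> insert x (\<Union>y\<in>A `` {x} \<inter> (?X - {x}). ?R y)"
      using rtrancl_leave_start[of x _ A ?X] by blast
    then have "infinite (\<Union>y\<in>A `` {x} \<inter> (?X - {x}). ?R y)"
      using s Fx finite_subset unfolding P_def by fastforce
    then obtain y where y: "y \<in> A `` {x} \<inter> (?X - {x})" "infinite (?R y)" using fin by auto
    moreover have "?X - {x} = W - insert x F" by auto
    ultimately have "P (Suc n) (insert x F, y)" "Q s (insert x F, y)" by (auto simp: P_def Q_def Fx)
    then show "\<exists>t. P (Suc n) t \<and> Q s t" by blast
  qed
  then obtain f where f: "\<And>n. P n (f n)" "\<And>n. Q (f n) (f (Suc n))" by blast
  define \<rho> where "\<rho> n = snd (f n)" for n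
  have "\<rho> i \<in> fst (f n)" if "i < n" for i n
    using that by (induction n) (use f(2) in \<open>auto simp: Q_def \<rho>_def less_Suc_eq\<close>)
  moreover have "\<rho> n \<notin> fst (f n)" for n using f(1)[of n] by (simp add: P_def \<rho>_def)
  ultimately have "\<rho> i \<noteq> \<rho> n" if "i < n" for i n using that by metis
  then have "inj \<rho>" by (metis injI linorder_neqE_nat)
  moreover have "\<rho> 0 = w0" using f(1)[of 0] by (simp add: P_def \<rho>_def)
  moreover have "(\<rho> n, \<rho> (Suc n)) \<in> A" for n using f(2)[of n] by (simp add: Q_def \<rho>_def)
  ultimately show ?thesis by blast
qed

definition ray_arcs :: "(nat \<Rightarrow> 'a) \<Rightarrow> nat set \<Rightarrow> ('a \<times> 'a) set" where
  "ray_arcs \<rho> I = (\<lambda>i. (\<rho> i, \<rho> (Suc i))) ` I"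

lemma excess_ray_arcs:
  assumes "inj \<rho>"
  shows "excess (ray_arcs \<rho> {..<k}) v = of_bool (\<rho> 0 = v) - of_bool (\<rho> k = v)"
proof (induction k)
  case (Suc k)
  have "ray_arcs \<rho> {..<Suc k} = insert (\<rho> k, \<rho> (Suc k)) (ray_arcs \<rho> {..<k})"
    by (auto simp: ray_arcs_def less_Suc_eq)
  moreover have "(\<rho> k, \<rho> (Suc k)) \<notin> ray_arcs \<rho> {..<k}"
    using injD[OF assms] by (auto simp: ray_arcs_def)
  ultimately show ?case using Suc by (simp add: excess_insert ray_arcs_def)
qed (simp add: ray_arcs_def excess_def)

text \<open>
  Almost all vertices of the ray have an arc back to its first vertex \<open>a\<close>.  An initial segment
  closed by such a back arc \<open>(b, a)\<close> is reversed first; afterwards the triangles formed by the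
  reversed back arc, the next arc of the ray and the next back arc are reversed one by one, so that
  in the limit all back arcs are restored.
\<close>

lemma reach_ray:
  assumes tour: "tour W A" and \<rho>: "inj \<rho>" "\<And>n. (\<rho> n, \<rho> (Suc n)) \<in> A" and fin: "finite (A `` {\<rho> 0})"
  shows "reach A (W \<times> W) (undirected (ray_arcs \<rho> UNIV))"
proof -
  have AW: "A \<subseteq> W \<times> W" and ori: "oriented A"
    and total: "\<And>u v. u \<in> W \<Longrightarrow> v \<in> W \<Longrightarrow> u \<noteq> v \<Longrightarrow> (u, v) \<in> A \<or> (v, u) \<in> A"
    using tour by (auto simp: tour_def)
  have \<rho>W: "\<rho> n \<in> W" for n using \<rho>(2) AW by blast
  have \<rho>_eq: "\<rho> i = \<rho> j \<longleftrightarrow> i = j" for i j using \<rho>(1) by (auto dest: injD)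
  have "finite (\<rho> -` (A `` {\<rho> 0}))" using fin \<rho>(1) by (rule finite_vimageI)
  then obtain m0 where m0: "\<rho> -` (A `` {\<rho> 0}) \<subseteq> {..<m0}" using finite_nat_iff_bounded by blast
  \<comment> \<open>From index \<open>m\<close> on, the ray contains no out-neighbour of its first
    vertex, and \<open>m > 0\<close> keeps these vertices apart from \<open>\<rho> 0\<close>; hence
    the back arcs exist.\<close>
  define m where "m = max m0 2"
  define a where "a i = (\<rho> i, \<rho> (Suc i))" for i
  define b where "b n = (\<rho> (m + n), \<rho> 0)" for n
  have bA: "b n \<in> A" for n
  proof -
    have "(\<rho> 0, \<rho> (m + n)) \<notin> A" using m0 unfolding m_def by (auto simp: subset_iff)
    moreover have "\<rho> (m + n) \<noteq> \<rho> 0" by (simp add: \<rho>_eq m_def)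
    ultimately show ?thesis using total[of "\<rho> (m + n)" "\<rho> 0"] \<rho>W by (auto simp: b_def)
  qed
  have aA: "a i \<in> A" for i by (simp add: a_def \<rho>(2))
  have ab: "a i \<noteq> b n" for i n by (simp add: a_def b_def \<rho>_eq)
  have aa: "a i = a j \<longleftrightarrow> i = j" for i j by (simp add: a_def \<rho>_eq)
  have bb: "b i = b j \<longleftrightarrow> i = j" for i j by (simp add: b_def \<rho>_eq)
  have ray: "ray_arcs \<rho> I = a ` I" for I by (auto simp: ray_arcs_def a_def)
  have d: "undirected X \<inter> undirected Y = {}" if "X \<subseteq> A" "Y \<subseteq> A" "X \<inter> Y = {}" for X Y
    using undirected_disjoint[OF ori that] .
  define M where "M n = (case n of 0 \<Rightarrow> {} | Suc k \<Rightarrow> undirected (a ` {..<m + k}) \<union> undirected {b k})" for n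
  define N where "N n = (case n of 0 \<Rightarrow> undirected (a ` {..<m}) \<union> undirected {b 0}
    | Suc k \<Rightarrow> undirected {b k} \<union> undirected {a (m + k), b (Suc k)})" for n
  have symM: "sym (M n)" for n by (auto simp: M_def sym_Un sym_def in_undirected split: nat.splits)
  have dis: "undirected (a ` I) \<inter> undirected {b k} = {}"
    "undirected (a ` {..<m + k}) \<inter> undirected {a (m + k), b (Suc k)} = {}"
    "undirected {b k} \<inter> undirected {a (m + k), b (Suc k)} = {}" for k I
    by (rule d; use aA bA ab aa bb in auto; metis ab)+
  have "reach A (\<Union>n. N n) {f. \<exists>m. \<forall>n\<ge>m. f \<in> M n}"
  proof (rule reach_omega)
    show "M 0 = {}" by (simp add: M_def)
    show "M (Suc n) = symdiff (M n) (N n)" for n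
    proof (cases n)
      case 0
      then show ?thesis by (auto simp: M_def N_def symdiff_def)
    next
      case (Suc k)
      have "{..<Suc (m + k)} = insert (m + k) {..<m + k}" by auto
      then have "undirected (a ` {..<m + k}) \<union> undirected {a (m + k), b (Suc k)}
        = undirected (a ` {..<m + Suc k}) \<union> undirected {b (Suc k)}"
        by (auto simp: undirected_def)
      then show ?thesis using symdiff_telescope[OF dis(1,2,3), of k] Suc by (simp add: M_def N_def)
    qed
    show "reach (flip A (M n)) (N n) (N n)" for n
    proof (cases n)
      case 0
      let ?Z = "insert (b 0) (a ` {..<m})"
      have b0: "b 0 = (\<rho> m, \<rho> 0)" by (simp add: b_def)
      have "b 0 \<notin> a ` {..<m}" using ab[of _ 0] by (metis imageE)
      then have "excess ?Z v = 0" for v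
        using excess_ray_arcs[OF \<rho>(1), of m v] excess_insert[of "a ` {..<m}" "\<rho> m" "\<rho> 0" v]
        unfolding ray b0 by simp
      then have "reach A (undirected ?Z) (undirected ?Z)"
        using aA bA ori by (intro reach_balanced) auto
      moreover have "undirected ?Z = N 0" by (auto simp: N_def undirected_def)
      ultimately show ?thesis using 0 by (simp add: M_def)
    next
      case (Suc k)
      let ?xs = "[\<rho> 0, \<rho> (m + k), \<rho> (Suc (m + k))]"
      let ?Z = "set (zip ?xs (rotate1 ?xs))"
      have Z: "?Z = {(\<rho> 0, \<rho> (m + k)), a (m + k), b (Suc k)}" by (auto simp: a_def b_def)
      have "cycle_arcs ?Z" unfolding cycle_arcs_def
        by (rule exI[of _ ?xs]) (auto simp: \<rho>_eq m_def)
      moreover have "(\<rho> 0, \<rho> (m + k)) \<in> flip A (M n)"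
        using bA[of k] Suc by (auto simp: M_def in_flip undirected_def b_def)
      moreover have "{a (m + k), b (Suc k)} \<subseteq> flip A (M n)"
      proof (rule subset_flip)
        show "{a (m + k), b (Suc k)} \<inter> M n = {}"
          using dis(2,3)[of k] Suc unfolding M_def by (auto simp: undirected_def)
      qed (use aA bA in auto)
      ultimately have "reach (flip A (M n)) (undirected ?Z) (undirected ?Z)"
        unfolding Z by (intro reach_cycle) auto
      moreover have "undirected ?Z = N n" unfolding Z using Suc by (auto simp: N_def undirected_def b_def)
      ultimately show ?thesis by simp
    qed
    fix f :: "'a \<times> 'a"
    obtain u v where f: "f = (u, v)" by (cases f)
    let ?I = "{k \<in> UNIV. (u, v) \<in> undirected {b k}}" and ?J = "{k \<in> UNIV. (u, v) \<in> undirected {a (m + k)}}"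
    have fin: "finite ?I" "finite ?J" by (rule finite_disjoint_family; use aa bb in auto)+
    have "finite (Suc -` ?I)" using fin(1) by (rule finite_vimageI) simp
    then have "finite (insert 0 (Suc ` (?I \<union> ?J \<union> Suc -` ?I)))" using fin by blast
    moreover have "{n. f \<in> N n} \<subseteq> insert 0 (Suc ` (?I \<union> ?J \<union> Suc -` ?I))"
    proof
      fix n assume "n \<in> {n. f \<in> N n}"
      then show "n \<in> insert 0 (Suc ` (?I \<union> ?J \<union> Suc -` ?I))"
        by (cases n) (auto simp: N_def f in_undirected)
    qed
    ultimately show "finite {n. f \<in> N n}" by (rule rev_finite_subset)
  qed
  moreover have "{f. \<exists>m. \<forall>n\<ge>m. f \<in> M n} = undirected (a ` UNIV)"
  proof (intro set_eqI iffI)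
    fix f assume "f \<in> {f. \<exists>m. \<forall>n\<ge>m. f \<in> M n}"
    then obtain l where l: "\<And>n. n \<ge> l \<Longrightarrow> f \<in> M n" by blast
    have "f \<notin> undirected {b l} \<or> f \<notin> undirected {b (Suc l)}"
      using d[of "{b l}" "{b (Suc l)}"] bA bb[of l "Suc l"] by auto
    then show "f \<in> undirected (a ` UNIV)"
      using l[of "Suc l"] l[of "Suc (Suc l)"] by (auto simp: M_def undirected_def)
  next
    fix f assume "f \<in> undirected (a ` UNIV)"
    then obtain i where i: "f \<in> undirected {a i}" by (auto simp: undirected_def)
    have "f \<in> M n" if "n \<ge> Suc i" for n
    proof (cases n)
      case (Suc k)
      then have "{a i} \<subseteq> a ` {..<m + k}" using that by (auto simp: m_def)
      then have "undirected {a i} \<subseteq> undirected (a ` {..<m + k})" by (auto simp: undirected_def)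
      then show ?thesis using i Suc by (auto simp: M_def)
    qed (use that in simp)
    then show "f \<in> {f. \<exists>m. \<forall>n\<ge>m. f \<in> M n}" by blast
  qed
  ultimately have "reach A (\<Union>n. N n) (undirected (ray_arcs \<rho> UNIV))" by (simp add: ray)
  moreover have "(\<Union>n. N n) \<subseteq> W \<times> W"
  proof -
    have "undirected X \<subseteq> W \<times> W" if "X \<subseteq> A" for X using that AW by (auto simp: undirected_def)
    then have "N n \<subseteq> W \<times> W" for n using aA bA by (cases n) (auto simp: N_def image_subset_iff)
    then show ?thesis by blast
  qed
  ultimately show ?thesis by (rule reach_mono)
qed

text \<open>A ray that starts in the finite set \<open>Y\<close> leaves it exactly once more than it
  enters it. Reversal exchanges leaving and entering arcs, so the cut loses exactly one arc.\<close>

lemma card_cut_flip_ray: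
  assumes tour: "tour W A" and \<rho>: "inj \<rho>" "\<And>n. (\<rho> n, \<rho> (Suc n)) \<in> A"
    and Y: "finite Y" "\<rho> 0 \<in> Y" and fin: "finite (A \<inter> Y \<times> (W - Y))" "Y \<subseteq> W"
  shows "Suc (card (flip A (undirected (ray_arcs \<rho> UNIV)) \<inter> Y \<times> (W - Y))) = card (A \<inter> Y \<times> (W - Y))"
proof -
  have AW: "A \<subseteq> W \<times> W" and ori: "oriented A" using tour by (auto simp: tour_def)
  have \<rho>W: "\<rho> n \<in> W" for n using \<rho>(2) AW by blast
  define a where "a i = (\<rho> i, \<rho> (Suc i))" for i
  have inj_a: "inj_on a I" for I using injD[OF \<rho>(1)] by (auto simp: inj_on_def a_def)
  have aA: "a i \<in> A" for i by (simp add: a_def \<rho>(2))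
  have "finite (\<rho> -` Y)" using Y(1) \<rho>(1) by (rule finite_vimageI)
  then obtain k where k: "\<rho> -` Y \<subseteq> {..<k}" using finite_nat_iff_bounded by blast
  let ?out = "{i \<in> {..<k}. \<rho> i \<in> Y \<and> \<rho> (Suc i) \<notin> Y}" and ?in = "{i \<in> {..<k}. \<rho> i \<notin> Y \<and> \<rho> (Suc i) \<in> Y}"
  have "int (card ?out) - int (card ?in)
      = (\<Sum>i<k. of_bool (\<rho> i \<in> Y \<and> \<rho> (Suc i) \<notin> Y) - of_bool (\<rho> i \<notin> Y \<and> \<rho> (Suc i) \<in> Y))"
    by (simp add: sum_subtractf sum_of_bool_eq Int_def conj_commute)
  \<comment> \<open>Departures minus entries telescope; the ray starts in \<open>Y\<close> and is
    outside from \<open>k\<close> on.\<close>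
  also have "\<dots> = (\<Sum>i<k. of_bool (\<rho> i \<in> Y) - of_bool (\<rho> (Suc i) \<in> Y))"
    by (intro sum.cong) auto
  also have "\<dots> = of_bool (\<rho> 0 \<in> Y) - of_bool (\<rho> k \<in> Y)"
    by (rule sum_lessThan_telescope')
  also have "\<dots> = 1" using Y(2) k by auto
  finally have out_in: "card ?out = Suc (card ?in)" by simp
  let ?X = "A \<inter> Y \<times> (W - Y)" and ?U = "undirected (ray_arcs \<rho> UNIV)"
  have U: "(u, v) \<in> ?U \<longleftrightarrow> (\<exists>i. (u, v) = a i \<or> (v, u) = a i)" for u v
    by (auto simp: in_undirected ray_arcs_def a_def)
  have less: "i < k" if "\<rho> i \<in> Y \<or> \<rho> (Suc i) \<in> Y" for i
  proof -
    have "j < k" if "\<rho> j \<in> Y" for j using that k by auto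
    then show ?thesis using that Suc_lessD by blast
  qed
  have out: "a ` ?out \<subseteq> ?X" using aA \<rho>W by (auto simp: a_def)
  have inn: "prod.swap ` a ` ?in \<inter> ?X = {}"
    using aA ori by (auto simp: a_def oriented_def)
  have eq: "flip A ?U \<inter> Y \<times> (W - Y) = (?X - a ` ?out) \<union> prod.swap ` a ` ?in"
  proof (intro set_eqI)
    fix f :: "'a \<times> 'a"
    obtain u v where f: "f = (u, v)" by (cases f)
    have A': "(u, v) \<in> flip A ?U \<longleftrightarrow> ((u, v) \<in> A \<and> (\<forall>i. (u, v) \<noteq> a i)) \<or> (\<exists>i. (v, u) = a i)"
      using aA ori unfolding in_flip U oriented_def by metis
    have "(u, v) \<in> a ` ?out \<longleftrightarrow> (\<exists>i. (u, v) = a i)" if "u \<in> Y" "v \<in> W - Y"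
      using that less by (force simp: a_def image_iff)
    moreover have "(u, v) \<in> prod.swap ` a ` ?in \<longleftrightarrow> (\<exists>i. (v, u) = a i) \<and> u \<in> Y \<and> v \<in> W - Y"
      using less \<rho>W by (force simp: a_def image_iff)
    ultimately show "f \<in> flip A ?U \<inter> Y \<times> (W - Y) \<longleftrightarrow> f \<in> (?X - a ` ?out) \<union> prod.swap ` a ` ?in"
      unfolding f using A' by auto
  qed
  have "card (flip A ?U \<inter> Y \<times> (W - Y)) = card (?X - a ` ?out) + card (prod.swap ` a ` ?in)"
    unfolding eq using fin inn by (intro card_Un_disjoint) auto
  also have "card (?X - a ` ?out) = card ?X - card (a ` ?out)" using out by (intro card_Diff_subset) auto
  also have "card (a ` ?out) = card ?out" by (rule card_image[OF inj_a])
  also have "card (prod.swap ` a ` ?in) = card ?in"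
  proof (subst card_image)
    show "inj_on prod.swap (a ` ?in)" by (rule inj_onI) (metis swap_swap)
  qed (rule card_image[OF inj_a])
  finally have "card (flip A ?U \<inter> Y \<times> (W - Y)) = card ?X - card ?out + card ?in" .
  moreover have "card ?out \<le> card ?X"
    using card_mono[OF fin(1) out] card_image[OF inj_a[of ?out]] by simp
  ultimately show ?thesis using out_in by simp
qed

section \<open>The main induction\<close>

lemma finite_cut: "finite Y \<Longrightarrow> (\<And>w. finite (A `` {w})) \<Longrightarrow> finite (A \<inter> Y \<times> Z)"
  by (rule finite_subset[of _ "Sigma Y (\<lambda>y. A `` {y})"]) auto

text \<open>If arcs leave \<open>Y\<close>, some vertex of \<open>Y\<close> reaches infinitely many
  vertices; otherwise the set reachable from \<open>Y\<close> would be finite with an empty cut,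
  against minimality. Reversing a ray from there lowers the cut of every finite superset of
  \<open>Y\<close> by exactly one, so \<open>Y\<close> stays minimal and induction on the size of
  the cut applies.\<close>

lemma clear_minimal_cut:
  assumes "tour W A" "\<And>w. finite (A `` {w})" "finite Y" "Y \<subseteq> W"
    and "\<And>Z. finite Z \<Longrightarrow> Y \<subseteq> Z \<Longrightarrow> Z \<subseteq> W \<Longrightarrow> card (A \<inter> Y \<times> (W - Y)) \<le> card (A \<inter> Z \<times> (W - Z))"
  shows "\<exists>N. reach A (W \<times> W) N \<and> flip A N \<inter> Y \<times> (W - Y) = {} \<and> (\<forall>w. finite (flip A N `` {w}))"
  using assms
proof (induction "card (A \<inter> Y \<times> (W - Y))" arbitrary: A)
  case 0
  have "finite (A \<inter> Y \<times> (W - Y))" using 0(4,3) by (rule finite_cut)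
  then have "A \<inter> Y \<times> (W - Y) = {}" using 0(1) by simp
  then show ?case using 0(3) reach_mono[OF reach_empty] by (intro exI[of _ "{}"]) auto
next
  case (Suc c)
  note tour = Suc.prems(1) and fin = Suc.prems(2) and min = Suc.prems(5)
  have AW: "A \<subseteq> W \<times> W" using tour by (simp add: tour_def)
  have "\<exists>y\<in>Y. infinite (A\<^sup>* `` {y})"
  proof (rule ccontr)
    assume "\<not> ?thesis"
    then have "finite (\<Union>y\<in>Y. A\<^sup>* `` {y})" using Suc.prems(3) by blast
    moreover have "(\<Union>y\<in>Y. A\<^sup>* `` {y}) = A\<^sup>* `` Y" by blast
    ultimately have finZ: "finite (A\<^sup>* `` Y)" by simp
    have ZW: "A\<^sup>* `` Y \<subseteq> W"
    proof
      fix z assume "z \<in> A\<^sup>* `` Y"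
      then obtain y where y: "y \<in> Y" "(y, z) \<in> A\<^sup>*" by blast
      from y(2) show "z \<in> W" by (cases rule: rtranclE) (use AW Suc.prems(4) y(1) in auto)
    qed
    have "A \<inter> (A\<^sup>* `` Y) \<times> (W - A\<^sup>* `` Y) = {}" by (auto intro: rtrancl_into_rtrancl)
    then show False using min[OF finZ _ ZW] Suc.hyps(2) by fastforce
  qed
  then obtain y where y: "y \<in> Y" "infinite (A\<^sup>* `` {y})" by blast
  then obtain \<rho> :: "nat \<Rightarrow> 'a" where \<rho>: "\<rho> 0 = y" "inj \<rho>" "\<And>n. (\<rho> n, \<rho> (Suc n)) \<in> A"
    using infinite_ray[OF AW fin y(2)] Suc.prems(4) by blast
  define N1 where "N1 = undirected (ray_arcs \<rho> UNIV)"
  define A1 where "A1 = flip A N1"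
  have reach1: "reach A (W \<times> W) N1" unfolding N1_def using tour \<rho>(2,3) fin by (rule reach_ray)
  have tour1: "tour W A1" unfolding A1_def using tour reach_sym[OF reach1] by (rule tour_flip)
  \<comment> \<open>Each vertex gains at most one out-neighbour, its predecessor on the ray.\<close>
  have fin1: "finite (A1 `` {w})" for w
  proof (rule finite_subset)
    show "A1 `` {w} \<subseteq> A `` {w} \<union> \<rho> ` {i. \<rho> (Suc i) = w}"
      using \<rho>(3) unfolding A1_def N1_def ray_arcs_def
      by (auto simp: in_flip in_undirected split: if_splits)
    have "\<rho> i = \<rho> j \<longleftrightarrow> i = j" for i j using \<rho>(2) by (auto dest: injD)
    then have "{i. \<rho> (Suc i) = w} \<subseteq> {i}" if "\<rho> (Suc i) = w" for i using that by auto
    then have "finite {i. \<rho> (Suc i) = w}"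
      by (cases "\<exists>i. \<rho> (Suc i) = w") (auto intro: finite_subset)
    then show "finite (A `` {w} \<union> \<rho> ` {i. \<rho> (Suc i) = w})" using fin by simp
  qed
  have decrease: "Suc (card (A1 \<inter> Z \<times> (W - Z))) = card (A \<inter> Z \<times> (W - Z))"
    if "finite Z" "Y \<subseteq> Z" "Z \<subseteq> W" for Z
    unfolding A1_def N1_def
  proof (rule card_cut_flip_ray[OF tour \<rho>(2,3) that(1)])
    show "\<rho> 0 \<in> Z" using \<rho>(1) y(1) that by auto
    show "finite (A \<inter> Z \<times> (W - Z))" using that(1) fin by (rule finite_cut)
  qed (rule that(3))
  have "\<exists>N. reach A1 (W \<times> W) N \<and> flip A1 N \<inter> Y \<times> (W - Y) = {} \<and> (\<forall>w. finite (flip A1 N `` {w}))"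
  proof (rule Suc.hyps(1)[OF _ tour1 fin1 Suc.prems(3,4)])
    show "c = card (A1 \<inter> Y \<times> (W - Y))"
      using decrease[OF Suc.prems(3) _ Suc.prems(4)] Suc.hyps(2) by simp
    fix Z assume Z: "finite Z" "Y \<subseteq> Z" "Z \<subseteq> W"
    then show "card (A1 \<inter> Y \<times> (W - Y)) \<le> card (A1 \<inter> Z \<times> (W - Z))"
      using min[OF Z] decrease[OF Z] decrease[OF Suc.prems(3) _ Suc.prems(4)] by simp
  qed
  then obtain N2 where N2: "reach A1 (W \<times> W) N2" "flip A1 N2 \<inter> Y \<times> (W - Y) = {}"
    "\<forall>w. finite (flip A1 N2 `` {w})" by blast
  have "reach A (W \<times> W) (symdiff N1 N2)" using reach_trans[OF reach1 N2(1)[unfolded A1_def]] by simp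
  moreover have "flip A (symdiff N1 N2) = flip A1 N2"
    using flip_flip[OF reach_sym[OF reach1] reach_sym[OF N2(1)]] by (simp add: A1_def)
  ultimately show ?case using N2 by (intro exI[of _ "symdiff N1 N2"]) simp
qed

text \<open>Among the finite subsets of \<open>W - Y\<close> containing \<open>F - Y\<close>, one
  with the fewest leaving arcs is cleared. The reversals stay within \<open>W - Y\<close>, so
  \<open>Y\<close> keeps no outgoing arcs and the union is closed.\<close>

lemma extend_closed_set:
  assumes tour: "tour W A" and fin: "\<And>w. finite (A `` {w})" and Y: "finite Y" "Y \<subseteq> W" "A \<inter> Y \<times> (W - Y) = {}"
    and F: "finite F" "F \<subseteq> W"
  shows "\<exists>N Z. reach A ((W - Y) \<times> (W - Y)) N \<and> finite Z \<and> Y \<union> F \<subseteq> Z \<and> Z \<subseteq> W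
    \<and> flip A N \<inter> Z \<times> (W - Z) = {} \<and> (\<forall>w. finite (flip A N `` {w}))"
proof -
  let ?W = "W - Y"
  define A' where "A' = A \<inter> ?W \<times> ?W"
  have fin': "finite (A' `` {w})" for w using fin by (auto simp: A'_def intro: finite_subset[of _ "A `` {w}"])
  define P where "P Z \<longleftrightarrow> finite Z \<and> F - Y \<subseteq> Z \<and> Z \<subseteq> ?W" for Z
  have "P (F - Y)" using F by (auto simp: P_def)
  then obtain Z where Z: "P Z" "\<And>Z'. P Z' \<Longrightarrow> card (A' \<inter> Z \<times> (?W - Z)) \<le> card (A' \<inter> Z' \<times> (?W - Z'))"
    using ex_has_least_nat[of P "F - Y" "\<lambda>Z. card (A' \<inter> Z \<times> (?W - Z))"] by blast
  have tour': "tour ?W A'" unfolding A'_def using tour by (rule tour_restrict) auto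
  have "\<exists>N. reach A' (?W \<times> ?W) N \<and> flip A' N \<inter> Z \<times> (?W - Z) = {} \<and> (\<forall>w. finite (flip A' N `` {w}))"
    using Z by (intro clear_minimal_cut[OF tour' fin']) (auto simp: P_def)
  then obtain N where N: "reach A' (?W \<times> ?W) N" "flip A' N \<inter> Z \<times> (?W - Z) = {}"
    "\<And>w. finite (flip A' N `` {w})" by blast
  have NW: "N \<subseteq> ?W \<times> ?W" using N(1) by (rule reach_subset)
  have "reach A (?W \<times> ?W) N" using N(1) by (rule reach_local) (auto simp: A'_def)
  moreover have "flip A N \<inter> (Y \<union> Z) \<times> (W - (Y \<union> Z)) = {}"
  proof (rule ccontr)
    assume "\<not> ?thesis"
    then obtain x y where xy: "(x, y) \<in> flip A N" "x \<in> Y \<union> Z" "y \<in> W - (Y \<union> Z)" by blast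
    show False
    proof (cases "x \<in> Y")
      case True
      then have "(x, y) \<notin> N" using NW by auto
      then have "(x, y) \<in> A" using xy by (simp add: in_flip)
      then show False using Y(3) True xy by auto
    next
      case False
      then have "x \<in> Z" "x \<in> ?W" "y \<in> ?W" using xy Z(1) by (auto simp: P_def)
      then have "(x, y) \<in> flip A' N" using xy(1) by (auto simp: in_flip A'_def split: if_splits)
      then show False using N(2) \<open>x \<in> Z\<close> xy(3) by auto
    qed
  qed
  moreover have "finite (flip A N `` {w})" for w
  proof (rule finite_subset)
    show "flip A N `` {w} \<subseteq> A `` {w} \<union> flip A' N `` {w}"
      using NW by (auto simp: in_flip A'_def split: if_splits)
  qed (use fin N(3) in auto)
  ultimately show ?thesis using Y(1,2) Z(1)
    by (intro exI[of _ N] exI[of _ "Y \<union> Z"]) (auto simp: P_def)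
qed

text \<open>Closed sets are extended along the enumeration until they exhaust \<open>W\<close>.
  Block \<open>n\<close> acts outside the closed set reached so far, so every pair is touched
  finitely often and closed sets remain closed in the limit.\<close>

lemma exhaust_by_closed_sets:
  assumes tour: "tour W A" and fin: "\<And>w. finite (A `` {w})" and H: "finite H" "H \<subseteq> W"
    and enum: "W \<subseteq> range (en :: nat \<Rightarrow> 'a)"
  shows "\<exists>N. reach A (W \<times> W) N
    \<and> (\<forall>w\<in>W. \<exists>Y. finite Y \<and> insert w H \<subseteq> Y \<and> Y \<subseteq> W \<and> flip A N \<inter> Y \<times> (W - Y) = {})"
proof -
  \<comment> \<open>A state consists of the pairs reversed so far and the current closed
    set.\<close>
  define P where "P n s \<longleftrightarrow> (n = 0 \<longrightarrow> s = ({}, {})) \<and> sym (fst s) \<and> finite (snd s) \<and> snd s \<subseteq> W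
    \<and> flip A (fst s) \<inter> snd s \<times> (W - snd s) = {} \<and> (\<forall>w. finite (flip A (fst s) `` {w}))"
    for n :: nat and s :: "('a \<times> 'a) set \<times> 'a set"
  define Q where "Q n s t \<longleftrightarrow> snd s \<subseteq> snd t \<and> H \<union> ({en n} \<inter> W) \<subseteq> snd t
    \<and> (\<exists>N. reach (flip A (fst s)) ((W - snd s) \<times> (W - snd s)) N \<and> fst t = symdiff (fst s) N)"
    for n :: nat and s t :: "('a \<times> 'a) set \<times> 'a set"
  have "\<exists>f. \<forall>n. P n (f n) \<and> Q n (f n) (f (Suc n))"
  proof (rule dependent_nat_choice)
    show "\<exists>s. P 0 s" using fin by (intro exI[of _ "({}, {})"]) (simp add: P_def)
  next
    fix s n assume s: "P n s"
    let ?A = "flip A (fst s)"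
    have "tour W ?A" using tour s by (intro tour_flip) (simp_all add: P_def)
    then have "\<exists>N Z. reach ?A ((W - snd s) \<times> (W - snd s)) N \<and> finite Z \<and> snd s \<union> (H \<union> ({en n} \<inter> W)) \<subseteq> Z \<and> Z \<subseteq> W
      \<and> flip ?A N \<inter> Z \<times> (W - Z) = {} \<and> (\<forall>w. finite (flip ?A N `` {w}))"
      using s H by (intro extend_closed_set) (auto simp: P_def)
    then obtain N Z where N: "reach ?A ((W - snd s) \<times> (W - snd s)) N" "finite Z"
      "snd s \<union> (H \<union> ({en n} \<inter> W)) \<subseteq> Z" "Z \<subseteq> W" "flip ?A N \<inter> Z \<times> (W - Z) = {}"
      "\<forall>w. finite (flip ?A N `` {w})" by blast
    have "sym (symdiff (fst s) N)" using s reach_sym[OF N(1)] by (auto simp: P_def sym_def symdiff_def)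
    moreover have "flip ?A N = flip A (symdiff (fst s) N)"
      using s reach_sym[OF N(1)] by (intro flip_flip) (simp_all add: P_def)
    ultimately have "P (Suc n) (symdiff (fst s) N, Z)" "Q n s (symdiff (fst s) N, Z)"
      using N by (auto simp: P_def Q_def)
    then show "\<exists>t. P (Suc n) t \<and> Q n s t" by blast
  qed
  then obtain f where f: "\<And>n. P n (f n)" "\<And>n. Q n (f n) (f (Suc n))" by blast
  define M where "M n = fst (f n)" for n
  define Y where "Y n = snd (f n)" for n
  have "\<exists>N. reach (flip A (M n)) ((W - Y n) \<times> (W - Y n)) N \<and> M (Suc n) = symdiff (M n) N" for n
    using f(2)[of n] by (simp add: Q_def M_def Y_def)
  then obtain N where N: "\<And>n. reach (flip A (M n)) ((W - Y n) \<times> (W - Y n)) (N n)"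
    "\<And>n. M (Suc n) = symdiff (M n) (N n)" by metis
  have M0: "M 0 = {}" using f(1)[of 0] by (simp add: P_def M_def)
  have Y: "finite (Y n)" "Y n \<subseteq> W" "flip A (M n) \<inter> Y n \<times> (W - Y n) = {}" for n
    using f(1)[of n] by (auto simp: P_def M_def Y_def)
  have YS: "Y n \<subseteq> Y (Suc n)" "H \<union> ({en n} \<inter> W) \<subseteq> Y (Suc n)" for n
    using f(2)[of n] by (auto simp: Q_def Y_def)
  have Ymono: "Y n \<subseteq> Y k" if "n \<le> k" for n k using YS(1) that by (rule lift_Suc_mono_le)
  define L where "L = {f. \<exists>m. \<forall>n\<ge>m. f \<in> M n}"
  have "reach A (\<Union>n. (W - Y n) \<times> (W - Y n)) L"
    unfolding L_def
  proof (rule reach_omega[where M = M and N = N and T = "\<lambda>n. (W - Y n) \<times> (W - Y n)", OF M0])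
    show "M (Suc n) = symdiff (M n) (N n)" for n by (rule N(2))
    show "reach (flip A (M n)) ((W - Y n) \<times> (W - Y n)) (N n)" for n by (rule N(1))
    fix f :: "'a \<times> 'a"
    show "finite {n. f \<in> (W - Y n) \<times> (W - Y n)}"
    proof (cases "fst f \<in> W")
      case True
      then obtain i where i: "fst f = en i" using enum by blast
      have "n \<le> i" if "f \<in> (W - Y n) \<times> (W - Y n)" for n
      proof (rule ccontr)
        assume "\<not> n \<le> i"
        then have "fst f \<in> Y n" using YS(2)[of i] Ymono[of "Suc i" n] i True by auto
        then show False using that by auto
      qed
      then show ?thesis by (auto intro: finite_subset[of _ "{..i}"])
    next
      case False
      then have "{n. f \<in> (W - Y n) \<times> (W - Y n)} = {}" by auto
      then show ?thesis by (simp only: finite.emptyI)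
    qed
  qed
  then have reachL: "reach A (W \<times> W) L" by (rule reach_mono) blast
  have closed: "flip A L \<inter> Y n \<times> (W - Y n) = {}" for n
  proof -
    have "(x, y) \<in> M k \<longleftrightarrow> (x, y) \<in> M n" if "x \<in> Y n" "n \<le> k" for x y k
      using that(2)
    proof (induction k rule: dec_induct)
      case (step k)
      have "x \<in> Y k" using Ymono[OF step(1)] that(1) by blast
      then have "(x, y) \<notin> N k" using reach_subset[OF N(1)] by blast
      then show ?case using step by (simp add: N(2) symdiff_def)
    qed simp
    note M_const = this
    have "(x, y) \<in> L \<longleftrightarrow> (x, y) \<in> M n" if x: "x \<in> Y n" for x y
    proof
      assume "(x, y) \<in> L"
      then obtain m where "\<forall>k\<ge>m. (x, y) \<in> M k" by (auto simp: L_def)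
      then have "(x, y) \<in> M (max m n)" by simp
      then show "(x, y) \<in> M n" using M_const[OF x, of "max m n"] by simp
    next
      assume "(x, y) \<in> M n"
      then show "(x, y) \<in> L" unfolding L_def using M_const[OF x] by blast
    qed
    then have "(x, y) \<in> flip A L \<longleftrightarrow> (x, y) \<in> flip A (M n)" if "x \<in> Y n" for x y
      using that by (simp add: in_flip)
    then show ?thesis using Y(3)[of n] by blast
  qed
  have "\<exists>n. insert w H \<subseteq> Y n" if "w \<in> W" for w
  proof -
    from enum that obtain i where "w = en i" by blast
    then show ?thesis using YS(2)[of i] that by (intro exI[of _ "Suc i"]) auto
  qed
  then have "\<forall>w\<in>W. \<exists>Y. finite Y \<and> insert w H \<subseteq> Y \<and> Y \<subseteq> W \<and> flip A L \<inter> Y \<times> (W - Y) = {}"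
    using Y(1,2) closed by meson
  with reachL show ?thesis by blast
qed

text \<open>\<open>W\<close> is countable by \<open>card_bounded_outdegree\<close>. A path can
  return to \<open>W\<close> from outside only at one of the finitely many heads of arcs in
  \<open>C\<close>; as the closed sets contain all of these, no path from \<open>w\<close> reaches a
  vertex of \<open>W\<close> outside its closed set.\<close>

lemma thins_countable:
  assumes tour: "tour S B" and WS: "W \<subseteq> S" and inf: "infinite V"
    and cut: "finite (B \<inter> (S - W) \<times> W)" and outW: "\<And>w. w \<in> W \<Longrightarrow> finite (B `` {w} \<inter> W)"
  shows "thins V S B W"
proof -
  have BS: "B \<subseteq> S \<times> S" using tour by (simp add: tour_def)
  define C where "C = B \<inter> (S - W) \<times> W"
  define A where "A = B \<inter> W \<times> W"
  have tourA: "tour W A" unfolding A_def using tour WS by (rule tour_restrict)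
  have finA: "finite (A `` {w})" for w
  proof (cases "w \<in> W")
    case True
    then show ?thesis using outW by (auto simp: A_def intro: finite_subset[of _ "B `` {w} \<inter> W"])
  next
    case False
    then have "A `` {w} = {}" by (auto simp: A_def)
    then show ?thesis by simp
  qed
  have "|W| \<le>o |UNIV :: nat set|"
    using outW by (intro card_bounded_outdegree[OF tour WS order_refl]) (auto intro: card_finite_less)
  then obtain g :: "'a \<Rightarrow> nat" where "inj_on g W" using card_of_ordLeq[of W "UNIV :: nat set"] by auto
  then have en: "W \<subseteq> range (inv_into W g)" by (metis inv_into_f_f rangeI subsetI)
  have C: "finite (snd ` C)" "snd ` C \<subseteq> W" using cut by (auto simp: C_def)
  from exhaust_by_closed_sets[OF tourA finA C en] obtain N where "reach A (W \<times> W) N \<and>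
    (\<forall>w\<in>W. \<exists>Y. finite Y \<and> insert w (snd ` C) \<subseteq> Y \<and> Y \<subseteq> W \<and> flip A N \<inter> Y \<times> (W - Y) = {})"
    by (elim exE)
  then have N: "reach A (W \<times> W) N"
    "\<And>w. w \<in> W \<Longrightarrow> \<exists>Y. finite Y \<and> insert w (snd ` C) \<subseteq> Y \<and> Y \<subseteq> W \<and> flip A N \<inter> Y \<times> (W - Y) = {}"
    by blast+
  have NW: "N \<subseteq> W \<times> W" using N(1) by (rule reach_subset)
  have "reach B (W \<times> W) N" using N(1) by (rule reach_local) (auto simp: A_def)
  then have "reach B (S \<times> S) N" by (rule reach_mono) (use WS in auto)
  moreover have "N \<inter> (S - W) \<times> (S - W) = {}" using NW by auto
  moreover have BC: "flip B N \<inter> (S - W) \<times> W \<subseteq> C" using NW by (auto simp: in_flip C_def split: if_splits)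
  moreover have "finite (scc (flip B N) v \<inter> W)" for v
  proof (cases "scc (flip B N) v \<inter> W = {}")
    case False
    then obtain w where w: "w \<in> scc (flip B N) v" "w \<in> W" by blast
    obtain Y where Y: "finite Y" "insert w (snd ` C) \<subseteq> Y" "Y \<subseteq> W" "flip A N \<inter> Y \<times> (W - Y) = {}"
      using N(2)[OF w(2)] by blast
    have "scc (flip B N) v \<inter> W \<subseteq> Y"
    proof
      fix y assume y: "y \<in> scc (flip B N) v \<inter> W"
      then have "(w, y) \<in> (flip B N)\<^sup>*" using w(1) by (auto simp: scc_def intro: rtrancl_trans)
      then have "y \<in> W \<longrightarrow> y \<in> Y"
      proof (induction rule: rtrancl_induct)
        case (step x y)
        show ?case
        proof
          assume yW: "y \<in> W"
          have "x \<in> S" using step(2) flip_subset[OF BS] by blast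
          show "y \<in> Y"
          proof (cases "x \<in> W")
            case True
            then have "(x, y) \<in> flip A N" using step(2) yW by (auto simp: in_flip A_def split: if_splits)
            then show ?thesis using Y(4) step.IH True yW by blast
          next
            case False
            then have "(x, y) \<in> C" using BC step(2) yW \<open>x \<in> S\<close> by blast
            then have "y \<in> snd ` C" by force
            then show ?thesis using Y(2) by blast
          qed
        qed
      qed (use Y(2) in blast)
      then show "y \<in> Y" using y by blast
    qed
    then show ?thesis using Y(1) finite_subset by blast
  qed simp
  ultimately show ?thesis unfolding thins_def using inf
    by (intro exI[of _ N]) (auto simp: C_def intro: card_finite_less)
qed

section \<open>Descent in cardinality\<close>

lemma card_less_countable_imp_finite:
  assumes "|V| \<le>o |UNIV :: nat set|" "|X| <o |V|" shows "finite X"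
proof (rule ccontr)
  assume "infinite X"
  then have "|UNIV :: nat set| \<le>o |X|" using infinite_iff_card_of_nat by blast
  then have "|V| \<le>o |X|" using assms(1) ordLeq_transitive by blast
  then show False using assms(2) not_ordLess_ordLeq by blast
qed

lemma thins_general:
  fixes B :: "('a \<times> 'a) set"
  assumes tour: "tour S B" and WS: "W \<subseteq> S" and inf: "infinite V"
    and cut: "|B \<inter> (S - W) \<times> W| <o |V|"
    and outW: "\<And>w. w \<in> W \<Longrightarrow> |B `` {w} \<inter> W| <o |V|"
  shows "thins V S B W"
proof (cases "|UNIV :: nat set| <o |V|")
  case True
  then show ?thesis using thins_uncountable[OF tour WS] cut outW by blast
next
  case False
  then have V: "|V| \<le>o |UNIV :: nat set|" using card_not_less by blast
  then show ?thesis
    by (intro thins_countable[OF tour WS inf] card_less_countable_imp_finite[OF V] cut outW)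
qed

text \<open>Both sides of the small cut are thinned in turn. The extra clauses of
  \<open>thins\<close> protect the second application: the first leaves all pairs inside
  \<open>X\<close> alone and creates no arc from \<open>X\<close> to its complement, so the cut and
  the indegrees inside \<open>X\<close> stay small.\<close>

lemma splits_into_smaller:
  fixes A :: "('a \<times> 'a) set"
  assumes tour: "tour V A" and inf: "infinite V"
  shows "splits_into V A (\<lambda>K B. |K| <o |V| )"
proof -
  let ?P = "\<lambda>S B :: ('a \<times> 'a) set. \<exists>X. |B \<inter> (S \<inter> X) \<times> (S - X)| <o |V|
    \<and> (\<forall>w\<in>S - X. |B `` {w} - X| <o |V| ) \<and> (\<forall>x\<in>S \<inter> X. |B\<inverse> `` {x} \<inter> X| <o |V| )"
  let ?Q = "\<lambda>S B :: ('a \<times> 'a) set. \<exists>X. |S - X| <o |V| \<and> |B \<inter> (S \<inter> X) \<times> (S - X)| <o |V|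
    \<and> (\<forall>x\<in>S \<inter> X. |B\<inverse> `` {x} \<inter> X| <o |V| )"
  have "splits_into V A ?Q"
  proof (rule splits_into_refine[OF tour split_by_small_cuts[OF tour inf]])
    fix S and B :: "('a \<times> 'a) set"
    assume tB: "tour S B" and "?P S B"
    then obtain X where X: "|B \<inter> (S \<inter> X) \<times> (S - X)| <o |V|" "\<And>w. w \<in> S - X \<Longrightarrow> |B `` {w} - X| <o |V|"
      "\<And>x. x \<in> S \<inter> X \<Longrightarrow> |B\<inverse> `` {x} \<inter> X| <o |V|" by blast
    have SX: "S - (S - X) = S \<inter> X" by auto
    have BS: "B \<subseteq> S \<times> S" using tB by (simp add: tour_def)
    have "thins V S B (S - X)"
    proof (rule thins_general[OF tB _ inf])
      show "|B \<inter> (S - (S - X)) \<times> (S - X)| <o |V|" unfolding SX by (rule X(1))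
      show "|B `` {w} \<inter> (S - X)| <o |V|" if "w \<in> S - X" for w
        by (rule card_subset_less[OF X(2)[OF that]]) auto
    qed auto
    then obtain N where N: "reach B (S \<times> S) N" "N \<inter> (S \<inter> X) \<times> (S \<inter> X) = {}"
      "flip B N \<inter> (S \<inter> X) \<times> (S - X) \<subseteq> B" "\<And>v. v \<in> S \<Longrightarrow> |scc (flip B N) v \<inter> (S - X)| <o |V|"
      unfolding thins_def SX by blast
    have "?Q K (flip B N \<inter> K \<times> K)" if "v \<in> S" "K = scc (flip B N) v" for v K
    proof (intro exI[of _ X] conjI ballI)
      have KS: "K \<subseteq> S" using that scc_subset[OF flip_subset[OF BS]] by blast
      show "|K - X| <o |V|" using N(4)[OF that(1)] by (rule card_subset_less) (use that(2) KS in auto)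
      show "|flip B N \<inter> K \<times> K \<inter> (K \<inter> X) \<times> (K - X)| <o |V|"
        using X(1) by (rule card_subset_less) (use N(3) KS in blast)
      fix x assume x: "x \<in> K \<inter> X"
      then have "|B\<inverse> `` {x} \<inter> X| <o |V|" using X(3) KS by blast
      then show "|(flip B N \<inter> K \<times> K)\<inverse> `` {x} \<inter> X| <o |V|"
      proof (rule card_subset_less)
        show "(flip B N \<inter> K \<times> K)\<inverse> `` {x} \<inter> X \<subseteq> B\<inverse> `` {x} \<inter> X"
        proof
          fix y assume y: "y \<in> (flip B N \<inter> K \<times> K)\<inverse> `` {x} \<inter> X"
          then have "(y, x) \<notin> N" using N(2) x KS by blast
          then show "y \<in> B\<inverse> `` {x} \<inter> X" using y by (simp add: in_flip)
        qed
      qed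
    qed
    then show "splits_into S B ?Q" unfolding splits_into_def using N(1) by blast
  qed
  then show ?thesis
  proof (rule splits_into_refine[OF tour])
    fix S and B :: "('a \<times> 'a) set"
    assume tB: "tour S B" and "?Q S B"
    then obtain X where X: "|S - X| <o |V|" "|B \<inter> (S \<inter> X) \<times> (S - X)| <o |V|"
      "\<And>x. x \<in> S \<inter> X \<Longrightarrow> |B\<inverse> `` {x} \<inter> X| <o |V|" by blast
    have SX: "S - S \<inter> X = S - X" by auto
    have BS: "B \<subseteq> S \<times> S" using tB by (simp add: tour_def)
    \<comment> \<open>In the opposite tournament, indegrees inside \<open>X\<close> become
      outdegrees and arcs leaving \<open>X\<close> become arcs entering it, while components are
      unchanged.\<close>
    have "thins V S (B\<inverse>) (S \<inter> X)"
    proof (rule thins_general[OF tour_converse[OF tB] _ inf])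
      have "|prod.swap ` (B \<inter> (S \<inter> X) \<times> (S - X))| <o |V|" using X(2) by (rule card_image_less)
      then show "|B\<inverse> \<inter> (S - S \<inter> X) \<times> (S \<inter> X)| <o |V|"
        by (rule card_subset_less) (force simp: image_iff)
      show "|B\<inverse> `` {x} \<inter> (S \<inter> X)| <o |V|" if "x \<in> S \<inter> X" for x
        by (rule card_subset_less[OF X(3)[OF that]]) auto
    qed auto
    then obtain N where N: "reach (B\<inverse>) (S \<times> S) N" "\<And>v. v \<in> S \<Longrightarrow> |scc (flip (B\<inverse>) N) v \<inter> (S \<inter> X)| <o |V|"
      unfolding thins_def by blast
    have "reach B (S \<times> S) N" using reach_converse[OF N(1)] by simp
    moreover have "|scc (flip B N) v| <o |V|" if v: "v \<in> S" for v
    proof -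
      have "scc (flip (B\<inverse>) N) v = scc (flip B N) v"
        using flip_converse[OF reach_sym[OF N(1)]] by simp
      then have "|scc (flip B N) v \<inter> (S \<inter> X) \<union> (S - X)| <o |V|"
        using N(2)[OF v] X(1) card_of_Un_ordLess_infinite[OF inf] by simp
      then show ?thesis
        by (rule card_subset_less) (use scc_subset[OF flip_subset[OF BS] v] in blast)
    qed
    ultimately show "splits_into S B (\<lambda>K B. |K| <o |V| )" unfolding splits_into_def by blast
  qed
qed

text \<open>Cardinals are well-founded under \<open><o\<close>, so the induction hypothesis applies
  inside each component produced by \<open>splits_into_smaller\<close>; a finite tournament is left
  as it is.\<close>

lemma splits_into_finite: "tour V A \<Longrightarrow> splits_into V A (\<lambda>K B. finite K)"
proof (induction V arbitrary: A rule: wf_induct_rule[OF wf_inv_image[OF wf_ordLess, of "\<lambda>V. |V|"]])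
  case (1 V)
  show ?case
  proof (cases "finite V")
    case True
    have "A \<subseteq> V \<times> V" using 1(2) by (simp add: tour_def)
    then have "finite (scc A v)" if "v \<in> V" for v
      using finite_subset[OF scc_subset True] that by blast
    then show ?thesis by (rule splits_into_trivial)
  next
    case False
    show ?thesis
      using splits_into_refine[OF 1(2) splits_into_smaller[OF 1(2) False]] 1(1) by simp
  qed
qed

theorem mainTheorem1:
  fixes D :: "'a pair_pre_digraph"
  assumes "tournament D"
  shows "\<exists>C \<in> (rs D :: ('a ordinals, 'a) cycle_seq set).
           \<forall>H \<in> pre_digraph.sccs (with_proj (reverse_seq D C)). finite (verts H)"
  using assms splits_into_finite by (rule splits_into_finite_imp_theorem)

end
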